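(* Let $\Lambda(\Omega)\subset\mathbb{R}^m$ be a simple generic model set with $\Omega$ symmetric around the origin, let $\mathcal{K}$ be a countable index set, and let $g_k\in W(L^2,\ell^1)$ for every $k\in\mathcal{K}$. Then the family $\{T_\lambda g_k : k\in\mathcal{K},\lambda\in\Lambda(\Omega)\}$ is a normalized tight frame for $L^2(\mathbb{R}^m)$, that is, $$\sum_{k\in\mathcal{K}}\sum_{\lambda\in\Lambda(\Omega)}|\langle f,T_\lambda g_k\rangle|^2=\|f\|_2^2\quad\text{for all } f\in L^2(\mathbb{R}^m),$$ if and only if, for each $\eta\in\Gamma^*$, $$D(\Lambda(\Omega))\,\Phi(-p_2^*(\eta))\sum_{k\in\mathcal{K}}\overline{\widehat{g_k}(t)}\,\widehat{g_k}(t-p_1^*(\eta))=\delta_{\eta,0}\quad\text{for a.e. } t\in\mathbb{R}^m,$$ where $\delta$ is the Kronecker delta.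
   Context: Notation: $T_\lambda f(t)=f(t-\lambda)$; $\widehat f(\omega)=\int_{\mathbb{R}^m} f(t)e^{-2\pi i t\cdot\omega}\,dt$. $W(L^p,\ell^q)$ is the space of measurable functions $f$ on $\mathbb{R}^m$ with $\|f\|_{p,q}=\big(\sum_{k\in\mathbb{Z}^m}\|f\mathbf{1}_{k+[0,1]^m}\|_p^q\big)^{1/q}<\infty$ (usual modification for $q=\infty$). Model sets: let $\Gamma\subset\mathbb{R}^m\times\mathbb{R}$ be a lattice and $p_1:\mathbb{R}^m\times\mathbb{R}\to\mathbb{R}^m$, $p_2:\mathbb{R}^m\times\mathbb{R}\to\mathbb{R}$ the orthogonal projections; assume $p_1|_\Gamma$ and $p_2|_\Gamma$ are injective with dense images in $\mathbb{R}^m$ and $\mathbb{R}$. $\Gamma^*=\{y:\gamma\cdot y\in\mathbb{Z}\ \forall\gamma\in\Gamma\}$ is the dual lattice and $p_1^*,p_2^*$ are the same projections used on $\Gamma^*$ (also injective on $\Gamma^*$ with dense images). For a compact interval $\Omega\subset\mathbb{R}$ with non-empty interior, $\Lambda(\Omega)=\{p_1(\gamma):\gamma\in\Gamma,\ p_2(\gamma)\in\Omega\}$ is a simple model set; it is generic if $p_2(\Gamma)\cap\partial\Omega=\emptyset$. Standing assumption: also $p_2^*(\Gamma^* )\cap\partial\Omega=\emptyset$. Its density is $D(\Lambda(\Omega))=\lim_{R\to\infty}\#(\Lambda(\Omega)\cap(x+R[0,1]^m))/R^m=|\Omega|/\mathrm{vol}(\Gamma)$ (independent of $x\in\mathbb{R}^m$).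 The function $\Phi$: fix $0<\epsilon<1$, put $\Omega_n=(1-\epsilon^n)\Omega$ and let $\psi_n$ be the infinite convolution product over $s=0,1,2,\dots$ of the functions $\mathbf{1}_{\epsilon^{ns}\Omega_n}/|\epsilon^{ns}\Omega_n|$ (convergent in $L^1(\mathbb{R})$), so that $\widehat{\psi_n}(t)=\prod_{s=0}^\infty\mathrm{sinc}(t|\epsilon^{ns}\Omega_n|)$ with $\mathrm{sinc}(t)=\sin(\pi t)/(\pi t)$. Let $\Psi$ be the uniform limit of $\widehat{\psi_n}$ as $n\to\infty$ (namely $\Psi(t)=\mathrm{sinc}(|\Omega|t)$, the Fourier transform of $\mathbf{1}_\Omega/|\Omega|$), and set $\Phi=|\Omega|\cdot(\Psi*\Psi)$. Then $\Phi(0)=1$. *)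

theory Defs
  imports "HOL-Analysis.Analysis"
begin

section \<open>Function spaces, Fourier transform, convolution\<close>

text \<open>Functions are Lebesgue measurable and complex valued; they are not identified modulo null
  sets, so every integral below depends only on the class of its arguments.\<close>

definition L2_space :: "('a::euclidean_space \<Rightarrow> complex) set" where
  "L2_space = {f \<in> borel_measurable lebesgue. integrable lebesgue (\<lambda>t. (cmod (f t))\<^sup>2)}"

definition L2_inner :: "('a::euclidean_space \<Rightarrow> complex) \<Rightarrow> ('a \<Rightarrow> complex) \<Rightarrow> complex" where
  "L2_inner f g = (LINT t|lebesgue. f t * cnj (g t))"

definition L2_norm :: "('a::euclidean_space \<Rightarrow> complex) \<Rightarrow> real" where
  "L2_norm f = sqrt (LINT t|lebesgue. (cmod (f t))\<^sup>2)"

definition translate :: "'a::euclidean_space \<Rightarrow> ('a \<Rightarrow> complex) \<Rightarrow> 'a \<Rightarrow> complex" where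
  "translate l f = (\<lambda>t. f (t - l))"

definition fourier :: "('a::euclidean_space \<Rightarrow> complex) \<Rightarrow> 'a \<Rightarrow> complex" where
  "fourier f w = (LINT t|lebesgue. f t * exp (- (2 * of_real pi * \<i> * of_real (t \<bullet> w))))"

definition convolve :: "(real \<Rightarrow> complex) \<Rightarrow> (real \<Rightarrow> complex) \<Rightarrow> real \<Rightarrow> complex" where
  "convolve f g t = (LINT s|lebesgue. f s * g (t - s))"

definition integer_points :: "(real ^ 'm) set" where
  "integer_points = {k. \<forall>i. k $ i \<in> \<int>}"

text \<open>The amalgam space \<open>W(L^p, l^q)\<close>, for finite exponents \<open>p, q \<ge> 1\<close> only. The first condition
  says that the local norms are finite, the second that their \<open>q\<close>-th powers are summable.\<close>

definition local_Lp_norm :: "real \<Rightarrow> (real ^ 'm \<Rightarrow> complex) \<Rightarrow> real ^ 'm \<Rightarrow> real" where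
  "local_Lp_norm p f k = (LINT t:cbox k (k + vec 1)|lebesgue. cmod (f t) powr p) powr (1 / p)"

definition amalgam_space :: "real \<Rightarrow> real \<Rightarrow> (real ^ 'm \<Rightarrow> complex) set" where
  "amalgam_space p q = {f \<in> borel_measurable lebesgue.
     (\<forall>k \<in> integer_points. set_integrable lebesgue (cbox k (k + vec 1)) (\<lambda>t. cmod (f t) powr p)) \<and>
     (\<lambda>k. local_Lp_norm p f k powr q) summable_on integer_points}"


section \<open>Lattices and model sets\<close>

definition full_lattice :: "'a::euclidean_space set \<Rightarrow> bool" where
  "full_lattice \<Gamma> \<longleftrightarrow> (\<exists>B. independent B \<and> span B = UNIV \<and>
     \<Gamma> = range (\<lambda>c :: 'a \<Rightarrow> int. \<Sum>b\<in>B. of_int (c b) *\<^sub>R b))"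

definition dual_lattice :: "'a::euclidean_space set \<Rightarrow> 'a set" where
  "dual_lattice \<Gamma> = {y. \<forall>\<gamma>\<in>\<Gamma>. \<gamma> \<bullet> y \<in> \<int>}"

definition model_set :: "('a \<times> real) set \<Rightarrow> real set \<Rightarrow> 'a set" where
  "model_set \<Gamma> \<Omega> = {fst \<gamma> | \<gamma>. \<gamma> \<in> \<Gamma> \<and> snd \<gamma> \<in> \<Omega>}"

definition generic_window :: "('a \<times> real) set \<Rightarrow> real set \<Rightarrow> bool" where
  "generic_window \<Gamma> \<Omega> \<longleftrightarrow> snd ` \<Gamma> \<inter> frontier \<Omega> = {}"

text \<open>The common value of the limit for all base points \<open>x\<close>.\<close>

definition set_density :: "(real ^ 'm) set \<Rightarrow> real" where
  "set_density \<Lambda> = (THE d. \<forall>x.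
     ((\<lambda>R. real (card (\<Lambda> \<inter> cbox x (x + vec R))) / R ^ CARD('m)) \<longlongrightarrow> d) at_top)"


section \<open>The function \<open>\<Phi>\<close>\<close>

primrec convolution_prod :: "(nat \<Rightarrow> real \<Rightarrow> complex) \<Rightarrow> nat \<Rightarrow> real \<Rightarrow> complex" where
  "convolution_prod \<phi> 0 = \<phi> 0"
| "convolution_prod \<phi> (Suc N) = convolve (convolution_prod \<phi> N) (\<phi> (Suc N))"

text \<open>The limit in \<open>L\<^sup>1\<close> of the partial convolution products, determined up to a null set.\<close>

definition infinite_convolution :: "(nat \<Rightarrow> real \<Rightarrow> complex) \<Rightarrow> real \<Rightarrow> complex" where
  "infinite_convolution \<phi> = (SOME \<psi>. integrable lebesgue \<psi> \<and>
     (\<lambda>N. \<integral>\<^sup>+ t. ennreal (cmod (convolution_prod \<phi> N t - \<psi> t)) \<partial>lebesgue) \<longlonglongrightarrow> 0)"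

definition normalized_indicator :: "real set \<Rightarrow> real \<Rightarrow> complex" where
  "normalized_indicator S t = of_real (indicator S t / measure lebesgue S)"

definition shrunk_window :: "real \<Rightarrow> real set \<Rightarrow> nat \<Rightarrow> real set" where
  "shrunk_window \<epsilon> \<Omega> n = (\<lambda>x. (1 - \<epsilon> ^ n) * x) ` \<Omega>"

text \<open>For \<open>n = 0\<close> the window degenerates to a point, and \<open>psi_fun \<epsilon> \<Omega> 0\<close> is null; only the limit
  \<open>n \<rightarrow> \<infinity>\<close> is used.\<close>

definition psi_fun :: "real \<Rightarrow> real set \<Rightarrow> nat \<Rightarrow> real \<Rightarrow> complex" where
  "psi_fun \<epsilon> \<Omega> n = infinite_convolution
     (\<lambda>s. normalized_indicator ((\<lambda>x. \<epsilon> ^ (n * s) * x) ` shrunk_window \<epsilon> \<Omega> n))"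

definition Psi_fun :: "real \<Rightarrow> real set \<Rightarrow> real \<Rightarrow> complex" where
  "Psi_fun \<epsilon> \<Omega> = (THE \<Psi>. uniform_limit UNIV (\<lambda>n. fourier (psi_fun \<epsilon> \<Omega> n)) \<Psi> sequentially)"

definition Phi_fun :: "real \<Rightarrow> real set \<Rightarrow> real \<Rightarrow> complex" where
  "Phi_fun \<epsilon> \<Omega> t = of_real (measure lebesgue \<Omega>) * convolve (Psi_fun \<epsilon> \<Omega>) (Psi_fun \<epsilon> \<Omega>) t"

end

theory Submission
  imports Defs "HOL-Probability.Characteristic_Functions"
begin

text \<open>For \<open>f\<close> in \<open>L\<^sup>2\<close> let \<open>G f (x, y)\<close> be the sum of
  \<open>|\<langle>f, T\<^bsub>x + p\<^sub>1 \<gamma>\<^esub> g\<^sub>k\<rangle>|\<^sup>2 1\<^bsub>\<Omega>\<^esub>(y + p\<^sub>2 \<gamma>)\<close> over all \<open>k\<close> and all lattice points \<open>\<gamma>\<close>, so that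
  \<open>G f (0, 0)\<close> is the frame sum. As \<open>G f\<close> is \<open>\<Gamma>\<close>-periodic on \<open>\<real>\<^sup>m \<times> \<real>\<close>, it is determined almost
  everywhere by its Fourier coefficients. Unfolding the integral over a fundamental domain and
  applying Parseval's identity to the correlations of \<open>f\<close> and \<open>g\<^sub>k\<close> shows that the coefficient at \<open>\<eta>\<close> is
  the integral of \<open>F(t) cnj (F(t - p\<^sub>1 \<eta>))\<close>, where \<open>F\<close> is the Fourier transform of \<open>f\<close>, against the Gramian sum at \<open>\<eta>\<close>, times the Fourier transform of
  \<open>1\<^bsub>\<Omega>\<^esub>\<close> at \<open>p\<^sub>2 \<eta>\<close>; the latter is \<open>|\<Omega>| \<Phi>(- p\<^sub>2 \<eta>)\<close>. Hence the Gramian equations hold iff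
  \<open>G f = \<parallel>f\<parallel>\<^sup>2\<close> almost everywhere for every test function \<open>f\<close>.

  The remaining point is to pass from almost every \<open>(x, y)\<close> to \<open>(0, 0)\<close> and back. Translating \<open>f\<close>
  handles \<open>x\<close>. A tight frame for \<open>\<Lambda>(\<Omega>)\<close> is a Bessel system for every compact window, because
  finitely many lattice shifts of \<open>\<Omega>\<close> cover it; so \<open>G f (x, \<cdot>)\<close> is continuous, by dominated convergence, off the countable set of
  \<open>y\<close> for which \<open>y + p\<^sub>2(\<Gamma>)\<close> meets the boundary of \<open>\<Omega>\<close>. Genericity says that \<open>0\<close> is not in this set.\<close>

section \<open>Lebesgue measure and countable sums\<close>

text \<open>The coefficients exist only once the sum over \<open>k\<close> of the squared
  correlations is integrable on \<open>\<real>^m\<close>. The two directions obtain this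
  differently: a tight frame by integrating its constant value over a fundamental domain, the
  Gramian equations through the one at \<open>\<eta> = 0\<close>, which makes the sum over
  \<open>k\<close> of \<open>|fourier (g k) t|^2\<close> constant in \<open>t\<close>. At (0, 0) the
  upper and the lower bound are of different depth. Fatou's lemma loses mass in the harmless
  direction, so the upper bound survives a limit along points of full measure approaching the
  origin. It gives the Bessel bound for all windows, and this bound controls the error made in the
  lower bound when such a point is moved to the origin. \<open>\<Phi>\<close> is the transform of
  the normalized window because, as \<open>n\<close> grows, all factors of the infinite convolution
  but the first shrink to a point mass, and because the self-convolution of \<open>\<Psi>\<close> is
  the transform of a squared indicator, which \<open>|\<Omega>|\<close> rescales. The density
  \<open>|\<Omega>| / vol(\<Gamma>)\<close> normalizes the coefficients and is found by counting
  lattice points.\<close>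

definition ue :: "real \<Rightarrow> complex" where "ue x = cis (2 * pi * x)"

lemma ue_0 [simp]: "ue 0 = 1" and norm_ue [simp]: "cmod (ue x) = 1"
  by (simp_all add: ue_def)

lemma ue_add: "ue (x + y) = ue x * ue y"
  by (simp add: ue_def cis_mult distrib_left)

lemma ue_minus: "ue (- x) = cnj (ue x)"
  by (simp add: ue_def cis_cnj)

lemma ue_diff: "ue (x - y) = ue x * cnj (ue y)"
  using ue_add[of x "- y"] by (simp add: ue_minus)

lemma ue_mult_cnj [simp]: "cnj (ue x) * ue x = 1"
  by (simp add: ue_def cis_cnj cis_mult)

lemma ue_Ints: "x \<in> \<int> \<Longrightarrow> ue x = 1"
  by (auto simp: ue_def elim!: Ints_cases intro!: cis_multiple_2pi)

lemma continuous_ue [continuous_intros]: "continuous F f \<Longrightarrow> continuous F (\<lambda>x. ue (f x))"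
  unfolding ue_def cis_conv_exp by (intro continuous_intros)

lemma continuous_on_ue [continuous_intros]: "continuous_on S f \<Longrightarrow> continuous_on S (\<lambda>x. ue (f x))"
  unfolding ue_def cis_conv_exp by (intro continuous_intros)

lemma ue_measurable [measurable (raw)]: "f \<in> borel_measurable M \<Longrightarrow> (\<lambda>x. ue (f x)) \<in> borel_measurable M"
  by (rule measurable_compose[OF _ borel_measurable_continuous_onI]) (auto intro: continuous_intros)

lemma cnj_measurable [measurable (raw)]: "f \<in> borel_measurable M \<Longrightarrow> (\<lambda>x. cnj (f x)) \<in> borel_measurable M"
  by (rule measurable_compose[OF _ borel_measurable_continuous_onI]) (auto intro: continuous_intros)

lemma fourier_ue: "fourier f w = (LINT t|lebesgue. f t * ue (- (t \<bullet> w)))"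
  unfolding fourier_def ue_def cis_conv_exp by (simp add: algebra_simps)

text \<open>Products of \<open>lborel\<close> are again \<open>lborel\<close>, so Fubini arguments
  stay in one family of measures; functions are therefore taken to be Borel until the final passage
  to representatives.\<close>

lemma fourier_lborel:
  assumes "f \<in> borel_measurable borel"
  shows "fourier f w = (LINT t|lborel. f t * ue (- (t \<bullet> w)))"
  unfolding fourier_ue by (rule integral_completion) (use assms in measurable)

section \<open>Translation and dilation of Lebesgue measure\<close>

lemma nn_integral_lborel_shift:
  fixes f :: "'a::euclidean_space \<Rightarrow> ennreal"
  assumes [measurable]: "f \<in> borel_measurable borel"
  shows "(\<integral>\<^sup>+x. f (a + x) \<partial>lborel) = (\<integral>\<^sup>+x. f x \<partial>lborel)"
proof -
  have "(\<integral>\<^sup>+x. f x \<partial>lborel) = (\<integral>\<^sup>+x. f x \<partial>distr lborel borel ((+) a))"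
    by (subst lborel_distr_plus) simp
  then show ?thesis by (subst (asm) nn_integral_distr) auto
qed

lemma integral_lborel_shift:
  fixes f :: "'a::euclidean_space \<Rightarrow> 'b::{banach, second_countable_topology}"
  assumes [measurable]: "f \<in> borel_measurable borel"
  shows "(LINT x|lborel. f (a + x)) = (LINT x|lborel. f x)"
proof -
  have "(LINT x|lborel. f x) = (LINT x|distr lborel borel ((+) a). f x)"
    by (subst lborel_distr_plus) simp
  then show ?thesis by (subst (asm) integral_distr) auto
qed

lemma integrable_lborel_shift:
  fixes f :: "'a::euclidean_space \<Rightarrow> 'b::{banach, second_countable_topology}"
  assumes "integrable lborel f"
  shows "integrable lborel (\<lambda>x. f (a + x))"
proof -
  have [measurable]: "f \<in> borel_measurable borel" using assms by auto
  have "integrable (distr lborel borel ((+) a)) f"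
    by (subst lborel_distr_plus) (use assms in simp)
  then show ?thesis by (subst (asm) integrable_distr_eq) auto
qed

lemma AE_lborel_shift:
  fixes a :: "'a::euclidean_space"
  assumes "AE x in lborel. P x"
  shows "AE x in lborel. P (a + x)"
proof -
  \<comment> \<open>\<open>P\<close> may be non-measurable, so the exceptional set is enlarged to a
    Borel null set before it is pulled back.\<close>
  obtain N where N: "N \<in> null_sets lborel" "{x. \<not> P x} \<subseteq> N"
    using assms by (auto elim!: AE_E simp: null_sets_def)
  then have [measurable]: "N \<in> sets borel" by (auto simp: null_sets_def)
  have "AE x in distr lborel borel ((+) a). x \<notin> N"
    by (subst lborel_distr_plus) (use N AE_not_in in blast)
  then have "AE x in lborel. a + x \<notin> N"
    by (subst (asm) AE_distr_iff) auto
  then show ?thesis by eventually_elim (use N in auto)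
qed

lemma integral_lborel_scale:
  fixes f :: "'a::euclidean_space \<Rightarrow> complex"
  assumes [measurable]: "f \<in> borel_measurable borel" and c: "c > 0"
  shows "(LINT x|lborel. f (c *\<^sub>R x)) * of_real c ^ DIM('a) = (LINT x|lborel. f x)"
proof -
  have *: "lborel = density (distr lborel borel (\<lambda>x::'a. 0 + c *\<^sub>R x)) (\<lambda>_. ennreal (\<bar>c\<bar> ^ DIM('a)))"
    by (rule lborel_affine) (use c in auto)
  have "(LINT x|lborel. f x) = (LINT x|lborel. (c ^ DIM('a)) *\<^sub>R f (c *\<^sub>R x))"
    by (subst *, subst integral_density) (use c in \<open>auto simp: integral_distr\<close>)
  then show ?thesis by (simp add: scaleR_conv_of_real)
qed

text \<open>In \<open>ennreal\<close> the unordered sum is the supremum of the finite partial sums;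
  an enumeration of \<open>A\<close> exhausts it, and monotone convergence gives the integral. As an
  integral the sum is open to Tonelli, Fatou and dominated convergence.\<close>

lemma infsum_ennreal_eq_nn_integral:
  fixes f :: "'a \<Rightarrow> ennreal"
  assumes "countable A"
  shows "infsum f A = (\<integral>\<^sup>+x. f x \<partial>count_space A)"
proof (cases "A = {}")
  case False
  define F where "F n = from_nat_into A ` {..n}" for n
  have F: "finite (F n)" "F n \<subseteq> A" for n
    using from_nat_into[OF False] by (auto simp: F_def)
  have UF: "(\<Union>n. F n) = A"
  proof -
    have "(\<Union>n. F n) = range (from_nat_into A)" by (auto simp: F_def)
    then show ?thesis using range_from_nat_into[OF False assms] by simp
  qed
  have inc: "incseq F" by (force simp: F_def incseq_def)
  have fin: "(\<integral>\<^sup>+x. f x * indicator B x \<partial>count_space A) = sum f B" if "finite B" "B \<subseteq> A" for B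
    by (subst nn_integral_count_space'[of B]) (use that in \<open>auto simp: indicator_def\<close>)
  have "infsum f A = (SUP F\<in>{F. finite F \<and> F \<subseteq> A}. sum f F)"
    by (rule nonneg_infsum_complete) simp
  also have "\<dots> = (\<integral>\<^sup>+x. f x \<partial>count_space A)"
  proof (rule antisym)
    show "(SUP F\<in>{F. finite F \<and> F \<subseteq> A}. sum f F) \<le> (\<integral>\<^sup>+x. f x \<partial>count_space A)"
      by (rule SUP_least) (auto simp flip: fin intro!: nn_integral_mono simp: indicator_def)
    have "(\<integral>\<^sup>+x. f x \<partial>count_space A) = (\<integral>\<^sup>+x. (SUP n. f x * indicator (F n) x) \<partial>count_space A)"
    proof (rule nn_integral_cong)
      fix x assume "x \<in> space (count_space A)"
      then obtain n where "x \<in> F n" using UF by auto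
      then show "f x = (SUP n. f x * indicator (F n) x)"
        by (intro antisym SUP_upper2[of n] SUP_least) (auto simp: indicator_def)
    qed
    also have "\<dots> = (SUP n. (\<integral>\<^sup>+x. f x * indicator (F n) x \<partial>count_space A))"
      by (rule nn_integral_monotone_convergence_SUP)
        (use inc in \<open>auto simp: incseq_def le_fun_def indicator_def\<close>)
    also have "\<dots> \<le> (SUP F\<in>{F. finite F \<and> F \<subseteq> A}. sum f F)"
      by (rule SUP_least, subst fin) (use F in \<open>auto intro: SUP_upper\<close>)
    finally show "(\<integral>\<^sup>+x. f x \<partial>count_space A) \<le> (SUP F\<in>{F. finite F \<and> F \<subseteq> A}. sum f F)" .
  qed
  finally show ?thesis .
qed (simp add: nn_integral_count_space_finite)

lemma measurable_pair_measure_countable2: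
  assumes "countable A" "\<And>a. a \<in> A \<Longrightarrow> f a \<in> measurable M N"
  shows "(\<lambda>(x, a). f a x) \<in> measurable (M \<Otimes>\<^sub>M count_space A) N"
proof -
  have "(\<lambda>(a, x). f a x) \<in> measurable (count_space A \<Otimes>\<^sub>M M) N"
    by (rule measurable_pair_measure_countable1) (use assms in auto)
  from measurable_compose[OF measurable_pair_swap' this] show ?thesis
    by (simp add: case_prod_beta)
qed

lemma borel_measurable_nn_integral_count_space:
  fixes f :: "'a \<Rightarrow> 'b \<Rightarrow> ennreal"
  assumes "countable A" "\<And>a. a \<in> A \<Longrightarrow> f a \<in> borel_measurable M"
  shows "(\<lambda>x. \<integral>\<^sup>+a. f a x \<partial>count_space A) \<in> borel_measurable M"
  by (rule sigma_finite_measure.borel_measurable_nn_integral[OF sigma_finite_measure_count_space_countable])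
    (use assms in \<open>auto intro!: measurable_pair_measure_countable2\<close>)

text \<open>Unordered summability of complex families is absolute summability, which is what Bochner
  integrability against counting measure expresses.\<close>

lemma summable_on_iff_integrable_count_space:
  fixes f :: "'a \<Rightarrow> complex"
  shows "f summable_on A \<longleftrightarrow> integrable (count_space A) f"
proof -
  have "f summable_on A \<longleftrightarrow> Infinite_Set_Sum.abs_summable_on f A"
    using summable_on_iff_abs_summable_on_complex abs_summable_equivalent by blast
  then show ?thesis
    by (simp add: Infinite_Set_Sum.abs_summable_on_def)
qed

lemma infsum_eq_integral_count_space:
  fixes f :: "'a \<Rightarrow> complex"
  assumes "f summable_on A"
  shows "infsum f A = (LINT x|count_space A. f x)"
  using assms by (metis abs_summable_equivalent infsetsum_def infsetsum_infsum summable_on_iff_abs_summable_on_complex)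

text \<open>The tests \<open>min 1 (n * dist(x, -U))\<close> increase to the indicator of a bounded
  open \<open>U\<close>, so \<open>p\<close> integrates to zero over all bounded open sets. On each
  ball the positive and negative parts of \<open>p\<close> are then densities of finite measures
  agreeing on the open sets, an intersection-stable generator, hence they agree almost
  everywhere.\<close>

lemma AE_zero_real_test:
  fixes p :: "'a::euclidean_space \<Rightarrow> real"
  assumes [measurable]: "p \<in> borel_measurable borel"
    and int: "\<And>R. integrable lborel (\<lambda>x. indicator (ball 0 R) x * p x)"
    and test: "\<And>\<phi>. continuous_on UNIV \<phi> \<Longrightarrow> (\<And>x. 0 \<le> \<phi> x) \<Longrightarrow> bounded {x. \<phi> x \<noteq> 0} \<Longrightarrow> (LINT x|lborel. p x * \<phi> x) = 0"
  shows "AE x in lborel. p x = 0"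
proof -
  have opn: "(LINT x|lborel. indicator U x * p x) = 0" if U: "open U" "bounded U" for U
  proof -
    obtain R where R: "U \<subseteq> ball 0 R" using U(2) bounded_subset_ballD by blast
    define \<phi> where "\<phi> n x = min 1 (real n * infdist x (- U))" for n x
    \<comment> \<open>The distance to the empty set is 0 by convention and would make every
      \<open>\<phi> n\<close> vanish; boundedness of \<open>U\<close> rules this out.\<close>
    have ne: "- U \<noteq> {}" using U(2) not_bounded_UNIV by (metis double_compl Compl_empty_eq)
    have 0: "\<phi> n x = 0" if "x \<notin> U" for n x using that by (simp add: \<phi>_def)
    have 1: "0 \<le> \<phi> n x" "\<phi> n x \<le> 1" for n x by (auto simp: \<phi>_def infdist_nonneg)
    have c: "continuous_on UNIV (\<phi> n)" for n unfolding \<phi>_def by (intro continuous_intros)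
    have [measurable]: "\<phi> n \<in> borel_measurable borel" for n using c by (rule borel_measurable_continuous_onI)
    have [measurable]: "U \<in> sets borel" using U by auto
    have "(\<lambda>n. LINT x|lborel. p x * \<phi> n x) \<longlonglongrightarrow> (LINT x|lborel. indicator U x * p x)"
    proof (rule integral_dominated_convergence[where w="\<lambda>x. norm (indicator (ball 0 R) x * p x)"])
      show "AE x in lborel. (\<lambda>n. p x * \<phi> n x) \<longlonglongrightarrow> indicator U x * p x"
      proof (rule AE_I2)
        fix x
        show "(\<lambda>n. p x * \<phi> n x) \<longlonglongrightarrow> indicator U x * p x"
        proof (cases "x \<in> U")
          case True
          then have pos: "infdist x (- U) > 0"
            using U ne by (intro infdist_pos_not_in_closed) auto
          have "eventually (\<lambda>n. \<phi> n x = 1) sequentially"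
          proof -
            obtain N where "1 / infdist x (-U) < real N" using reals_Archimedean2 by blast
            then have "\<phi> n x = 1" if "n \<ge> N" for n
            proof -
              have "1 / infdist x (-U) \<le> real n" using that \<open>1 / infdist x (-U) < real N\<close> by linarith
              then show ?thesis using pos by (simp add: \<phi>_def field_simps min_def)
            qed
            then show ?thesis by (auto simp: eventually_sequentially)
          qed
          then have "(\<lambda>n. p x * \<phi> n x) \<longlonglongrightarrow> p x"
            by (rule tendsto_eventually[OF eventually_mono]) simp
          then show ?thesis using True by simp
        qed (simp add: 0)
      qed
      show "integrable lborel (\<lambda>x. norm (indicator (ball 0 R) x * p x))" using int by (rule integrable_norm)
      show "AE x in lborel. norm (p x * \<phi> n x) \<le> norm (indicator (ball 0 R) x * p x)" for n
      proof (rule AE_I2)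
        fix x show "norm (p x * \<phi> n x) \<le> norm (indicator (ball 0 R) x * p x)"
          using R 0[of x n] 1[of n x] by (cases "x \<in> U") (auto simp: abs_mult mult_left_le)
      qed
    qed measurable
    moreover have "(LINT x|lborel. p x * \<phi> n x) = 0" for n
      by (rule test[OF c 1(1)]) (rule bounded_subset[OF U(2)], use 0 in blast)
    ultimately show ?thesis by (simp add: LIMSEQ_const_iff)
  qed
  have "AE x in lborel. x \<in> ball 0 (real n) \<longrightarrow> p x = 0" for n
  proof -
    let ?B = "ball (0::'a) (real n)"
    define q where "q x = indicator ?B x * p x" for x
    have [measurable]: "?B \<in> sets borel" by simp
    have [measurable]: "q \<in> borel_measurable borel" unfolding q_def by measurable
    have qi: "integrable lborel q" unfolding q_def using int .
    let ?P = "\<lambda>x. ennreal (q x)" and ?N = "\<lambda>x. ennreal (- q x)"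
    have fin: "(\<integral>\<^sup>+x. ?P x \<partial>lborel) \<noteq> \<infinity>" "(\<integral>\<^sup>+x. ?N x \<partial>lborel) \<noteq> \<infinity>"
      using qi by (auto simp: real_integrable_def)
    have "density lborel ?P = density lborel ?N"
    proof (rule measure_eqI_generator_eq[where E="{U. open U}" and A="\<lambda>_. UNIV" and \<Omega>=UNIV])
      show "Int_stable {U::'a set. open U}" by (auto simp: Int_stable_def)
      fix U :: "'a set" assume "U \<in> {U. open U}"
      then have U: "open U" by simp
      then have [measurable]: "U \<in> sets borel" by auto
      let ?r = "\<lambda>x. indicator U x * q x"
      have ri: "integrable lborel ?r" using integrable_real_mult_indicator[of U lborel q] qi by (simp add: mult.commute)
      have fin': "(\<integral>\<^sup>+x. ennreal (?r x) \<partial>lborel) \<noteq> \<infinity>" "(\<integral>\<^sup>+x. ennreal (- ?r x) \<partial>lborel) \<noteq> \<infinity>"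
        using ri by (auto simp: real_integrable_def)
      have "(LINT x|lborel. indicator (U \<inter> ?B) x * p x) = 0"
        by (rule opn) (use U bounded_ball in \<open>auto intro: bounded_Int\<close>)
      then have "(LINT x|lborel. ?r x) = 0" by (simp add: q_def indicator_inter_arith mult.assoc)
      then have "enn2real (\<integral>\<^sup>+x. ennreal (?r x) \<partial>lborel) = enn2real (\<integral>\<^sup>+x. ennreal (- ?r x) \<partial>lborel)"
        using real_lebesgue_integral_def[OF ri] by simp
      then have "(\<integral>\<^sup>+x. ennreal (?r x) \<partial>lborel) = (\<integral>\<^sup>+x. ennreal (- ?r x) \<partial>lborel)"
        using fin' by (metis (lifting) ennreal_enn2real infinity_ennreal_def less_top)
      moreover have "(\<integral>\<^sup>+x. ennreal (?r x) \<partial>lborel) = emeasure (density lborel ?P) U"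
        by (subst emeasure_density) (auto intro!: nn_integral_cong split: split_indicator)
      moreover have "(\<integral>\<^sup>+x. ennreal (- ?r x) \<partial>lborel) = emeasure (density lborel ?N) U"
        by (subst emeasure_density) (auto intro!: nn_integral_cong split: split_indicator)
      ultimately show "emeasure (density lborel ?P) U = emeasure (density lborel ?N) U" by simp
    next
      show "sets (density lborel ?P) = sigma_sets UNIV {U. open U}"
        unfolding sets_density sets_lborel by (subst borel_def) simp
      show "sets (density lborel ?N) = sigma_sets UNIV {U. open U}"
        unfolding sets_density sets_lborel by (subst borel_def) simp
      show "emeasure (density lborel ?P) UNIV \<noteq> \<infinity>" using fin by (simp add: emeasure_density)
    qed auto
    then have "AE x in lborel. ?P x = ?N x"
      by (subst (asm) sigma_finite_measure.density_unique_iff[OF sigma_finite_lborel]) auto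
    then show ?thesis
    proof eventually_elim
      case (elim x)
      then have "q x = 0" by (cases "q x \<ge> 0") (auto simp: ennreal_neg ennreal_eq_0_iff)
      then show ?case by (auto simp: q_def indicator_def)
    qed
  qed
  then have "AE x in lborel. \<forall>n. x \<in> ball 0 (real n) \<longrightarrow> p x = 0" by (intro AE_all_countable[THEN iffD2] allI)
  then show ?thesis
  proof eventually_elim
    case (elim x)
    obtain n where "norm x < real n" using reals_Archimedean2 by blast
    then show ?case using elim[rule_format, of n] by simp
  qed
qed

lemma continuous_bounded_support:
  fixes \<phi> :: "'a::euclidean_space \<Rightarrow> real"
  assumes c: "continuous_on UNIV \<phi>" and b: "bounded {x. \<phi> x \<noteq> 0}"
  shows "\<exists>R B. 0 \<le> B \<and> (\<forall>x. \<bar>\<phi> x\<bar> \<le> B * indicator (ball 0 R) x)"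
proof -
  obtain R where R: "{x. \<phi> x \<noteq> 0} \<subseteq> ball 0 R" using b bounded_subset_ballD by blast
  have "compact (\<phi> ` cball 0 R)" by (intro compact_continuous_image continuous_on_subset[OF c]) auto
  from compact_imp_bounded[OF this] obtain B where "\<forall>y\<in>\<phi> ` cball 0 R. norm y \<le> B"
    unfolding bounded_iff by blast
  then have B: "\<And>x. x \<in> cball 0 R \<Longrightarrow> \<bar>\<phi> x\<bar> \<le> B" by auto
  have "\<bar>\<phi> x\<bar> \<le> \<bar>B\<bar> * indicator (ball 0 R) x" for x
  proof (cases "\<phi> x = 0")
    case False
    then have "x \<in> ball 0 R" using R by blast
    then show ?thesis using B[of x] by auto
  qed simp
  then show ?thesis using abs_ge_zero by blast
qed

lemma AE_zero_test:
  fixes p :: "'a::euclidean_space \<Rightarrow> complex"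
  assumes [measurable]: "p \<in> borel_measurable borel"
    and int: "\<And>R. integrable lborel (\<lambda>x. indicator (ball 0 R) x * p x)"
    and test: "\<And>\<phi>. continuous_on UNIV \<phi> \<Longrightarrow> (\<And>x. 0 \<le> \<phi> x) \<Longrightarrow> bounded {x. \<phi> x \<noteq> 0} \<Longrightarrow> (LINT x|lborel. p x * of_real (\<phi> x)) = 0"
  shows "AE x in lborel. p x = 0"
proof -
  have i: "integrable lborel (\<lambda>x. p x * of_real (\<phi> x))"
    if c: "continuous_on UNIV \<phi>" and b: "bounded {x. \<phi> x \<noteq> 0}" for \<phi> :: "'a \<Rightarrow> real"
  proof -
    have [measurable]: "\<phi> \<in> borel_measurable borel" using c by (rule borel_measurable_continuous_onI)
    obtain R B where B: "0 \<le> B" "\<And>x. \<bar>\<phi> x\<bar> \<le> B * indicator (ball 0 R) x"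
      using continuous_bounded_support[OF c b] by blast
    show ?thesis
    proof (rule Bochner_Integration.integrable_bound[where f="\<lambda>x. B * norm (indicator (ball 0 R) x * p x)"])
      show "AE x in lborel. norm (p x * of_real (\<phi> x)) \<le> norm (B * norm (indicator (ball 0 R) x * p x))"
      proof (rule AE_I2)
        fix x show "norm (p x * of_real (\<phi> x)) \<le> norm (B * norm (indicator (ball 0 R) x * p x))"
          using mult_right_mono[OF B(2)[of x] norm_ge_zero[of "p x"]] B(1)
          by (cases "norm x < R") (simp_all add: norm_mult abs_mult mult_ac)
      qed
    qed (use int in auto)
  qed
  have "AE x in lborel. Re (p x) = 0"
  proof (rule AE_zero_real_test)
    show "integrable lborel (\<lambda>x. indicator (ball 0 R) x * Re (p x))" for R
    proof -
      have "(\<lambda>x. indicator (ball 0 R) x * Re (p x)) = (\<lambda>x. Re (indicator (ball 0 R) x * p x))"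
        by (auto simp: indicator_def)
      then show ?thesis using integrable_Re[OF int[of R]] by simp
    qed
    fix \<phi> :: "'a \<Rightarrow> real" assume \<phi>: "continuous_on UNIV \<phi>" "\<And>x. 0 \<le> \<phi> x" "bounded {x. \<phi> x \<noteq> 0}"
    have "(LINT x|lborel. Re (p x * of_real (\<phi> x))) = Re (LINT x|lborel. p x * of_real (\<phi> x))"
      by (rule integral_Re[OF i]) (use \<phi> in auto)
    then show "(LINT x|lborel. Re (p x) * \<phi> x) = 0" using test[OF \<phi>] by simp
  qed measurable
  moreover have "AE x in lborel. Im (p x) = 0"
  proof (rule AE_zero_real_test)
    show "integrable lborel (\<lambda>x. indicator (ball 0 R) x * Im (p x))" for R
    proof -
      have "(\<lambda>x. indicator (ball 0 R) x * Im (p x)) = (\<lambda>x. Im (indicator (ball 0 R) x * p x))"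
        by (auto simp: indicator_def)
      then show ?thesis using integrable_Im[OF int[of R]] by simp
    qed
    fix \<phi> :: "'a \<Rightarrow> real" assume \<phi>: "continuous_on UNIV \<phi>" "\<And>x. 0 \<le> \<phi> x" "bounded {x. \<phi> x \<noteq> 0}"
    have "(LINT x|lborel. Im (p x * of_real (\<phi> x))) = Im (LINT x|lborel. p x * of_real (\<phi> x))"
      by (rule integral_Im[OF i]) (use \<phi> in auto)
    then show "(LINT x|lborel. Im (p x) * \<phi> x) = 0" using test[OF \<phi>] by simp
  qed measurable
  ultimately show ?thesis by eventually_elim (simp add: complex_eq_iff)
qed

section \<open>Fourier transform and correlations\<close>

text \<open>Normalized to be its own transform under the convention with \<open>2 * pi\<close> in
  the exponent.\<close>

definition gauss :: "'a::euclidean_space \<Rightarrow> real" where "gauss x = exp (- pi * (norm x)\<^sup>2)"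

lemma gauss_pos: "gauss x > 0" and gauss_le_1: "gauss x \<le> 1"
  by (auto simp: gauss_def)

lemma continuous_on_gauss [continuous_intros]: "continuous_on S f \<Longrightarrow> continuous_on S (\<lambda>x. gauss (f x))"
  unfolding gauss_def by (intro continuous_intros)

lemma gauss_measurable [measurable]: "gauss \<in> borel_measurable borel"
  by (rule borel_measurable_continuous_onI) (intro continuous_intros)

lemma gauss_real_fourier:
  shows "integrable lborel (gauss :: real \<Rightarrow> real)"
    and "(LINT x|lborel. of_real (gauss x) * ue (- (x * t))) = of_real (gauss (t::real))"
proof -
  \<comment> \<open>With this scale \<open>gauss x = s * std_normal_density (s * x)\<close>, so the
    transform is the characteristic function of the standard normal law at
    \<open>- (s * t)\<close>.\<close>
  define s where "s = sqrt (2 * pi)"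
  have s: "s > 0" "s\<^sup>2 = 2 * pi" by (auto simp: s_def)
  have g: "gauss x = s * std_normal_density (s * x)" for x :: real
    using s by (simp add: gauss_def std_normal_density_def s_def[symmetric] power_mult_distrib)
  have "integrable lborel (\<lambda>x. std_normal_density (s * x))"
    using lborel_integrable_real_affine[of std_normal_density s 0] s
    by (simp add: integrable_normal_density)
  then show gi: "integrable lborel (gauss :: real \<Rightarrow> real)" by (subst g[abs_def]) simp
  have "complex_of_real (gauss t) = char std_normal_distribution (- (s * t))"
  proof -
    have "- (- (s * t))\<^sup>2 / 2 = - pi * (norm t)\<^sup>2" using s by (simp add: power_mult_distrib)
    then show ?thesis by (simp only: char_std_normal_distribution gauss_def)
  qed
  also have "\<dots> = (LINT x|lborel. std_normal_density x *\<^sub>R iexp (- (s * t) * x))"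
    unfolding char_def by (subst integral_density) auto
  also have "\<dots> = \<bar>s\<bar> *\<^sub>R (LINT x|lborel. std_normal_density (0 + s * x) *\<^sub>R iexp (- (s * t) * (0 + s * x)))"
    by (rule lborel_integral_real_affine) (use s in auto)
  also have "\<dots> = (LINT x|lborel. of_real (gauss x) * ue (- (x * t)))"
    unfolding integral_scaleR_right[symmetric]
  proof (rule Bochner_Integration.integral_cong)
    fix x :: real
    have "iexp (- (s * t) * (0 + s * x)) = ue (- (x * t))"
    proof -
      have "- (s * t) * (0 + s * x) = 2 * pi * (- (x * t))"
        using s(2) by (simp add: power2_eq_square algebra_simps)
      then show ?thesis unfolding ue_def cis_conv_exp by (metis mult.commute)
    qed
    then show "\<bar>s\<bar> *\<^sub>R (std_normal_density (0 + s * x) *\<^sub>R iexp (- (s * t) * (0 + s * x))) = of_real (gauss x) * ue (- (x * t))"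
      using s(1) by (simp add: g scaleR_conv_of_real)
  qed simp
  finally show "(LINT x|lborel. of_real (gauss x) * ue (- (x * t))) = of_real (gauss t)" by simp
qed

lemma
  fixes h :: "'a::euclidean_space \<Rightarrow> real \<Rightarrow> complex"
  assumes h: "\<And>b. b \<in> Basis \<Longrightarrow> integrable lborel (h b)"
  shows integrable_lborel_prod: "integrable lborel (\<lambda>x. \<Prod>b\<in>Basis. h b (x \<bullet> b))"
    and integral_lborel_prod: "(LINT x|lborel. (\<Prod>b\<in>Basis. h b (x \<bullet> b))) = (\<Prod>b\<in>Basis. LINT x|lborel. h b x)"
proof -
  interpret product_sigma_finite "\<lambda>_::'a. lborel :: real measure"
    by (simp add: product_sigma_finite_def sigma_finite_lborel)
  have [measurable]: "h b \<in> borel_measurable borel" if "b \<in> Basis" for b using h[OF that] by auto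
  have [measurable]: "(\<lambda>f. \<Sum>b\<in>Basis. f b *\<^sub>R b) \<in> measurable (\<Pi>\<^sub>M b\<in>Basis. lborel) (borel :: 'a measure)"
    by (rule borel_measurable_sum) (auto intro!: borel_measurable_scaleR measurable_component_singleton)
  have p: "(\<lambda>x::'a. \<Prod>b\<in>Basis. h b (x \<bullet> b)) \<in> borel_measurable borel"
    by measurable
  have coord: "(\<Prod>b\<in>Basis. h b ((\<Sum>b\<in>Basis. f b *\<^sub>R b) \<bullet> b)) = (\<Prod>b\<in>Basis. h b (f b))" for f :: "'a \<Rightarrow> real"
    by (rule prod.cong) simp_all
  show "integrable lborel (\<lambda>x. \<Prod>b\<in>Basis. h b (x \<bullet> b))"
    by (subst lborel_eq, subst integrable_distr_eq)
      (use p product_integrable_prod[of Basis h] h in \<open>auto simp: coord\<close>)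
  show "(LINT x|lborel. (\<Prod>b\<in>Basis. h b (x \<bullet> b))) = (\<Prod>b\<in>Basis. LINT x|lborel. h b x)"
    by (subst lborel_eq, subst integral_distr)
      (use p product_integral_prod[of Basis h] h in \<open>auto simp: coord\<close>)
qed

lemma gauss_prod: "gauss x = (\<Prod>b\<in>Basis. gauss (x \<bullet> b))"
proof -
  have "(norm x)\<^sup>2 = (\<Sum>b\<in>Basis. (x \<bullet> b)\<^sup>2)"
    unfolding power2_norm_eq_inner by (subst euclidean_inner) (simp add: power2_eq_square)
  then show ?thesis by (simp add: gauss_def exp_sum[symmetric] sum_distrib_left)
qed

lemma ue_sum: "finite A \<Longrightarrow> ue (sum f A) = (\<Prod>a\<in>A. ue (f a))"
  by (induction rule: finite_induct) (auto simp: ue_add)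

lemma integrable_mult_ue:
  assumes "integrable M f" and [measurable]: "h \<in> borel_measurable M"
  shows "integrable M (\<lambda>x. f x * ue (h x))"
  by (rule Bochner_Integration.integrable_bound[OF assms(1)]) (use assms in \<open>auto simp: norm_mult\<close>)

lemma integrable_gauss: "integrable lborel (gauss :: 'a::euclidean_space \<Rightarrow> real)"
  and integral_gauss_ue: "(LINT x|lborel. of_real (gauss x) * ue (- (x \<bullet> t))) = of_real (gauss (t::'a))"
proof -
  define h where "h b x = complex_of_real (gauss x) * ue (- (x * (t \<bullet> b)))" for b :: 'a and x :: real
  have hi: "integrable lborel (h b)" for b
    unfolding h_def using gauss_real_fourier(1) by (intro integrable_mult_ue) auto
  have eq: "of_real (gauss x) * ue (- (x \<bullet> t)) = (\<Prod>b\<in>Basis. h b (x \<bullet> b))" for x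
    unfolding h_def prod.distrib gauss_prod[of x]
    by (subst euclidean_inner) (simp add: ue_sum flip: sum_negf)
  have i: "integrable lborel (\<lambda>x. complex_of_real (gauss x) * ue (- (x \<bullet> t)))"
    unfolding eq by (rule integrable_lborel_prod[OF hi])
  show "integrable lborel (gauss :: 'a \<Rightarrow> real)"
    by (rule Bochner_Integration.integrable_bound[OF i]) (auto simp: norm_mult)
  show "(LINT x|lborel. of_real (gauss x) * ue (- (x \<bullet> t))) = of_real (gauss (t::'a))"
    unfolding eq integral_lborel_prod[OF hi] by (simp add: h_def[abs_def] gauss_real_fourier(2) gauss_prod[of t])
qed

lemma fourier_gauss: "fourier (\<lambda>x. of_real (gauss x)) t = of_real (gauss t)"
  by (subst fourier_lborel) (auto simp: integral_gauss_ue)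

lemma integral_gauss: "(LINT x|lborel. complex_of_real (gauss (x::'a::euclidean_space))) = 1"
  using integral_gauss_ue[of "0::'a"] by (simp add: gauss_def)

lemma integrable_gauss_complex: "integrable lborel (\<lambda>x::'a::euclidean_space. complex_of_real (gauss x))"
  by (rule integrable_of_real[OF integrable_gauss])

lemma integrable_gauss_scale:
  assumes e: "e > 0"
  shows "integrable lborel (\<lambda>t::'a::euclidean_space. gauss (e *\<^sub>R t))"
proof -
  have "integrable (distr lborel borel (\<lambda>x::'a. 0 + (1/e) *\<^sub>R x)) (\<lambda>t::'a. gauss (e *\<^sub>R t))"
    by (subst integrable_distr_eq) (use e integrable_gauss in auto)
  then show ?thesis
    using e by (subst lborel_affine[of "1/e" 0], simp, subst integrable_density) auto
qed

section \<open>Fourier transforms of integrable functions: bound and continuity\<close>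

lemma fourier_bound:
  assumes "integrable lborel f"
  shows "cmod (fourier f w) \<le> (LINT t|lborel. cmod (f t))"
proof -
  have [measurable]: "f \<in> borel_measurable borel" using assms by auto
  show ?thesis
    by (subst fourier_lborel) (auto intro!: order_trans[OF integral_norm_bound] simp: norm_mult)
qed

text \<open>Stated at a single point because the null set on which the integrand fails to be
  continuous may depend on \<open>z0\<close>, as it does for indicator functions.\<close>

lemma isCont_integral_dominated:
  fixes F :: "'b::metric_space \<Rightarrow> 'a \<Rightarrow> complex"
  assumes meas: "\<And>z. F z \<in> borel_measurable M" and w: "integrable M w"
    and cont: "AE t in M. isCont (\<lambda>z. F z t) z0"
    and bound: "\<And>z. AE t in M. norm (F z t) \<le> w t"
  shows "isCont (\<lambda>z. LINT t|M. F z t) z0"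
  unfolding continuous_at_sequentially
proof (intro allI impI)
  fix X :: "nat \<Rightarrow> 'b" assume X: "X \<longlonglongrightarrow> z0"
  have "(\<lambda>n. LINT t|M. F (X n) t) \<longlonglongrightarrow> (LINT t|M. F z0 t)"
  proof (rule integral_dominated_convergence[OF meas meas w _ bound])
    show "AE t in M. (\<lambda>n. F (X n) t) \<longlonglongrightarrow> F z0 t"
      using cont by eventually_elim (rule isCont_tendsto_compose[OF _ X])
  qed
  then show "((\<lambda>z. LINT t|M. F z t) \<circ> X) \<longlonglongrightarrow> (LINT t|M. F z0 t)" by (simp add: o_def)
qed

lemma isCont_fourier:
  assumes "integrable lborel f"
  shows "isCont (fourier f) w"
proof -
  have [measurable]: "f \<in> borel_measurable borel" using assms by auto
  have "isCont (\<lambda>w. LINT t|lborel. f t * ue (- (t \<bullet> w))) w"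
    by (rule isCont_integral_dominated[where w="\<lambda>t. cmod (f t)"])
      (use assms in \<open>auto simp: norm_mult intro!: continuous_intros\<close>)
  moreover have "fourier f = (\<lambda>w. LINT t|lborel. f t * ue (- (t \<bullet> w)))"
    by (simp add: fourier_lborel fun_eq_iff)
  ultimately show ?thesis by simp
qed

lemma continuous_on_fourier: "integrable lborel f \<Longrightarrow> continuous_on S (fourier f)"
  by (simp add: isCont_fourier continuous_at_imp_continuous_on)

lemma fourier_measurable: "integrable lborel f \<Longrightarrow> fourier f \<in> borel_measurable borel"
  by (rule borel_measurable_continuous_onI[OF continuous_on_fourier])

text \<open>The inner product of \<open>V\<close> with the translate of \<open>W\<close> by
  \<open>z\<close>. Carrying the shift on \<open>V\<close> leaves \<open>W\<close> to supply a
  majorant independent of \<open>z\<close> when \<open>V\<close> is bounded.\<close>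

definition corr :: "('a::euclidean_space \<Rightarrow> complex) \<Rightarrow> ('a \<Rightarrow> complex) \<Rightarrow> 'a \<Rightarrow> complex" where
  "corr V W z = (LINT y|lborel. V (y + z) * cnj (W y))"

lemma corr_bound:
  assumes [measurable]: "V \<in> borel_measurable borel" and W: "integrable lborel W" and B: "\<And>x. cmod (V x) \<le> B"
  shows "cmod (corr V W z) \<le> B * (LINT y|lborel. cmod (W y))"
proof -
  have [measurable]: "W \<in> borel_measurable borel" using W by auto
  have "cmod (corr V W z) \<le> (LINT y|lborel. cmod (V (y + z) * cnj (W y)))"
    unfolding corr_def by (rule integral_norm_bound)
  also have "\<dots> \<le> (LINT y|lborel. B * cmod (W y))"
    by (rule integral_mono') (use W B order_trans[OF norm_ge_zero B] in \<open>auto simp: norm_mult intro!: mult_right_mono\<close>)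
  finally show ?thesis by simp
qed

lemma isCont_corr:
  assumes [measurable]: "V \<in> borel_measurable borel" and W: "integrable lborel W" and B: "\<And>x. cmod (V x) \<le> B"
    and c: "AE y in lborel. isCont V (y + z)"
  shows "isCont (corr V W) z"
proof -
  have [measurable]: "W \<in> borel_measurable borel" using W by auto
  have "isCont (\<lambda>z. LINT y|lborel. V (y + z) * cnj (W y)) z"
  proof (rule isCont_integral_dominated[where w="\<lambda>y. B * cmod (W y)"])
    show "AE y in lborel. isCont (\<lambda>z. V (y + z) * cnj (W y)) z"
      using c by eventually_elim (intro continuous_mult continuous_const isCont_o2[where g=V and f="\<lambda>z. _ + z"] continuous_add continuous_ident)
  qed (use W B in \<open>auto simp: norm_mult intro!: mult_right_mono\<close>)
  then show ?thesis by (simp add: corr_def[abs_def])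
qed

text \<open>The phase is kept general: \<open>h = 0\<close> gives integrability of the correlation,
  \<open>h z = - (z \<bullet> t)\<close> the interchange that computes its transform.\<close>

lemma corr_fubini:
  fixes V W :: "'a::euclidean_space \<Rightarrow> complex"
  assumes V: "integrable lborel V" and W: "integrable lborel W" and [measurable]: "h \<in> borel_measurable borel"
  shows "integrable (lborel \<Otimes>\<^sub>M lborel) (\<lambda>(y, z). V (y + z) * cnj (W y) * ue (h z))"
proof (rule lborel_pair.Fubini_integrable)
  have [measurable]: "W \<in> borel_measurable borel" "V \<in> borel_measurable borel" using W V by auto
  show "(\<lambda>(y, z). V (y + z) * cnj (W y) * ue (h z)) \<in> borel_measurable (lborel \<Otimes>\<^sub>M lborel)"
    by measurable
  have "(LINT z|lborel. norm (V (y + z) * cnj (W y) * ue (h z))) = cmod (W y) * (LINT z|lborel. cmod (V z))" for y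
    using integral_lborel_shift[of "\<lambda>x. cmod (V x)" y] by (simp add: norm_mult)
  then show "integrable lborel (\<lambda>y. LINT z|lborel. norm (case (y, z) of (y, z) \<Rightarrow> V (y + z) * cnj (W y) * ue (h z)))"
    using W by simp
  show "AE y in lborel. integrable lborel (\<lambda>z. case (y, z) of (y, z) \<Rightarrow> V (y + z) * cnj (W y) * ue (h z))"
    unfolding prod.case by (intro AE_I2 integrable_mult_ue integrable_mult_left integrable_lborel_shift V) measurable
qed

lemma integrable_corr:
  assumes V: "integrable lborel V" and W: "integrable lborel W"
  shows "integrable lborel (corr V W)"
  using lborel_pair.integrable_snd[OF corr_fubini[OF assms, of "\<lambda>_. 0"]] by (simp add: corr_def[abs_def])

lemma fourier_cnj:
  assumes "integrable lborel W"
  shows "cnj (fourier W t) = (LINT y|lborel. cnj (W y) * ue (y \<bullet> t))"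
proof -
  have [measurable]: "W \<in> borel_measurable borel" using assms by auto
  show ?thesis
    by (subst fourier_lborel, simp, subst Bochner_Integration.integral_cnj[symmetric]) (simp add: ue_minus)
qed

lemma fourier_corr:
  fixes V W :: "'a::euclidean_space \<Rightarrow> complex"
  assumes V: "integrable lborel V" and W: "integrable lborel W"
  shows "fourier (corr V W) t = fourier V t * cnj (fourier W t)"
proof -
  have [measurable]: "W \<in> borel_measurable borel" "V \<in> borel_measurable borel" using W V by auto
  have [measurable]: "corr V W \<in> borel_measurable borel" using integrable_corr[OF assms] by auto
  have sh: "(LINT z|lborel. V (y + z) * ue (- (z \<bullet> t))) = fourier V t * ue (y \<bullet> t)" for y
  proof -
    have "V (y + z) * ue (- (z \<bullet> t)) = V (y + z) * ue (- ((y + z) \<bullet> t)) * ue (y \<bullet> t)" for z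
      by (simp add: inner_add_left mult.assoc flip: ue_add)
    then have "(LINT z|lborel. V (y + z) * ue (- (z \<bullet> t))) = (LINT z|lborel. V (y + z) * ue (- ((y + z) \<bullet> t)) * ue (y \<bullet> t))"
      by (intro Bochner_Integration.integral_cong refl)
    also have "\<dots> = (LINT z|lborel. V z * ue (- (z \<bullet> t)) * ue (y \<bullet> t))"
      by (rule integral_lborel_shift) measurable
    finally show ?thesis by (simp add: fourier_lborel)
  qed
  have "fourier (corr V W) t = (LINT z|lborel. LINT y|lborel. V (y + z) * cnj (W y) * ue (- (z \<bullet> t)))"
    by (simp add: fourier_lborel corr_def)
  also have "\<dots> = (LINT y|lborel. LINT z|lborel. V (y + z) * cnj (W y) * ue (- (z \<bullet> t)))"
    by (rule lborel_pair.Fubini_integral) (rule corr_fubini[OF assms], measurable)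
  also have "\<dots> = (LINT y|lborel. cnj (W y) * (LINT z|lborel. V (y + z) * ue (- (z \<bullet> t))))"
    by (simp add: mult_ac)
  also have "\<dots> = fourier V t * cnj (fourier W t)"
  proof -
    have "cnj (W y) * (LINT z|lborel. V (y + z) * ue (- (z \<bullet> t))) = fourier V t * (cnj (W y) * ue (y \<bullet> t))" for y
      by (simp add: sh mult_ac)
    then show ?thesis by (simp only: fourier_cnj[OF W] integral_mult_right_zero)
  qed
  finally show ?thesis .
qed

section \<open>Gaussian summability, Plancherel and Parseval\<close>

lemma tendsto_shrink:
  fixes w :: "'a::real_normed_vector"
  shows "(\<lambda>n. w /\<^sub>R real (Suc n)) \<longlonglongrightarrow> 0"
  using tendsto_scaleR[OF LIMSEQ_inverse_real_of_nat tendsto_const[of w]] by simp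

lemma tendsto_gauss_shrink: "(\<lambda>n. gauss (t /\<^sub>R real (Suc n))) \<longlonglongrightarrow> 1"
proof -
  have "isCont gauss (0::'a)"
    unfolding gauss_def by (intro continuous_intros)
  from isCont_tendsto_compose[OF this tendsto_shrink[of t]] show ?thesis by (simp add: gauss_def)
qed

text \<open>Fubini moves the transform from \<open>A\<close> to the Gaussian, which is its own
  transform up to scaling. The integral thereby becomes an average of \<open>A\<close> against a
  Gaussian of mass one whose width tends to 0. Continuity at the single point 0 suffices, and
  \<open>fourier A\<close> is not assumed integrable.\<close>

lemma gauss_summation:
  fixes A :: "'a::euclidean_space \<Rightarrow> complex"
  assumes A: "integrable lborel A" and B: "\<And>z. cmod (A z) \<le> B" and c: "isCont A 0"
  shows "(\<lambda>n. LINT t|lborel. fourier A t * of_real (gauss (t /\<^sub>R real (Suc n)))) \<longlonglongrightarrow> A 0"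
proof -
  have [measurable]: "A \<in> borel_measurable borel" using A by auto
  have eq: "(LINT t|lborel. fourier A t * of_real (gauss (e *\<^sub>R t))) = (LINT w|lborel. A (e *\<^sub>R w) * of_real (gauss w))"
    if e: "e > 0" for e
  proof -
    have gi: "integrable lborel (\<lambda>t::'a. complex_of_real (gauss (e *\<^sub>R t)))"
      by (rule integrable_of_real[OF integrable_gauss_scale[OF e]])
    have inner: "(LINT t|lborel. of_real (gauss (e *\<^sub>R t)) * ue (- (z \<bullet> t))) = of_real ((1/e) ^ DIM('a) * gauss (z /\<^sub>R e))" for z :: 'a
    proof -
      have "(LINT t|lborel. of_real (gauss (e *\<^sub>R t)) * ue (- (z \<bullet> t)))
          = (LINT x|lborel. of_real (gauss (e *\<^sub>R ((1/e) *\<^sub>R x))) * ue (- (z \<bullet> ((1/e) *\<^sub>R x)))) * of_real (1/e) ^ DIM('a)"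
        by (rule integral_lborel_scale[symmetric]) (use e in auto)
      also have "(LINT x|lborel. complex_of_real (gauss (e *\<^sub>R ((1/e) *\<^sub>R x))) * ue (- (z \<bullet> ((1/e) *\<^sub>R x))))
          = (LINT x|lborel. of_real (gauss x) * ue (- (x \<bullet> (z /\<^sub>R e))))"
        using e by (intro Bochner_Integration.integral_cong) (auto simp: inner_commute divide_inverse)
      finally show ?thesis unfolding integral_gauss_ue by simp
    qed
    have int: "integrable (lborel \<Otimes>\<^sub>M lborel) (\<lambda>(z, t). A z * (of_real (gauss (e *\<^sub>R t)) * ue (- (z \<bullet> t))))"
    proof (rule lborel_pair.Fubini_integrable)
      show "integrable lborel (\<lambda>z. LINT t|lborel. norm (case (z, t) of (z, t) \<Rightarrow> A z * (of_real (gauss (e *\<^sub>R t)) * ue (- (z \<bullet> t)))))"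
        using A by (simp add: norm_mult)
      show "AE z in lborel. integrable lborel (\<lambda>t. case (z, t) of (z, t) \<Rightarrow> A z * (of_real (gauss (e *\<^sub>R t)) * ue (- (z \<bullet> t))))"
        unfolding prod.case by (intro AE_I2 integrable_mult_right integrable_mult_ue gi) measurable
    qed measurable
    have "(LINT t|lborel. fourier A t * of_real (gauss (e *\<^sub>R t)))
        = (LINT t|lborel. LINT z|lborel. A z * (of_real (gauss (e *\<^sub>R t)) * ue (- (z \<bullet> t))))"
      by (simp add: fourier_lborel mult_ac flip: integral_mult_right_zero)
    also have "\<dots> = (LINT z|lborel. LINT t|lborel. A z * (of_real (gauss (e *\<^sub>R t)) * ue (- (z \<bullet> t))))"
      by (rule lborel_pair.Fubini_integral) (rule int)
    also have "\<dots> = (LINT z|lborel. A z * of_real (gauss (z /\<^sub>R e))) * of_real ((1/e) ^ DIM('a))"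
    proof -
      have "(LINT t|lborel. A z * (of_real (gauss (e *\<^sub>R t)) * ue (- (z \<bullet> t)))) = A z * of_real (gauss (z /\<^sub>R e)) * of_real ((1/e) ^ DIM('a))" for z
        by (subst integral_mult_right_zero, subst inner) simp
      then show ?thesis by (simp only: integral_mult_left_zero)
    qed
    also have "(LINT z|lborel. A z * of_real (gauss (z /\<^sub>R e))) = (LINT w|lborel. A (e *\<^sub>R w) * of_real (gauss ((e *\<^sub>R w) /\<^sub>R e))) * of_real e ^ DIM('a)"
      by (rule integral_lborel_scale[symmetric]) (use e in auto)
    finally show ?thesis using e by (simp add: power_one_over)
  qed
  have "(\<lambda>n. LINT w|lborel. A (inverse (real (Suc n)) *\<^sub>R w) * of_real (gauss w)) \<longlonglongrightarrow> (LINT w::'a|lborel. A 0 * of_real (gauss w))"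
  proof (rule integral_dominated_convergence[where w="\<lambda>w::'a. B * gauss w"])
    show "integrable lborel (\<lambda>w::'a. B * gauss w)" by (rule integrable_mult_right[OF integrable_gauss])
    show "AE w in lborel. (\<lambda>n. A (inverse (real (Suc n)) *\<^sub>R w) * of_real (gauss w)) \<longlonglongrightarrow> A 0 * of_real (gauss w)"
    proof (rule AE_I2)
      fix w :: 'a
      show "(\<lambda>n. A (inverse (real (Suc n)) *\<^sub>R w) * of_real (gauss w)) \<longlonglongrightarrow> A 0 * of_real (gauss w)"
        by (intro tendsto_mult tendsto_const isCont_tendsto_compose[OF c] tendsto_shrink)
    qed
  qed (use B in \<open>auto simp: norm_mult gauss_pos less_imp_le intro!: mult_right_mono\<close>)
  then show ?thesis using integral_gauss[where 'a='a] by (simp add: eq)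
qed

text \<open>The functions for which Plancherel's theorem is used: continuity almost everywhere makes the
  autocorrelation continuous at 0 without appeal to density arguments.\<close>

definition nice :: "('a::euclidean_space \<Rightarrow> complex) \<Rightarrow> bool" where
  "nice V \<longleftrightarrow> integrable lborel V \<and> bounded (range V) \<and> (AE x in lborel. isCont V x)"

lemma niceD:
  assumes "nice V"
  shows "integrable lborel V" "V \<in> borel_measurable borel" "AE x in lborel. isCont V x"
    and "\<exists>B. \<forall>x. cmod (V x) \<le> B"
  using assms by (auto simp: nice_def bounded_iff)

lemma nice_square_integrable:
  assumes "nice V" "nice W"
  shows "integrable lborel (\<lambda>x. V x * cnj (W x))"
proof -
  obtain B where B: "\<And>x. cmod (V x) \<le> B" using niceD(4)[OF assms(1)] by blast
  note [measurable] = niceD(2)[OF assms(1)] niceD(2)[OF assms(2)]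
  show ?thesis
    by (rule Bochner_Integration.integrable_bound[where f="\<lambda>x. B * cmod (W x)"])
      (use niceD(1)[OF assms(2)] B order_trans[OF norm_ge_zero B] in \<open>auto simp: norm_mult abs_mult intro!: mult_right_mono\<close>)
qed

lemma corr_nice:
  assumes V: "nice V" and W: "nice W"
  shows "integrable lborel (corr V W)" "\<exists>B. \<forall>z. cmod (corr V W z) \<le> B" "isCont (corr V W) 0"
    "corr V W 0 = (LINT x|lborel. V x * cnj (W x))"
proof -
  obtain B where B: "\<And>x. cmod (V x) \<le> B" using niceD(4)[OF V] by blast
  show "integrable lborel (corr V W)" using V W niceD by (intro integrable_corr) auto
  show "\<exists>B. \<forall>z. cmod (corr V W z) \<le> B" using corr_bound[OF niceD(2)[OF V] niceD(1)[OF W] B] by blast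
  show "isCont (corr V W) 0"
    by (rule isCont_corr[OF niceD(2)[OF V] niceD(1)[OF W] B]) (use niceD(3)[OF V] in simp)
  show "corr V W 0 = (LINT x|lborel. V x * cnj (W x))" by (simp add: corr_def)
qed

text \<open>Gaussian summation is applied to the autocorrelation of \<open>V\<close>, whose
  transform \<open>|fourier V t|^2\<close> is non-negative. The factors
  \<open>gauss (t / (n + 1))\<close> increase to 1, so monotone convergence yields integrability and
  value together.\<close>

lemma plancherel:
  assumes V: "nice V"
  shows "integrable lborel (\<lambda>t. (cmod (fourier V t))\<^sup>2)"
    and "(LINT t|lborel. (cmod (fourier V t))\<^sup>2) = (LINT t|lborel. (cmod (V t))\<^sup>2)"
proof -
  note [measurable] = niceD(2)[OF V] fourier_measurable[OF niceD(1)[OF V]]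
  define F where "F n t = (cmod (fourier V t))\<^sup>2 * gauss (t /\<^sub>R real (Suc n))" for n t
  have [measurable]: "F n \<in> borel_measurable borel" for n unfolding F_def by measurable
  obtain B where "\<And>z. cmod (corr V V z) \<le> B" using corr_nice(2)[OF V V] by blast
  from gauss_summation[OF corr_nice(1)[OF V V] this corr_nice(3)[OF V V]]
  have lim: "(\<lambda>n. LINT t|lborel. complex_of_real (F n t)) \<longlonglongrightarrow> (LINT t|lborel. of_real ((cmod (V t))\<^sup>2))"
    by (simp add: fourier_corr niceD(1)[OF V] corr_nice(4)[OF V V] F_def flip: complex_norm_square)
  then have lim: "(\<lambda>n. LINT t|lborel. F n t) \<longlonglongrightarrow> (LINT t|lborel. (cmod (V t))\<^sup>2)"
    by (simp only: integral_complex_of_real tendsto_of_real_iff)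
  obtain C where C: "\<And>t. cmod (fourier V t) \<le> C" using fourier_bound[OF niceD(1)[OF V]] by blast
  have Fi: "integrable lborel (F n)" for n
  proof -
    have i: "integrable lborel (\<lambda>t::'a. C\<^sup>2 * gauss (t /\<^sub>R real (Suc n)))"
      by (intro integrable_mult_right integrable_gauss_scale) simp
    moreover have "norm (F n t) \<le> norm (C\<^sup>2 * gauss (t /\<^sub>R real (Suc n)))" for t
      unfolding F_def using C[of t] gauss_pos[of "t /\<^sub>R real (Suc n)"]
      by (simp add: abs_mult mult_right_mono power_mono)
    ultimately show ?thesis
      by (intro Bochner_Integration.integrable_bound[OF i] AE_I2) auto
  qed
  have mono: "F n t \<le> F m t" if "n \<le> m" for n m t
  proof -
    have "norm (t /\<^sub>R real (Suc m)) \<le> norm (t /\<^sub>R real (Suc n))"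
      using that by (simp add: divide_left_mono mult_right_mono le_imp_inverse_le)
    then have "(norm (t /\<^sub>R real (Suc m)))\<^sup>2 \<le> (norm (t /\<^sub>R real (Suc n)))\<^sup>2"
      by (rule power_mono) simp
    then have "gauss (t /\<^sub>R real (Suc n)) \<le> gauss (t /\<^sub>R real (Suc m))"
      unfolding gauss_def by simp
    then show ?thesis unfolding F_def by (rule mult_left_mono) simp
  qed
  have tend: "(\<lambda>n. F n t) \<longlonglongrightarrow> (cmod (fourier V t))\<^sup>2" for t
    using tendsto_mult_left[OF tendsto_gauss_shrink[of t], of "(cmod (fourier V t))\<^sup>2"]
    by (simp add: F_def)
  show "integrable lborel (\<lambda>t. (cmod (fourier V t))\<^sup>2)"
    by (rule integrable_monotone_convergence[OF Fi _ _ lim]) (use mono tend in \<open>auto simp: mono_def\<close>)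
  show "(LINT t|lborel. (cmod (fourier V t))\<^sup>2) = (LINT t|lborel. (cmod (V t))\<^sup>2)"
    by (rule integral_monotone_convergence[OF Fi _ _ lim]) (use mono tend in \<open>auto simp: mono_def\<close>)
qed

lemma integrable_mult_cnj_L2:
  assumes [measurable]: "f \<in> borel_measurable M" "h \<in> borel_measurable M"
    and "integrable M (\<lambda>x. (cmod (f x))\<^sup>2)" "integrable M (\<lambda>x. (cmod (h x))\<^sup>2)"
  shows "integrable M (\<lambda>x. f x * cnj (h x))"
proof (rule Bochner_Integration.integrable_bound[where f="\<lambda>x. (cmod (f x))\<^sup>2 + (cmod (h x))\<^sup>2"])
  have "norm (f x * cnj (h x)) \<le> norm ((cmod (f x))\<^sup>2 + (cmod (h x))\<^sup>2)" for x
  proof -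
    have "2 * (cmod (f x) * cmod (h x)) \<le> (cmod (f x))\<^sup>2 + (cmod (h x))\<^sup>2"
      using sum_squares_bound[of "cmod (f x)" "cmod (h x)"] by simp
    moreover have "0 \<le> cmod (f x) * cmod (h x)" by simp
    ultimately show ?thesis unfolding norm_mult complex_mod_cnj real_norm_def by linarith
  qed
  then show "AE x in M. norm (f x * cnj (h x)) \<le> norm ((cmod (f x))\<^sup>2 + (cmod (h x))\<^sup>2)"
    by (rule AE_I2)
qed (use assms in auto)

text \<open>The integrand has no sign now, so dominated convergence replaces the monotone one; the
  majorant comes from Plancherel for \<open>V\<close> and \<open>W\<close> separately.\<close>

lemma parseval:
  assumes V: "nice V" and W: "nice W"
  shows "integrable lborel (\<lambda>t. fourier V t * cnj (fourier W t))"
    and "(LINT t|lborel. fourier V t * cnj (fourier W t)) = (LINT t|lborel. V t * cnj (W t))"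
proof -
  note [measurable] = niceD(2)[OF V] fourier_measurable[OF niceD(1)[OF V]] niceD(2)[OF W] fourier_measurable[OF niceD(1)[OF W]]
  show i: "integrable lborel (\<lambda>t. fourier V t * cnj (fourier W t))"
    by (intro integrable_mult_cnj_L2 plancherel(1) V W) measurable
  obtain B where "\<And>z. cmod (corr V W z) \<le> B" using corr_nice(2)[OF V W] by blast
  from gauss_summation[OF corr_nice(1)[OF V W] this corr_nice(3)[OF V W]]
  have 1: "(\<lambda>n. LINT t|lborel. fourier V t * cnj (fourier W t) * of_real (gauss (t /\<^sub>R real (Suc n)))) \<longlonglongrightarrow> (LINT t|lborel. V t * cnj (W t))"
    by (simp add: fourier_corr niceD(1)[OF V] niceD(1)[OF W] corr_nice(4)[OF V W])
  have 2: "(\<lambda>n. LINT t|lborel. fourier V t * cnj (fourier W t) * of_real (gauss (t /\<^sub>R real (Suc n)))) \<longlonglongrightarrow> (LINT t|lborel. fourier V t * cnj (fourier W t))"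
  proof (rule integral_dominated_convergence[where w="\<lambda>t. norm (fourier V t * cnj (fourier W t))"])
    show "AE t in lborel. (\<lambda>n. fourier V t * cnj (fourier W t) * of_real (gauss (t /\<^sub>R real (Suc n)))) \<longlonglongrightarrow> fourier V t * cnj (fourier W t)"
    proof (rule AE_I2)
      fix t :: 'a
      show "(\<lambda>n. fourier V t * cnj (fourier W t) * of_real (gauss (t /\<^sub>R real (Suc n)))) \<longlonglongrightarrow> fourier V t * cnj (fourier W t)"
        using tendsto_mult_left[OF tendsto_of_real[OF tendsto_gauss_shrink[of t]], of "fourier V t * cnj (fourier W t)"]
        by simp
    qed
    show "AE t in lborel. norm (fourier V t * cnj (fourier W t) * of_real (gauss (t /\<^sub>R real (Suc n)))) \<le> norm (fourier V t * cnj (fourier W t))" for n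
      using gauss_le_1 by (intro AE_I2) (auto simp: norm_mult abs_of_pos[OF gauss_pos] intro!: mult_left_le)
  qed (use i in auto)
  show "(LINT t|lborel. fourier V t * cnj (fourier W t)) = (LINT t|lborel. V t * cnj (W t))"
    using LIMSEQ_unique[OF 2 1] .
qed

lemma fourier_unique:
  fixes p :: "'a::euclidean_space \<Rightarrow> complex"
  assumes p: "integrable lborel p" and z: "\<And>t. fourier p t = 0"
  shows "AE x in lborel. p x = 0"
proof (rule AE_zero_test)
  show [measurable]: "p \<in> borel_measurable borel" using p by auto
  show "integrable lborel (\<lambda>x. indicator (ball 0 R) x * p x)" for R
    by (rule Bochner_Integration.integrable_bound[OF p]) (auto simp: indicator_def)
  fix \<phi> :: "'a \<Rightarrow> real" assume \<phi>: "continuous_on UNIV \<phi>" "\<And>x. 0 \<le> \<phi> x" "bounded {x. \<phi> x \<noteq> 0}"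
  have [measurable]: "\<phi> \<in> borel_measurable borel" using \<phi>(1) by (rule borel_measurable_continuous_onI)
  obtain R B where "\<And>x. \<bar>\<phi> x\<bar> \<le> B * indicator (ball 0 R) x" "0 \<le> B"
    using continuous_bounded_support[OF \<phi>(1,3)] by blast
  then have B': "cmod (of_real (\<phi> x)) \<le> \<bar>B\<bar> * indicator (ball 0 R) x" for x
    by simp
  have B'': "cmod (of_real (\<phi> x)) \<le> \<bar>B\<bar>" for x
    by (rule order_trans[OF B']) (auto simp: indicator_def)
  have ci: "integrable lborel (\<lambda>x. indicator (ball (0::'a) R) x :: real)"
    using emeasure_lborel_ball_finite[of "0::'a" R] by (simp add: integrable_indicator_iff)
  have i\<phi>: "integrable lborel (\<lambda>x. complex_of_real (\<phi> x))"
    by (rule Bochner_Integration.integrable_bound[OF integrable_mult_right[OF ci, of "\<bar>B\<bar>"]])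
      (use B' in \<open>auto simp: abs_mult\<close>)
  \<comment> \<open>With the conjugate, \<open>corr\<close> at 0 is the integral of \<open>p\<close>
    against \<open>\<phi>\<close>. Its transform contains the factor \<open>fourier q\<close>, which
    vanishes, so Gaussian summation returns 0.\<close>
  define q where "q x = cnj (p x)" for x
  have q: "integrable lborel q" unfolding q_def using p by simp
  have "cnj (fourier q t) = fourier p (- t)" for t
    by (subst fourier_cnj[OF q]) (simp add: q_def fourier_lborel)
  then have fq: "fourier q t = 0" for t using z complex_cnj_zero_iff by metis
  let ?A = "corr (\<lambda>x. of_real (\<phi> x)) q"
  have "isCont ?A 0"
    by (rule isCont_corr[where V="\<lambda>x. of_real (\<phi> x)", OF _ q B'']) (use \<phi>(1) in \<open>auto simp: continuous_on_eq_continuous_at intro!: continuous_intros\<close>)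
  moreover have "cmod (?A z) \<le> \<bar>B\<bar> * (LINT y|lborel. cmod (q y))" for z
    by (rule corr_bound[where V="\<lambda>x. of_real (\<phi> x)", OF _ q B'']) measurable
  ultimately have "(\<lambda>n. LINT t|lborel. fourier ?A t * of_real (gauss (t /\<^sub>R real (Suc n)))) \<longlonglongrightarrow> ?A 0"
    using gauss_summation[where A="?A", OF integrable_corr[OF i\<phi> q]] by blast
  then have "?A 0 = 0" by (simp add: fourier_corr i\<phi> q fq LIMSEQ_const_iff)
  then show "(LINT x|lborel. p x * of_real (\<phi> x)) = 0" by (simp add: corr_def q_def mult.commute)
qed

section \<open>Density of continuous functions in \<open>L\<^sup>2\<close>\<close>

text \<open>The radial retraction onto the disc of radius \<open>R\<close>. Being continuous, it
  preserves both continuity of approximants and their pointwise convergence.\<close>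

definition clamp_norm :: "real \<Rightarrow> complex \<Rightarrow> complex" where
  "clamp_norm R z = (R / max R (cmod z)) *\<^sub>R z"

lemma clamp_norm:
  assumes "R > 0"
  shows "cmod (clamp_norm R z) \<le> R" "cmod z \<le> R \<Longrightarrow> clamp_norm R z = z"
    "\<lbrakk>0 \<le> c; c \<le> 1\<rbrakk> \<Longrightarrow> cmod (c *\<^sub>R clamp_norm R z - z) \<le> cmod z"
proof -
  show "cmod (clamp_norm R z) \<le> R" "cmod z \<le> R \<Longrightarrow> clamp_norm R z = z"
    using assms by (auto simp: clamp_norm_def field_simps max_def)
  assume that: "0 \<le> c" "c \<le> 1"
  define s where "s = c * (R / max R (cmod z))"
  have s: "0 \<le> s" "s \<le> 1"
  proof -
    have q: "0 \<le> R / max R (cmod z)" "R / max R (cmod z) \<le> 1"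
      using assms by (auto simp: divide_le_eq_1)
    show "0 \<le> s" "s \<le> 1" unfolding s_def by (intro mult_nonneg_nonneg mult_le_one q that)+
  qed
  have "c *\<^sub>R clamp_norm R z - z = (s - 1) *\<^sub>R z" by (simp add: s_def clamp_norm_def algebra_simps)
  then have "cmod (c *\<^sub>R clamp_norm R z - z) = \<bar>s - 1\<bar> * cmod z" by simp
  also have "\<dots> \<le> 1 * cmod z" by (rule mult_right_mono) (use s in auto)
  finally show "cmod (c *\<^sub>R clamp_norm R z - z) \<le> cmod z" by simp
qed

lemma continuous_on_clamp_norm:
  assumes "R > 0" "continuous_on S f"
  shows "continuous_on S (\<lambda>x. clamp_norm R (f x))"
  unfolding clamp_norm_def by (intro continuous_intros assms) (use assms in auto)

text \<open>Measurability gives continuous \<open>g n\<close> converging to \<open>f\<close> almost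
  everywhere, but without a majorant. Truncation in value and in space supplies one: first
  \<open>R\<close> is chosen so that the truncation \<open>h R\<close> is close to \<open>f\<close>,
  then \<open>n\<close> so that the equally truncated \<open>u R n\<close> is close to
  \<open>h R\<close>.\<close>

lemma L2_dense:
  fixes f :: "'a::euclidean_space \<Rightarrow> complex"
  assumes [measurable]: "f \<in> borel_measurable borel" and fi: "integrable lborel (\<lambda>x. (cmod (f x))\<^sup>2)" and e: "e > 0"
  obtains u where "continuous_on UNIV u" "nice u" "(LINT x|lborel. (cmod (u x - f x))\<^sup>2) < e"
    "integrable lborel (\<lambda>x. (cmod (u x - f x))\<^sup>2)"
proof -
  have "f measurable_on UNIV"
    by (rule lebesgue_measurable_imp_measurable_on) (auto intro: measurable_completion)
  then obtain N g where N: "negligible N" and g: "\<And>n. continuous_on UNIV (g n)"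
    and lim: "\<And>x. x \<notin> N \<Longrightarrow> (\<lambda>n. g n x) \<longlonglongrightarrow> f x"
    unfolding measurable_on_def by auto
  have [measurable]: "g n \<in> borel_measurable borel" for n using g by (rule borel_measurable_continuous_onI)
  have aelim: "AE x in lborel. (\<lambda>n. g n x) \<longlonglongrightarrow> f x"
  proof -
    have "AE x in lebesgue. x \<notin> N" using N by (simp add: negligible_iff_null_sets AE_not_in)
    then have "AE x in lborel. x \<notin> N" by (simp add: AE_completion_iff)
    then show ?thesis by eventually_elim (rule lim)
  qed
  define cut where "cut R x = max 0 (min 1 (R + 1 - norm x))" for R :: real and x :: 'a
  have cut: "0 \<le> cut R x" "cut R x \<le> 1" "R + 1 < norm x \<Longrightarrow> cut R x = 0" "norm x \<le> R \<Longrightarrow> cut R x = 1" for R x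
    by (auto simp: cut_def)
  have ccut: "continuous_on UNIV (cut R)" for R unfolding cut_def by (intro continuous_intros)
  have [measurable]: "cut R \<in> borel_measurable borel" for R using ccut by (rule borel_measurable_continuous_onI)
  have ccl: "continuous_on UNIV (clamp_norm R)" if "R > 0" for R
    using continuous_on_clamp_norm[OF that continuous_on_id] .
  have clm [measurable]: "(\<lambda>x. clamp_norm R (h x)) \<in> borel_measurable borel"
    if "R > 0" "h \<in> borel_measurable borel" for h :: "'a \<Rightarrow> complex" and R
    using that by (intro measurable_compose[OF that(2)] borel_measurable_continuous_onI ccl)
  define h where "h R x = cut R x *\<^sub>R clamp_norm R (f x)" for R x
  define u where "u R n x = cut R x *\<^sub>R clamp_norm R (g n x)" for R n x
  have hm [measurable]: "h R \<in> borel_measurable borel" if "R > 0" for R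
    unfolding h_def using clm[OF that, of f] by measurable
  have uc: "continuous_on UNIV (u R n)" if "R > 0" for R n
    unfolding u_def by (intro continuous_intros ccut continuous_on_clamp_norm that g)
  have um [measurable]: "u R n \<in> borel_measurable borel" if "R > 0" for R n
    using uc[OF that] by (rule borel_measurable_continuous_onI)
  have hf: "(cmod (h R x - f x))\<^sup>2 \<le> (cmod (f x))\<^sup>2" if "R > 0" for R x
    unfolding h_def by (intro power_mono clamp_norm cut that) auto
  have "(\<lambda>n. LINT x|lborel. (cmod (h (real (Suc n)) x - f x))\<^sup>2) \<longlonglongrightarrow> (LINT x::'a|lborel. 0)"
  proof (rule integral_dominated_convergence[OF _ _ fi])
    show "AE x in lborel. (\<lambda>n. (cmod (h (real (Suc n)) x - f x))\<^sup>2) \<longlonglongrightarrow> 0"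
    proof (intro AE_I2 tendsto_eventually)
      fix x
      obtain M where M: "max (norm x) (cmod (f x)) < real M" using reals_Archimedean2 by blast
      have "(cmod (h (real (Suc n)) x - f x))\<^sup>2 = 0" if "n \<ge> M" for n
      proof -
        have "real M \<le> real (Suc n)" using that by simp
        then have "norm x \<le> real (Suc n)" "cmod (f x) \<le> real (Suc n)" using M by linarith+
        then show ?thesis by (simp add: h_def cut clamp_norm del: of_nat_Suc)
      qed
      then show "eventually (\<lambda>n. (cmod (h (real (Suc n)) x - f x))\<^sup>2 = 0) sequentially"
        by (rule eventually_sequentiallyI)
    qed
    show "AE x in lborel. norm ((cmod (h (real (Suc n)) x - f x))\<^sup>2) \<le> (cmod (f x))\<^sup>2" for n
      using hf[of "real (Suc n)"] by (intro AE_I2) (simp del: of_nat_Suc)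
    show "(\<lambda>x. (cmod (h (real (Suc n)) x - f x))\<^sup>2) \<in> borel_measurable lborel" for n
      using hm[of "real (Suc n)"] by measurable
  qed simp
  \<comment> \<open>Two errors of \<open>e / 4\<close>, each doubled by
    \<open>|a + b|^2 \<le> 2 |a|^2 + 2 |b|^2\<close>, add up to \<open>e\<close>.\<close>
  then have "eventually (\<lambda>n. (LINT x|lborel. (cmod (h (real (Suc n)) x - f x))\<^sup>2) < e / 4) sequentially"
    using e by (intro order_tendstoD) auto
  then obtain n0 where n0: "(LINT x|lborel. (cmod (h (real (Suc n0)) x - f x))\<^sup>2) < e / 4"
    by (auto simp: eventually_sequentially)
  define R where "R = real (Suc n0)"
  have R: "R > 0" by (simp add: R_def)
  let ?B = "\<lambda>x. indicator (cball (0::'a) (R + 1)) x :: real"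
  have Bi: "integrable lborel ?B"
    using emeasure_lborel_cball_finite[of "0::'a" "R + 1"] by (simp add: integrable_indicator_iff)
  have ub: "cmod (u R n x) \<le> R * ?B x" and hb: "cmod (h R x) \<le> R * ?B x" for n x
  proof -
    have *: "cut R x * cmod (clamp_norm R z) \<le> R * ?B x" for z
    proof (cases "norm x \<le> R + 1")
      case True
      have "cut R x * cmod (clamp_norm R z) \<le> 1 * R" by (intro mult_mono cut clamp_norm R) auto
      then show ?thesis using True by simp
    qed (simp add: cut)
    show "cmod (u R n x) \<le> R * ?B x" "cmod (h R x) \<le> R * ?B x"
      using * by (simp_all add: u_def h_def abs_of_nonneg[OF cut(1)])
  qed
  have ui: "integrable lborel (u R n)" for n
    by (rule Bochner_Integration.integrable_bound[OF integrable_mult_right[OF Bi, of R]])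
      (use ub um[OF R] R in \<open>auto simp: abs_mult\<close>)
  have "bounded (range (u R n))" for n
    unfolding bounded_iff using order_trans[OF ub mult_left_le] R by (intro exI[of _ R]) (auto simp: indicator_def)
  then have un: "nice (u R n)" for n
    unfolding nice_def using ui uc[OF R] by (auto simp: continuous_on_eq_continuous_at)
  have uh: "(cmod (u R n x - h R x))\<^sup>2 \<le> (2 * R)\<^sup>2 * ?B x" for n x
  proof -
    have "(cmod (u R n x - h R x))\<^sup>2 \<le> (2 * R * ?B x)\<^sup>2"
      by (rule power_mono) (use norm_triangle_ineq4[of "u R n x" "h R x"] ub[of n x] hb[of x] in auto)
    then show ?thesis by (cases "norm x \<le> R + 1") (auto simp: power_mult_distrib)
  qed
  have "(\<lambda>n. LINT x|lborel. (cmod (u R n x - h R x))\<^sup>2) \<longlonglongrightarrow> (LINT x::'a|lborel. 0)"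
  proof (rule integral_dominated_convergence[where w="\<lambda>x. (2 * R)\<^sup>2 * ?B x"])
    show "AE x in lborel. (\<lambda>n. (cmod (u R n x - h R x))\<^sup>2) \<longlonglongrightarrow> 0"
      using aelim
    proof eventually_elim
      case (elim x)
      have "isCont (clamp_norm R) (f x)" using ccl[OF R] by (simp add: continuous_on_eq_continuous_at)
      from isCont_tendsto_compose[OF this elim]
      have "(\<lambda>n. (cmod (cut R x *\<^sub>R clamp_norm R (g n x) - h R x))\<^sup>2) \<longlonglongrightarrow> (cmod (cut R x *\<^sub>R clamp_norm R (f x) - h R x))\<^sup>2"
        by (intro tendsto_intros)
      then show ?case by (simp add: u_def h_def)
    qed
    show "AE x in lborel. norm ((cmod (u R n x - h R x))\<^sup>2) \<le> (2 * R)\<^sup>2 * ?B x" for n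
      using uh by (intro AE_I2) simp
    show "integrable lborel (\<lambda>x. (2 * R)\<^sup>2 * ?B x)" by (rule integrable_mult_right[OF Bi])
    show "(\<lambda>x. (cmod (u R n x - h R x))\<^sup>2) \<in> borel_measurable lborel" for n
      using um[OF R, of n] hm[OF R] by measurable
  qed simp
  then have "eventually (\<lambda>n. (LINT x|lborel. (cmod (u R n x - h R x))\<^sup>2) < e / 4) sequentially"
    using e by (intro order_tendstoD) auto
  then obtain n where n: "(LINT x|lborel. (cmod (u R n x - h R x))\<^sup>2) < e / 4"
    by (auto simp: eventually_sequentially)
  note [measurable] = um[OF R] hm[OF R]
  have i1: "integrable lborel (\<lambda>x. (cmod (u R n x - h R x))\<^sup>2)"
    by (rule Bochner_Integration.integrable_bound[OF integrable_mult_right[OF Bi, of "(2 * R)\<^sup>2"]])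
      (use uh R in \<open>auto simp: abs_mult intro!: AE_I2\<close>)
  have i2: "integrable lborel (\<lambda>x. (cmod (h R x - f x))\<^sup>2)"
    by (rule Bochner_Integration.integrable_bound[OF fi]) (use hf[OF R] in auto)
  have le: "(cmod (u R n x - f x))\<^sup>2 \<le> 2 * (cmod (u R n x - h R x))\<^sup>2 + 2 * (cmod (h R x - f x))\<^sup>2" for x
  proof -
    have "(cmod (u R n x - f x))\<^sup>2 \<le> (cmod (u R n x - h R x) + cmod (h R x - f x))\<^sup>2"
      using norm_triangle_ineq[of "u R n x - h R x" "h R x - f x"] by (intro power_mono) auto
    also have "\<dots> \<le> 2 * (cmod (u R n x - h R x))\<^sup>2 + 2 * (cmod (h R x - f x))\<^sup>2"
      using sum_squares_bound[of "cmod (u R n x - h R x)" "cmod (h R x - f x)"] by (simp add: power2_sum)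
    finally show ?thesis .
  qed
  have i3: "integrable lborel (\<lambda>x. 2 * (cmod (u R n x - h R x))\<^sup>2 + 2 * (cmod (h R x - f x))\<^sup>2)"
    using i1 i2 by simp
  have i4: "integrable lborel (\<lambda>x. (cmod (u R n x - f x))\<^sup>2)"
    by (rule Bochner_Integration.integrable_bound[OF i3]) (use le in auto)
  have "(LINT x|lborel. (cmod (u R n x - f x))\<^sup>2) \<le> (LINT x|lborel. 2 * (cmod (u R n x - h R x))\<^sup>2 + 2 * (cmod (h R x - f x))\<^sup>2)"
    by (rule integral_mono[OF i4 i3 le])
  also have "\<dots> < e" using i1 i2 n n0 by (simp add: R_def)
  finally show ?thesis using that uc[OF R] un i4 by blast
qed

section \<open>Lattices and periodisation\<close>

locale based_lattice =
  fixes B :: "'a::euclidean_space set"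
  assumes indep: "independent B" and spans: "span B = UNIV"
begin

definition lat :: "'a set" where
  "lat = range (\<lambda>c :: 'a \<Rightarrow> int. \<Sum>b\<in>B. of_int (c b) *\<^sub>R b)"

text \<open>The dual basis: pairing with \<open>dvec b\<close> reads off the coordinate along
  \<open>b\<close>. Membership in the lattice and in the cell thus become conditions on inner
  products, which are visibly continuous.\<close>

definition dvec :: "'a \<Rightarrow> 'a" where
  "dvec b = (\<Sum>i\<in>Basis. representation B i b *\<^sub>R i)"

text \<open>Half-open, so that every point lies in exactly one lattice translate of the
  cell.\<close>

definition fdom :: "'a set" where
  "fdom = {z. \<forall>b\<in>B. 0 \<le> z \<bullet> dvec b \<and> z \<bullet> dvec b < 1}"

text \<open>A measure on the whole space carried by the cell: periodic functions remain functions on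
  the space and no quotient has to be formed.\<close>

definition torus :: "'a measure" where
  "torus = density lborel (indicator fdom)"

lemma finite_B [simp]: "finite B"
  using indep by (rule finiteI_independent)

lemma inner_dvec: "z \<bullet> dvec b = representation B z b"
proof -
  have "representation B z b = representation B (\<Sum>i\<in>Basis. (z \<bullet> i) *\<^sub>R i) b"
    by (simp add: euclidean_representation)
  also have "\<dots> = (\<Sum>i\<in>Basis. (z \<bullet> i) * representation B i b)"
    by (subst representation_sum) (auto simp: indep spans representation_scale)
  finally show ?thesis by (simp add: dvec_def inner_sum_right mult.commute)
qed

lemma expand: "(\<Sum>b\<in>B. (z \<bullet> dvec b) *\<^sub>R b) = z"
  unfolding inner_dvec by (rule sum_representation_eq) (auto simp: indep spans)

lemma dvec_basis: "b \<in> B \<Longrightarrow> b' \<in> B \<Longrightarrow> b' \<bullet> dvec b = (if b = b' then 1 else 0)"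
  unfolding inner_dvec by (auto simp: representation_basis[OF indep])

lemma sum_dvec: "b \<in> B \<Longrightarrow> (\<Sum>b\<in>B. c b *\<^sub>R b) \<bullet> dvec b = c b"
  by (simp add: inner_sum_left dvec_basis if_distrib cong: if_cong)

lemma lat_iff: "z \<in> lat \<longleftrightarrow> (\<forall>b\<in>B. z \<bullet> dvec b \<in> \<int>)"
proof
  assume "z \<in> lat" then show "\<forall>b\<in>B. z \<bullet> dvec b \<in> \<int>" by (auto simp: lat_def sum_dvec)
next
  assume z: "\<forall>b\<in>B. z \<bullet> dvec b \<in> \<int>"
  have "z = (\<Sum>b\<in>B. of_int \<lfloor>z \<bullet> dvec b\<rfloor> *\<^sub>R b)"
    by (subst expand[symmetric]) (intro sum.cong refl, use z in \<open>auto elim!: Ints_cases\<close>)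
  then show "z \<in> lat" unfolding lat_def by (intro image_eqI[where x="\<lambda>b. \<lfloor>z \<bullet> dvec b\<rfloor>"]) auto
qed

lemma lat_add: "x \<in> lat \<Longrightarrow> y \<in> lat \<Longrightarrow> x + y \<in> lat"
  and lat_diff: "x \<in> lat \<Longrightarrow> y \<in> lat \<Longrightarrow> x - y \<in> lat"
  and lat_uminus: "x \<in> lat \<Longrightarrow> - x \<in> lat"
  and lat_0 [simp]: "0 \<in> lat"
  by (auto simp: lat_iff inner_add_left inner_diff_left)

lemma lat_bij: "\<gamma>0 \<in> lat \<Longrightarrow> bij_betw (\<lambda>\<gamma>. \<gamma>0 + \<gamma>) lat lat"
  by (rule bij_betw_byWitness[of _ "\<lambda>\<gamma>. \<gamma> - \<gamma>0"]) (use lat_add lat_diff in auto)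

lemma dvec_dual: "b \<in> B \<Longrightarrow> dvec b \<in> dual_lattice lat"
  by (auto simp: dual_lattice_def lat_iff)

lemma ue_dual: "\<gamma> \<in> lat \<Longrightarrow> \<eta> \<in> dual_lattice lat \<Longrightarrow> ue (- ((z + \<gamma>) \<bullet> \<eta>)) = ue (- (z \<bullet> \<eta>))"
  using ue_Ints[of "- (\<gamma> \<bullet> \<eta>)"] by (simp add: dual_lattice_def inner_add_left ue_diff ue_minus)

lemma dual_0: "0 \<in> dual_lattice lat" and dual_add: "x \<in> dual_lattice lat \<Longrightarrow> y \<in> dual_lattice lat \<Longrightarrow> x + y \<in> dual_lattice lat"
  and dual_uminus: "x \<in> dual_lattice lat \<Longrightarrow> - x \<in> dual_lattice lat"
  by (auto simp: dual_lattice_def inner_add_right)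

lemma countable_lat: "countable lat"
proof -
  have "lat \<subseteq> (\<lambda>c. \<Sum>b\<in>B. of_int (c b) *\<^sub>R b) ` (B \<rightarrow>\<^sub>E (UNIV :: int set))"
  proof
    fix z assume "z \<in> lat"
    then obtain c :: "'a \<Rightarrow> int" where "z = (\<Sum>b\<in>B. of_int (c b) *\<^sub>R b)" by (auto simp: lat_def)
    then show "z \<in> (\<lambda>c. \<Sum>b\<in>B. of_int (c b) *\<^sub>R b) ` (B \<rightarrow>\<^sub>E (UNIV :: int set))"
      by (intro image_eqI[where x="restrict c B"]) auto
  qed
  moreover have "countable (B \<rightarrow>\<^sub>E (UNIV :: int set))" by (rule countable_PiE) auto
  ultimately show ?thesis by (meson countable_image countable_subset)
qed

text \<open>Cauchy-Schwarz against the dual basis bounds the integer coordinates of the lattice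
  points in \<open>S\<close>.\<close>

lemma finite_lat_bounded: assumes "bounded S" shows "finite (lat \<inter> S)"
proof -
  obtain M where M: "\<And>z. z \<in> S \<Longrightarrow> norm z \<le> M" using assms by (auto simp: bounded_iff)
  let ?I = "\<lambda>b. {- \<lceil>M * norm (dvec b)\<rceil> .. \<lceil>M * norm (dvec b)\<rceil>}"
  have "lat \<inter> S \<subseteq> (\<lambda>c. \<Sum>b\<in>B. of_int (c b) *\<^sub>R b) ` (Pi\<^sub>E B ?I)"
  proof
    fix z assume z: "z \<in> lat \<inter> S"
    have i: "\<lfloor>z \<bullet> dvec b\<rfloor> \<in> ?I b" and e: "of_int \<lfloor>z \<bullet> dvec b\<rfloor> = z \<bullet> dvec b" if "b \<in> B" for b
    proof -
      show e: "of_int \<lfloor>z \<bullet> dvec b\<rfloor> = z \<bullet> dvec b" using z that by (auto simp: lat_iff elim!: Ints_cases)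
      have "\<bar>z \<bullet> dvec b\<bar> \<le> norm z * norm (dvec b)" by (rule Cauchy_Schwarz_ineq2)
      also have "\<dots> \<le> M * norm (dvec b)" using M z by (intro mult_right_mono) auto
      finally have "\<bar>of_int \<lfloor>z \<bullet> dvec b\<rfloor>\<bar> \<le> M * norm (dvec b)" unfolding e .
      then have "\<bar>of_int \<lfloor>z \<bullet> dvec b\<rfloor>\<bar> \<le> real_of_int \<lceil>M * norm (dvec b)\<rceil>" by linarith
      then have "\<bar>\<lfloor>z \<bullet> dvec b\<rfloor>\<bar> \<le> \<lceil>M * norm (dvec b)\<rceil>" by linarith
      then show "\<lfloor>z \<bullet> dvec b\<rfloor> \<in> ?I b" by auto
    qed
    have "z = (\<Sum>b\<in>B. of_int (restrict (\<lambda>b. \<lfloor>z \<bullet> dvec b\<rfloor>) B b) *\<^sub>R b)"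
      by (subst expand[symmetric]) (intro sum.cong refl, simp add: e)
    then show "z \<in> (\<lambda>c. \<Sum>b\<in>B. of_int (c b) *\<^sub>R b) ` (Pi\<^sub>E B ?I)"
      by (rule image_eqI[where x="restrict (\<lambda>b. \<lfloor>z \<bullet> dvec b\<rfloor>) B"]) (use i in auto)
  qed
  then show ?thesis by (rule finite_subset) (auto intro!: finite_imageI finite_PiE)
qed

definition lfloor :: "'a \<Rightarrow> 'a" where
  "lfloor z = (\<Sum>b\<in>B. of_int \<lfloor>z \<bullet> dvec b\<rfloor> *\<^sub>R b)"

lemma lfloor_lat: "lfloor z \<in> lat"
  unfolding lat_def lfloor_def by auto

lemma fdom_lfloor: "\<gamma> \<in> lat \<Longrightarrow> z - \<gamma> \<in> fdom \<longleftrightarrow> \<gamma> = lfloor z"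
proof
  assume g: "\<gamma> \<in> lat" and "z - \<gamma> \<in> fdom"
  then have "\<lfloor>z \<bullet> dvec b\<rfloor> = \<gamma> \<bullet> dvec b" if "b \<in> B" for b
  proof -
    have "\<gamma> \<bullet> dvec b \<in> \<int>" using g that by (simp add: lat_iff)
    then obtain k where k: "\<gamma> \<bullet> dvec b = of_int k" by (rule Ints_cases)
    have "0 \<le> (z - \<gamma>) \<bullet> dvec b" "(z - \<gamma>) \<bullet> dvec b < 1" using \<open>z - \<gamma> \<in> fdom\<close> that by (auto simp: fdom_def)
    then have "\<lfloor>z \<bullet> dvec b\<rfloor> = k" by (simp add: inner_diff_left k floor_eq_iff)
    then show ?thesis using k by simp
  qed
  then show "\<gamma> = lfloor z" unfolding lfloor_def by (subst expand[of \<gamma>, symmetric]) (intro sum.cong refl, simp)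
next
  assume "\<gamma> = lfloor z"
  then show "z - \<gamma> \<in> fdom"
    by (auto simp: fdom_def inner_diff_left lfloor_def sum_dvec) linarith
qed

lemma fdom_sets [measurable]: "fdom \<in> sets borel"
proof -
  have "fdom = (\<Inter>b\<in>B. {z. 0 \<le> z \<bullet> dvec b} \<inter> {z. z \<bullet> dvec b < 1})" if "B \<noteq> {}"
    using that by (auto simp: fdom_def)
  moreover have "fdom = UNIV" if "B = {}" unfolding fdom_def using that by auto
  moreover have "{z. 0 \<le> z \<bullet> dvec b} \<inter> {z. z \<bullet> dvec b < 1} \<in> sets borel" for b by measurable
  ultimately show ?thesis by (cases "B = {}") (auto intro!: sets.finite_INT)
qed

lemma bounded_unit: "bounded {z. \<forall>b\<in>B. 0 \<le> z \<bullet> dvec b \<and> z \<bullet> dvec b \<le> 1}"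
  unfolding bounded_iff
proof (intro exI ballI)
  fix z assume z: "z \<in> {z. \<forall>b\<in>B. 0 \<le> z \<bullet> dvec b \<and> z \<bullet> dvec b \<le> 1}"
  have "norm z = norm (\<Sum>b\<in>B. (z \<bullet> dvec b) *\<^sub>R b)" by (simp add: expand)
  also have "\<dots> \<le> (\<Sum>b\<in>B. norm ((z \<bullet> dvec b) *\<^sub>R b))" by (rule norm_sum)
  also have "\<dots> \<le> (\<Sum>b\<in>B. norm b)" using z by (intro sum_mono) (auto intro!: mult_left_le_one_le)
  finally show "norm z \<le> (\<Sum>b\<in>B. norm b)" .
qed

lemma bounded_fdom: "bounded fdom"
  by (rule bounded_subset[OF bounded_unit]) (auto simp: fdom_def)

lemma emeasure_fdom: "emeasure lborel fdom < \<infinity>" "emeasure lborel fdom > 0"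
proof -
  obtain R where "fdom \<subseteq> cball 0 R" using bounded_fdom bounded_subset_ballD ball_subset_cball by (metis subset_trans)
  then show "emeasure lborel fdom < \<infinity>"
    using emeasure_lborel_cball_finite[of "0::'a" R] by (metis emeasure_mono order_le_less_trans sets_lborel borel_closed closed_cball)
  let ?U = "\<Inter>b\<in>B. {z. 0 < z \<bullet> dvec b} \<inter> {z. z \<bullet> dvec b < 1}"
  have o: "open ?U"
    by (intro open_INT ballI open_Int open_Collect_less continuous_intros) auto
  \<comment> \<open>The centre of the cell shows that its interior is non-empty, which gives
    positive volume.\<close>
  have "(\<Sum>b\<in>B. (1/2) *\<^sub>R b) \<in> ?U" by (auto simp: sum_dvec)
  then have "\<not> negligible ?U" using open_not_negligible[OF o] by blast
  then have "?U \<notin> null_sets lborel" by (auto simp: negligible_iff_null_sets intro: null_sets_completionI)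
  then have "emeasure lborel ?U \<noteq> 0" using o by (simp add: null_sets_def)
  then have "emeasure lborel ?U > 0" by (simp add: zero_less_iff_neq_zero)
  moreover have "emeasure lborel ?U \<le> emeasure lborel fdom"
    by (rule emeasure_mono) (auto simp: fdom_def less_imp_le)
  ultimately show "emeasure lborel fdom > 0" by simp
qed

section \<open>Integration over the cell and unfolding of lattice sums\<close>

definition covol :: real where "covol = measure lborel fdom"

lemma covol_pos: "covol > 0"
  using emeasure_fdom by (simp add: covol_def measure_def enn2real_positive_iff)

lemma space_torus [simp]: "space torus = UNIV" and sets_torus [simp, measurable_cong]: "sets torus = sets borel"
  by (auto simp: torus_def)

lemma torus_eq: "torus = density lborel (\<lambda>z. ennreal (indicator fdom z))"
  unfolding torus_def by (simp add: ennreal_indicator)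

lemma integral_torus:
  fixes f :: "'a \<Rightarrow> 'b::{banach, second_countable_topology}"
  assumes "f \<in> borel_measurable borel"
  shows "(LINT z|torus. f z) = (LINT z|lborel. indicator fdom z *\<^sub>R f z)"
  unfolding torus_eq by (rule integral_density) (use assms in auto)

lemma emeasure_torus: "emeasure torus UNIV = ennreal covol"
proof -
  have "emeasure torus UNIV = emeasure lborel fdom"
    by (simp add: torus_def emeasure_density)
  also have "\<dots> = ennreal covol"
    unfolding covol_def by (rule emeasure_eq_ennreal_measure) (use emeasure_fdom in auto)
  finally show ?thesis .
qed

lemma finite_measure_torus: "finite_measure torus"
  by (rule finite_measureI) (simp add: emeasure_torus)

lemma AE_torus: "AE z in torus. z \<in> fdom"
  unfolding torus_def by (subst AE_density) (auto simp: indicator_def)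

text \<open>By the tiling property the indicators of the translated cells sum to 1. Inserting this
  sum, exchanging it with the integral and translating each term back to the cell gives the
  formula.\<close>

lemma unfold_nn:
  assumes [measurable]: "u \<in> borel_measurable borel"
  shows "(\<integral>\<^sup>+z. u z \<partial>lborel) = (\<integral>\<^sup>+z. (\<integral>\<^sup>+\<gamma>. u (z + \<gamma>) \<partial>count_space lat) \<partial>torus)"
proof -
  have "(\<integral>\<^sup>+z. u z \<partial>lborel) = (\<integral>\<^sup>+z. (\<integral>\<^sup>+\<gamma>. indicator fdom (z - \<gamma>) * u z \<partial>count_space lat) \<partial>lborel)"
  proof (rule nn_integral_cong)
    fix z
    have "(\<integral>\<^sup>+\<gamma>. indicator fdom (z - \<gamma>) * u z \<partial>count_space lat) = (\<integral>\<^sup>+\<gamma>. u z * indicator {lfloor z} \<gamma> \<partial>count_space lat)"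
      by (intro nn_integral_cong) (auto simp: indicator_def fdom_lfloor)
    also have "\<dots> = u z" using lfloor_lat[of z] by (simp add: nn_integral_cmult_indicator)
    finally show "u z = (\<integral>\<^sup>+\<gamma>. indicator fdom (z - \<gamma>) * u z \<partial>count_space lat)" by simp
  qed
  also have "\<dots> = (\<integral>\<^sup>+\<gamma>. (\<integral>\<^sup>+z. indicator fdom (z - \<gamma>) * u z \<partial>lborel) \<partial>count_space lat)"
    by (rule nn_integral_count_space_nn_integral) (auto simp: countable_lat)
  also have "\<dots> = (\<integral>\<^sup>+\<gamma>. (\<integral>\<^sup>+z. indicator fdom z * u (z + \<gamma>) \<partial>lborel) \<partial>count_space lat)"
  proof (rule nn_integral_cong)
    fix \<gamma>
    show "(\<integral>\<^sup>+z. indicator fdom (z - \<gamma>) * u z \<partial>lborel) = (\<integral>\<^sup>+z. indicator fdom z * u (z + \<gamma>) \<partial>lborel)"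
      by (subst nn_integral_lborel_shift[of _ \<gamma>, symmetric]) (auto simp: add.commute)
  qed
  also have "\<dots> = (\<integral>\<^sup>+z. (\<integral>\<^sup>+\<gamma>. indicator fdom z * u (z + \<gamma>) \<partial>count_space lat) \<partial>lborel)"
    by (rule nn_integral_count_space_nn_integral[symmetric]) (auto simp: countable_lat)
  also have "\<dots> = (\<integral>\<^sup>+z. indicator fdom z * (\<integral>\<^sup>+\<gamma>. u (z + \<gamma>) \<partial>count_space lat) \<partial>lborel)"
    by (intro nn_integral_cong nn_integral_cmult) simp
  also have "\<dots> = (\<integral>\<^sup>+z. (\<integral>\<^sup>+\<gamma>. u (z + \<gamma>) \<partial>count_space lat) \<partial>torus)"
    unfolding torus_def
    by (subst nn_integral_density) (auto intro!: borel_measurable_nn_integral_count_space countable_lat)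
  finally show ?thesis .
qed

text \<open>The same formula for indicators, read as an identity of measures. In this form it
  transfers to Bochner integrals, with Fubini supplying the summability at almost every
  \<open>z\<close>.\<close>

lemma unfold_distr: "distr (count_space lat \<Otimes>\<^sub>M torus) borel (\<lambda>(\<gamma>, z). z + \<gamma>) = lborel"
proof (rule measure_eqI)
  fix A assume "A \<in> sets (distr (count_space lat \<Otimes>\<^sub>M torus) borel (\<lambda>(\<gamma>, z). z + \<gamma>))"
  then have [measurable]: "A \<in> sets borel" by simp
  interpret finite_measure torus by (rule finite_measure_torus)
  have m [measurable]: "(\<lambda>(\<gamma>, z). z + \<gamma>) \<in> measurable (count_space lat \<Otimes>\<^sub>M torus) borel"
    by (rule measurable_pair_measure_countable1) (auto simp: countable_lat)
  have "emeasure (distr (count_space lat \<Otimes>\<^sub>M torus) borel (\<lambda>(\<gamma>, z). z + \<gamma>)) A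
      = (\<integral>\<^sup>+p. indicator A (case p of (\<gamma>, z) \<Rightarrow> z + \<gamma>) \<partial>(count_space lat \<Otimes>\<^sub>M torus))"
  proof -
    have "emeasure (distr (count_space lat \<Otimes>\<^sub>M torus) borel (\<lambda>(\<gamma>, z). z + \<gamma>)) A
        = (\<integral>\<^sup>+z. indicator A z \<partial>distr (count_space lat \<Otimes>\<^sub>M torus) borel (\<lambda>(\<gamma>, z). z + \<gamma>))"
      by simp
    then show ?thesis by (subst (asm) nn_integral_distr) auto
  qed
  also have "\<dots> = (\<integral>\<^sup>+\<gamma>. (\<integral>\<^sup>+z. indicator A (z + \<gamma>) \<partial>torus) \<partial>count_space lat)"
    by (subst nn_integral_fst[symmetric]) auto
  also have "\<dots> = (\<integral>\<^sup>+z. (\<integral>\<^sup>+\<gamma>. indicator A (z + \<gamma>) \<partial>count_space lat) \<partial>torus)"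
    by (rule nn_integral_count_space_nn_integral[symmetric]) (auto simp: countable_lat)
  also have "\<dots> = emeasure lborel A"
    by (subst unfold_nn[symmetric]) auto
  finally show "emeasure (distr (count_space lat \<Otimes>\<^sub>M torus) borel (\<lambda>(\<gamma>, z). z + \<gamma>)) A = emeasure lborel A" .
qed simp

lemma unfold_integral:
  fixes u :: "'a \<Rightarrow> complex"
  assumes u: "integrable lborel u"
  shows "AE z in torus. integrable (count_space lat) (\<lambda>\<gamma>. u (z + \<gamma>))"
    and "integrable torus (\<lambda>z. LINT \<gamma>|count_space lat. u (z + \<gamma>))"
    and "(LINT z|torus. LINT \<gamma>|count_space lat. u (z + \<gamma>)) = (LINT z|lborel. u z)"
proof -
  interpret T: finite_measure torus by (rule finite_measure_torus)
  interpret C: sigma_finite_measure "count_space lat" by (rule sigma_finite_measure_count_space_countable[OF countable_lat])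
  interpret P: pair_sigma_finite "count_space lat" torus ..
  have [measurable]: "u \<in> borel_measurable borel" using u by auto
  have m [measurable]: "(\<lambda>(\<gamma>, z). z + \<gamma>) \<in> measurable (count_space lat \<Otimes>\<^sub>M torus) borel"
    by (rule measurable_pair_measure_countable1) (auto simp: countable_lat)
  have "integrable (distr (count_space lat \<Otimes>\<^sub>M torus) borel (\<lambda>(\<gamma>, z). z + \<gamma>)) u"
    using u by (simp add: unfold_distr)
  then have i: "integrable (count_space lat \<Otimes>\<^sub>M torus) (\<lambda>(\<gamma>, z). u (z + \<gamma>))"
    by (subst (asm) integrable_distr_eq) (auto simp: case_prod_unfold)
  show "AE z in torus. integrable (count_space lat) (\<lambda>\<gamma>. u (z + \<gamma>))"
    using P.AE_integrable_snd[OF i] .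
  show "integrable torus (\<lambda>z. LINT \<gamma>|count_space lat. u (z + \<gamma>))"
    using P.integrable_snd[OF i] .
  have "(LINT z|lborel. u z) = (LINT z|distr (count_space lat \<Otimes>\<^sub>M torus) borel (\<lambda>(\<gamma>, z). z + \<gamma>). u z)"
    by (simp add: unfold_distr)
  also have "\<dots> = (LINT p|(count_space lat \<Otimes>\<^sub>M torus). (case p of (\<gamma>, z) \<Rightarrow> u (z + \<gamma>)))"
    by (subst integral_distr) (auto simp: case_prod_unfold)
  also have "\<dots> = (LINT z|torus. LINT \<gamma>|count_space lat. u (z + \<gamma>))"
    using P.integral_snd[OF i] by simp
  finally show "(LINT z|torus. LINT \<gamma>|count_space lat. u (z + \<gamma>)) = (LINT z|lborel. u z)" by simp
qed

text \<open>A periodic function has the same integral over the cell and over any translate of it.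
  Translating by a vector at which the character equals -1 shows that the integral is its own
  negative.\<close>

lemma torus_character:
  assumes \<eta>: "\<eta> \<in> dual_lattice lat"
  shows "(LINT z|torus. ue (- (z \<bullet> \<eta>))) = (if \<eta> = 0 then of_real covol else 0)"
proof (cases "\<eta> = 0")
  case True
  then show ?thesis using emeasure_torus covol_pos by (simp add: measure_def scaleR_conv_of_real)
next
  case False
  \<comment> \<open>Chosen so that \<open>w \<bullet> \<eta> = 1 / 2\<close>.\<close>
  define w where "w = (1 / (2 * (\<eta> \<bullet> \<eta>))) *\<^sub>R \<eta>"
  have w: "ue (- (w \<bullet> \<eta>)) = - 1" using False by (simp add: w_def ue_minus) (simp add: ue_def cis_conv_exp)
  let ?I = "LINT z|torus. ue (- (z \<bullet> \<eta>))"
  have I: "?I = (LINT z|lborel. indicator fdom z * ue (- (z \<bullet> \<eta>)))"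
    by (subst integral_torus) (auto simp: scaleR_conv_of_real indicator_def intro!: Bochner_Integration.integral_cong)
  have fi: "integrable lborel (\<lambda>z. indicator fdom z :: complex)"
  proof -
    have "integrable lborel (\<lambda>z. complex_of_real (indicator fdom z))"
      using emeasure_fdom by (intro integrable_of_real) (simp add: integrable_indicator_iff)
    moreover have "(\<lambda>z. complex_of_real (indicator fdom z)) = indicator fdom" by (auto simp: indicator_def)
    ultimately show ?thesis by simp
  qed
  have fi': "integrable lborel (\<lambda>z. indicator fdom (- w + z) :: complex)"
    using integrable_lborel_shift[OF fi] .
  \<comment> \<open>The integral over the shifted cell folds back to the original one, since the
    orbit of each \<open>z\<close> meets the shifted cell in exactly one point.\<close>
  have "(LINT z|lborel. indicator fdom (- w + z) * ue (- (z \<bullet> \<eta>)))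
      = (LINT z|torus. LINT \<gamma>|count_space lat. indicator fdom (- w + (z + \<gamma>)) * ue (- ((z + \<gamma>) \<bullet> \<eta>)))"
    by (rule unfold_integral(3)[symmetric]) (intro integrable_mult_ue fi', measurable)
  also have "\<dots> = ?I"
  proof (rule Bochner_Integration.integral_cong)
    fix z
    have "(LINT \<gamma>|count_space lat. indicator fdom (- w + (z + \<gamma>)) * ue (- ((z + \<gamma>) \<bullet> \<eta>)))
        = (LINT \<gamma>|count_space lat. indicator {- lfloor (z - w)} \<gamma> *\<^sub>R ue (- (z \<bullet> \<eta>)))"
    proof (rule Bochner_Integration.integral_cong)
      fix \<gamma> assume "\<gamma> \<in> space (count_space lat)"
      then have g: "\<gamma> \<in> lat" by simp
      have "- w + (z + \<gamma>) \<in> fdom \<longleftrightarrow> - \<gamma> = lfloor (z - w)"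
        using fdom_lfloor[OF lat_uminus[OF g], of "z - w"] by (simp add: algebra_simps)
      then have "- w + (z + \<gamma>) \<in> fdom \<longleftrightarrow> \<gamma> = - lfloor (z - w)"
        by (metis minus_minus)
      then show "indicator fdom (- w + (z + \<gamma>)) * ue (- ((z + \<gamma>) \<bullet> \<eta>)) = indicator {- lfloor (z - w)} \<gamma> *\<^sub>R ue (- (z \<bullet> \<eta>))"
        by (subst ue_dual[OF g \<eta>]) (auto simp: indicator_def)
    qed simp
    also have "\<dots> = ue (- (z \<bullet> \<eta>))"
      using lat_uminus[OF lfloor_lat[of "z - w"]]
      by (simp add: integrable_indicator_iff Int_absorb2 measure_count_space)
    finally show "(LINT \<gamma>|count_space lat. indicator fdom (- w + (z + \<gamma>)) * ue (- ((z + \<gamma>) \<bullet> \<eta>))) = ue (- (z \<bullet> \<eta>))" .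
  qed simp
  finally have 1: "?I = (LINT z|lborel. indicator fdom (- w + z) * ue (- (z \<bullet> \<eta>)))" by simp
  also have "\<dots> = (LINT z|lborel. indicator fdom (- w + (w + z)) * ue (- ((w + z) \<bullet> \<eta>)))"
    by (rule integral_lborel_shift[symmetric]) measurable
  also have "\<dots> = (LINT z|lborel. ue (- (w \<bullet> \<eta>)) * (indicator fdom z * ue (- (z \<bullet> \<eta>))))"
  proof (rule Bochner_Integration.integral_cong)
    fix z
    have "ue (- ((w + z) \<bullet> \<eta>)) = ue (- (w \<bullet> \<eta>)) * ue (- (z \<bullet> \<eta>))"
      by (simp add: inner_add_left flip: ue_add)
    then show "indicator fdom (- w + (w + z)) * ue (- ((w + z) \<bullet> \<eta>)) = ue (- (w \<bullet> \<eta>)) * (indicator fdom z * ue (- (z \<bullet> \<eta>)))"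
      by simp
  qed simp
  also have "\<dots> = - ?I" by (simp add: I w)
  finally show ?thesis using False by simp
qed

end

section \<open>Uniqueness of Fourier coefficients and lattice point counting\<close>

context based_lattice
begin

definition zero_coeffs :: "('a \<Rightarrow> complex) \<Rightarrow> bool" where
  "zero_coeffs G \<longleftrightarrow> integrable torus G \<and> (\<forall>\<eta>\<in>dual_lattice lat. (LINT z|torus. G z * ue (- (z \<bullet> \<eta>))) = 0)"

text \<open>Multipliers preserving the vanishing of all Fourier coefficients. They form an algebra containing
  the characters, which avoids handling trigonometric polynomials explicitly.\<close>

definition multiplier :: "('a \<Rightarrow> complex) \<Rightarrow> bool" where
  "multiplier q \<longleftrightarrow> (\<forall>G. zero_coeffs G \<longrightarrow> zero_coeffs (\<lambda>z. G z * q z))"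

lemma multiplier_const: "multiplier (\<lambda>_. c)"
  by (auto simp: multiplier_def zero_coeffs_def mult.assoc mult.left_commute[of _ c])

lemma zero_coeffs_add: "zero_coeffs G \<Longrightarrow> zero_coeffs H \<Longrightarrow> zero_coeffs (\<lambda>z. G z + H z)"
  unfolding zero_coeffs_def by (auto simp: distrib_right integrable_mult_ue)

lemma multiplier_add: "multiplier p \<Longrightarrow> multiplier q \<Longrightarrow> multiplier (\<lambda>z. p z + q z)"
  by (auto simp: multiplier_def distrib_left intro!: zero_coeffs_add)

lemma multiplier_mult: "multiplier p \<Longrightarrow> multiplier q \<Longrightarrow> multiplier (\<lambda>z. p z * q z)"
  unfolding multiplier_def mult.assoc[symmetric] by blast

lemma multiplier_ue:
  assumes "\<eta> \<in> dual_lattice lat"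
  shows "multiplier (\<lambda>z. ue (- (z \<bullet> \<eta>)))"
  unfolding multiplier_def zero_coeffs_def
proof (intro allI impI conjI ballI)
  fix G assume G: "integrable torus G \<and> (\<forall>\<eta>\<in>dual_lattice lat. (LINT z|torus. G z * ue (- (z \<bullet> \<eta>))) = 0)"
  show "integrable torus (\<lambda>z. G z * ue (- (z \<bullet> \<eta>)))" using G by (intro integrable_mult_ue) auto
  fix \<eta>' assume "\<eta>' \<in> dual_lattice lat"
  then have "(LINT z|torus. G z * ue (- (z \<bullet> (\<eta> + \<eta>')))) = 0" using G dual_add assms by blast
  then show "(LINT z|torus. G z * ue (- (z \<bullet> \<eta>)) * ue (- (z \<bullet> \<eta>'))) = 0"
    by (simp add: mult.assoc inner_add_right flip: ue_add)
qed

lemma multiplier_ue': "\<eta> \<in> dual_lattice lat \<Longrightarrow> multiplier (\<lambda>z. ue (z \<bullet> \<eta>))"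
  using multiplier_ue[OF dual_uminus] by simp

lemma multiplier_cos: "b \<in> B \<Longrightarrow> multiplier (\<lambda>z. of_real (cos (2 * pi * (z \<bullet> dvec b))))"
  and multiplier_sin: "b \<in> B \<Longrightarrow> multiplier (\<lambda>z. of_real (sin (2 * pi * (z \<bullet> dvec b))))"
proof -
  assume "b \<in> B"
  then have d: "dvec b \<in> dual_lattice lat" by (rule dvec_dual)
  have c: "complex_of_real (cos (2 * pi * x)) = ue x * (1/2) + ue (- x) * (1/2)" for x
    unfolding ue_minus by (simp add: ue_def complex_eq_iff)
  have s: "complex_of_real (sin (2 * pi * x)) = ue x * (- \<i>/2) + ue (- x) * (\<i>/2)" for x
    unfolding ue_minus by (simp add: ue_def complex_eq_iff)
  show "multiplier (\<lambda>z. of_real (cos (2 * pi * (z \<bullet> dvec b))))"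
    unfolding c by (intro multiplier_add multiplier_mult multiplier_const multiplier_ue multiplier_ue' d)
  show "multiplier (\<lambda>z. of_real (sin (2 * pi * (z \<bullet> dvec b))))"
    unfolding s by (intro multiplier_add multiplier_mult multiplier_const multiplier_ue multiplier_ue' d)
qed

lemma multiplier_sum: "finite I \<Longrightarrow> (\<And>i. i \<in> I \<Longrightarrow> multiplier (q i)) \<Longrightarrow> multiplier (\<lambda>z. \<Sum>i\<in>I. q i z)"
  by (induction rule: finite_induct) (auto intro: multiplier_add multiplier_const)

text \<open>A continuous map whose fibres are the lattice orbits. It embeds the quotient as a
  compact subset of a Euclidean space, where approximation by polynomials is available.\<close>

definition wrap :: "'a \<Rightarrow> 'a \<times> 'a" where
  "wrap z = (\<Sum>b\<in>B. cos (2 * pi * (z \<bullet> dvec b)) *\<^sub>R b, \<Sum>b\<in>B. sin (2 * pi * (z \<bullet> dvec b)) *\<^sub>R b)"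

lemma continuous_on_wrap: "continuous_on S wrap"
  unfolding wrap_def[abs_def] by (intro continuous_intros)

lemma wrap_eq_iff: "wrap z = wrap z' \<longleftrightarrow> z - z' \<in> lat"
proof -
  have "wrap z = wrap z' \<longleftrightarrow> (\<forall>b\<in>B. cos (2 * pi * (z \<bullet> dvec b)) = cos (2 * pi * (z' \<bullet> dvec b)) \<and> sin (2 * pi * (z \<bullet> dvec b)) = sin (2 * pi * (z' \<bullet> dvec b)))"
  proof
    assume "wrap z = wrap z'"
    then have w: "fst (wrap z) \<bullet> dvec b = fst (wrap z') \<bullet> dvec b" "snd (wrap z) \<bullet> dvec b = snd (wrap z') \<bullet> dvec b" for b by auto
    show "\<forall>b\<in>B. cos (2 * pi * (z \<bullet> dvec b)) = cos (2 * pi * (z' \<bullet> dvec b)) \<and> sin (2 * pi * (z \<bullet> dvec b)) = sin (2 * pi * (z' \<bullet> dvec b))"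
    proof
      fix b assume "b \<in> B"
      then show "cos (2 * pi * (z \<bullet> dvec b)) = cos (2 * pi * (z' \<bullet> dvec b)) \<and> sin (2 * pi * (z \<bullet> dvec b)) = sin (2 * pi * (z' \<bullet> dvec b))"
        using w[of b] by (simp add: wrap_def sum_dvec)
    qed
  qed (auto simp: wrap_def)
  also have "\<dots> \<longleftrightarrow> (\<forall>b\<in>B. (z - z') \<bullet> dvec b \<in> \<int>)"
  proof (intro ball_cong refl)
    fix b
    have "(cos (2 * pi * x) = cos (2 * pi * y) \<and> sin (2 * pi * x) = sin (2 * pi * y)) \<longleftrightarrow> x - y \<in> \<int>" for x y :: real
    proof -
      have "(sin (2 * pi * x) = sin (2 * pi * y) \<and> cos (2 * pi * x) = cos (2 * pi * y)) \<longleftrightarrow> (\<exists>n::int. 2 * pi * x = 2 * pi * y + 2 * pi * n)"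
        by (rule sin_cos_eq_iff)
      also have "\<dots> \<longleftrightarrow> (\<exists>n::int. x - y = n)"
      proof (intro ex_cong1)
        fix n :: int
        have "2 * pi * x = 2 * pi * y + 2 * pi * n \<longleftrightarrow> 2 * pi * x = 2 * pi * (y + n)" by (simp add: distrib_left)
        also have "\<dots> \<longleftrightarrow> x = y + n" by simp
        finally show "2 * pi * x = 2 * pi * y + 2 * pi * n \<longleftrightarrow> x - y = n" by auto
      qed
      finally show ?thesis by (auto simp: Ints_def)
    qed
    then show "(cos (2 * pi * (z \<bullet> dvec b)) = cos (2 * pi * (z' \<bullet> dvec b)) \<and> sin (2 * pi * (z \<bullet> dvec b)) = sin (2 * pi * (z' \<bullet> dvec b))) \<longleftrightarrow> (z - z') \<bullet> dvec b \<in> \<int>"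
      by (simp add: inner_diff_left)
  qed
  finally show ?thesis by (simp add: lat_iff)
qed

text \<open>Linear functions of \<open>wrap\<close> are combinations of cosines and sines of the
  dual coordinates, that is, of characters; sums and products follow by induction because
  multipliers form an algebra.\<close>

lemma multiplier_polynomial:
  assumes "real_polynomial_function p"
  shows "multiplier (\<lambda>z. of_real (p (wrap z)))"
  using assms
proof (induction rule: real_polynomial_function.induct)
  case (linear f)
  interpret bounded_linear f by fact
  have "wrap z = (\<Sum>b\<in>B. cos (2 * pi * (z \<bullet> dvec b)) *\<^sub>R (b, 0)) + (\<Sum>b\<in>B. sin (2 * pi * (z \<bullet> dvec b)) *\<^sub>R (0, b))" for z
    by (simp add: wrap_def sum_prod prod_eq_iff fst_sum snd_sum)
  then have "complex_of_real (f (wrap z)) = (\<Sum>b\<in>B. of_real (cos (2 * pi * (z \<bullet> dvec b))) * of_real (f (b, 0)))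
      + (\<Sum>b\<in>B. of_real (sin (2 * pi * (z \<bullet> dvec b))) * of_real (f (0, b)))" for z
    by (simp add: add sum scaleR del: scaleR_Pair)
  then show ?case
    by (auto intro!: multiplier_add multiplier_sum multiplier_mult multiplier_const multiplier_cos multiplier_sin)
qed (auto intro: multiplier_add multiplier_mult multiplier_const)

text \<open>A continuous periodic function factors through \<open>wrap\<close>. The factor is
  continuous on the compact image because images of compact sets are closed, so the
  Stone-Weierstrass theorem applies to it.\<close>

lemma periodic_approx:
  fixes P :: "'a \<Rightarrow> real"
  assumes c: "continuous_on UNIV P" and per: "\<And>z \<gamma>. \<gamma> \<in> lat \<Longrightarrow> P (z + \<gamma>) = P z" and e: "e > 0"
  obtains p where "real_polynomial_function p" "\<And>z. \<bar>P z - p (wrap z)\<bar> < e"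
proof -
  \<comment> \<open>The closed cell replaces the half-open one for the sake of compactness; it still
    meets every orbit.\<close>
  define C where "C = {z. \<forall>b\<in>B. 0 \<le> z \<bullet> dvec b \<and> z \<bullet> dvec b \<le> 1}"
  have "C = (\<Inter>b\<in>B. {z. 0 \<le> z \<bullet> dvec b} \<inter> {z. z \<bullet> dvec b \<le> 1})" by (auto simp: C_def)
  moreover have "closed (\<Inter>b\<in>B. {z. 0 \<le> z \<bullet> dvec b} \<inter> {z. z \<bullet> dvec b \<le> 1})"
    by (intro closed_INT ballI closed_Int closed_Collect_le continuous_intros)
  ultimately have C: "compact C" using bounded_unit by (simp add: compact_eq_bounded_closed C_def)
  have inC: "z - lfloor z \<in> C" for z
    using fdom_lfloor[OF lfloor_lat, of z z] by (auto simp: C_def fdom_def)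
  have rep: "\<exists>z'\<in>C. wrap z' = wrap z" for z
    using inC[of z] lat_uminus[OF lfloor_lat[of z]] by (intro bexI[of _ "z - lfloor z"]) (auto simp: wrap_eq_iff)
  have Peq: "P z = P z'" if "wrap z = wrap z'" for z z'
    using per[of "z - z'" z'] that by (simp add: wrap_eq_iff)
  \<comment> \<open>The choice of preimage is immaterial, since \<open>P\<close> is constant on the
    fibres of \<open>wrap\<close> by \<open>Peq\<close>.\<close>
  define F where "F s = P (SOME z. wrap z = s)" for s
  have F: "F (wrap z) = P z" for z
    unfolding F_def by (rule Peq) (rule someI[of _ z], rule refl)
  have S: "compact (wrap ` C)" by (rule compact_continuous_image[OF continuous_on_wrap C])
  have "continuous_on (wrap ` C) F"
    unfolding continuous_on_closed_vimage[OF compact_imp_closed[OF S]]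
  proof (intro allI impI)
    fix D :: "real set" assume D: "closed D"
    have "F -` D \<inter> wrap ` C = wrap ` (P -` D \<inter> C)" by (auto simp: F)
    moreover have "closed (P -` D)" using D c by (rule closed_vimage)
    then have "compact (P -` D \<inter> C)" using C by (simp add: closed_Int_compact)
    ultimately show "closed (F -` D \<inter> wrap ` C)"
      by (simp add: compact_imp_closed compact_continuous_image[OF continuous_on_wrap])
  qed
  then obtain p where p: "real_polynomial_function p" "\<And>x. x \<in> wrap ` C \<Longrightarrow> \<bar>F x - p x\<bar> < e"
    using Stone_Weierstrass_real_polynomial_function[OF S _ e] by blast
  have "\<bar>P z - p (wrap z)\<bar> < e" for z
  proof -
    have "wrap z \<in> wrap ` C" using rep[of z] by (metis image_eqI)
    from p(2)[OF this] show ?thesis by (simp add: F)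
  qed
  then show ?thesis using that p(1) by blast
qed

lemma torus_integral_continuous_zero:
  fixes P :: "'a \<Rightarrow> real"
  assumes G: "zero_coeffs G"
    and c: "continuous_on UNIV P" and per: "\<And>z \<gamma>. \<gamma> \<in> lat \<Longrightarrow> P (z + \<gamma>) = P z"
  shows "(LINT z|torus. G z * of_real (P z)) = 0"
proof -
  have Gi: "integrable torus G" using G by (simp add: zero_coeffs_def)
  then have [measurable]: "G \<in> borel_measurable borel" using borel_measurable_integrable by fastforce
  have [measurable]: "P \<in> borel_measurable borel" using c by (rule borel_measurable_continuous_onI)
  have le: "cmod (LINT z|torus. G z * of_real (P z)) \<le> 0 + e * (LINT z|torus. cmod (G z))" if e: "e > 0" for e
  proof -
    obtain p where p: "real_polynomial_function p" "\<And>z. \<bar>P z - p (wrap z)\<bar> < e"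
      using periodic_approx[OF c per e] by blast
    have zp: "zero_coeffs (\<lambda>z. G z * of_real (p (wrap z)))"
      using multiplier_polynomial[OF p(1)] G by (simp add: multiplier_def)
    then have "(LINT z|torus. G z * of_real (p (wrap z)) * ue (- (z \<bullet> 0))) = 0"
      using dual_0 unfolding zero_coeffs_def by blast
    then have z: "(LINT z|torus. G z * of_real (p (wrap z))) = 0" by simp
    have i1: "integrable torus (\<lambda>z. G z * of_real (p (wrap z)))"
      using zp unfolding zero_coeffs_def by blast
    have "continuous_on UNIV p"
      using p(1) unfolding real_polynomial_function_eq by (rule continuous_on_polymonial_function)
    then have "continuous_on UNIV (\<lambda>z. p (wrap z))"
      by (rule continuous_on_compose2[OF _ continuous_on_wrap]) simp
    then have [measurable]: "(\<lambda>z. p (wrap z)) \<in> borel_measurable borel" by (rule borel_measurable_continuous_onI)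
    have pw: "norm (G z * of_real (P z - p (wrap z))) \<le> e * cmod (G z)" for z
      using mult_right_mono[OF less_imp_le[OF p(2)[of z]] norm_ge_zero[of "G z"]] by (simp add: norm_mult mult.commute del: of_real_diff)
    have i2: "integrable torus (\<lambda>z. G z * of_real (P z - p (wrap z)))"
      by (rule Bochner_Integration.integrable_bound[OF integrable_mult_right[OF integrable_norm[OF Gi], of e]])
        (use order_trans[OF pw abs_ge_self] in \<open>auto simp del: of_real_diff\<close>)
    have "(LINT z|torus. G z * of_real (P z)) = (LINT z|torus. G z * of_real (p (wrap z)) + G z * of_real (P z - p (wrap z)))"
      by (simp add: right_diff_distrib)
    also have "\<dots> = (LINT z|torus. G z * of_real (P z - p (wrap z)))"
      by (subst Bochner_Integration.integral_add[OF i1 i2], subst z) simp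
    also have "cmod \<dots> \<le> (LINT z|torus. e * cmod (G z))"
      by (rule order_trans[OF integral_norm_bound], rule integral_mono[OF integrable_norm[OF i2]])
        (use Gi pw in auto)
    finally show ?thesis by simp
  qed
  have "cmod (LINT z|torus. G z * of_real (P z)) \<le> 0"
  proof (rule field_le_epsilon)
    fix d :: real assume d: "d > 0"
    define N where "N = (LINT z|torus. cmod (G z))"
    have N: "N \<ge> 0" by (simp add: N_def)
    \<comment> \<open>\<open>N + 1\<close> keeps the tolerance positive when
      \<open>N = 0\<close>.\<close>
    have "cmod (LINT z|torus. G z * of_real (P z)) \<le> 0 + (d / (N + 1)) * N"
      unfolding N_def by (rule le) (use d N in \<open>auto simp flip: N_def\<close>)
    also have "\<dots> \<le> 0 + d" using d N by (simp add: field_simps)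
    finally show "cmod (LINT z|torus. G z * of_real (P z)) \<le> 0 + d" .
  qed
  then show ?thesis by simp
qed

text \<open>Unfolding turns the integral of \<open>G\<close> against a test function into the
  integral over the cell of \<open>G\<close> against the periodised test function. The latter is
  continuous and periodic, so the vanishing coefficients annihilate it.\<close>

lemma torus_unique:
  fixes G :: "'a \<Rightarrow> complex"
  assumes G: "zero_coeffs G" and per: "\<And>z \<gamma>. \<gamma> \<in> lat \<Longrightarrow> G (z + \<gamma>) = G z"
  shows "AE z in lborel. G z = 0"
proof (rule AE_zero_test)
  have Gi: "integrable torus G" using G by (simp add: zero_coeffs_def)
  have Gm [measurable]: "G \<in> borel_measurable borel"
    using borel_measurable_integrable[OF Gi] by (simp add: measurable_cong_sets[OF sets_torus refl])
  then show "G \<in> borel_measurable borel" .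
  have ball_m [measurable]: "ball (0::'a) r \<in> sets borel" for r by simp
  \<comment> \<open>Only finitely many lattice translates of the cell meet a ball, so a periodic
    \<open>G\<close> that is integrable over one cell is integrable over the ball.\<close>
  show bi: "integrable lborel (\<lambda>x. indicator (ball 0 R) x * G x)" for R
  proof (rule integrableI_bounded)
    obtain M where M: "fdom \<subseteq> ball 0 M" using bounded_fdom bounded_subset_ballD by blast
    let ?S = "lat \<inter> ball 0 (R + M)"
    have fS: "finite ?S" by (rule finite_lat_bounded) simp
    have "(\<integral>\<^sup>+x. norm (indicator (ball 0 R) x * G x) \<partial>lborel)
        = (\<integral>\<^sup>+z. (\<integral>\<^sup>+\<gamma>. norm (indicator (ball 0 R) (z + \<gamma>) * G (z + \<gamma>)) \<partial>count_space lat) \<partial>torus)"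
      by (rule unfold_nn) measurable
    also have "\<dots> \<le> (\<integral>\<^sup>+z. ennreal (real (card ?S)) * ennreal (norm (G z)) \<partial>torus)"
    proof (rule nn_integral_mono_AE)
      show "AE z in torus. (\<integral>\<^sup>+\<gamma>. norm (indicator (ball 0 R) (z + \<gamma>) * G (z + \<gamma>)) \<partial>count_space lat) \<le> ennreal (real (card ?S)) * ennreal (norm (G z))"
        using AE_torus
      proof eventually_elim
        case (elim z)
        have "(\<integral>\<^sup>+\<gamma>. norm (indicator (ball 0 R) (z + \<gamma>) * G (z + \<gamma>)) \<partial>count_space lat)
            \<le> (\<integral>\<^sup>+\<gamma>. ennreal (norm (G z)) * indicator ?S \<gamma> \<partial>count_space lat)"
        proof (rule nn_integral_mono)
          fix \<gamma> assume "\<gamma> \<in> space (count_space lat)"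
          then have g: "\<gamma> \<in> lat" by simp
          have "norm \<gamma> < R + M" if "norm (z + \<gamma>) < R"
            using norm_triangle_ineq4[of "z + \<gamma>" z] M elim that by auto
          then show "ennreal (norm (indicator (ball 0 R) (z + \<gamma>) * G (z + \<gamma>))) \<le> ennreal (norm (G z)) * indicator ?S \<gamma>"
            using g by (auto simp: indicator_def per)
        qed
        also have "\<dots> = ennreal (real (card ?S)) * ennreal (norm (G z))"
          using fS by (subst nn_integral_cmult_indicator) (auto simp: mult.commute ennreal_of_nat_eq_real_of_nat)
        finally show ?case .
      qed
    qed
    also have "\<dots> = ennreal (real (card ?S)) * (\<integral>\<^sup>+z. norm (G z) \<partial>torus)" by (rule nn_integral_cmult) simp
    also have "\<dots> < \<infinity>" using Gi by (simp add: integrable_iff_bounded ennreal_mult_less_top)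
    finally show "(\<integral>\<^sup>+x. norm (indicator (ball 0 R) x * G x) \<partial>lborel) < \<infinity>" .
  qed measurable
  fix \<phi> :: "'a \<Rightarrow> real" assume \<phi>: "continuous_on UNIV \<phi>" "\<And>x. 0 \<le> \<phi> x" "bounded {x. \<phi> x \<noteq> 0}"
  have [measurable]: "\<phi> \<in> borel_measurable borel" using \<phi>(1) by (rule borel_measurable_continuous_onI)
  obtain R C where C: "0 \<le> C" "\<And>x. \<bar>\<phi> x\<bar> \<le> C * indicator (ball 0 R) x"
    using continuous_bounded_support[OF \<phi>(1,3)] by blast
  define P where "P z = (LINT \<gamma>|count_space lat. \<phi> (z + \<gamma>))" for z
  \<comment> \<open>On a ball the periodisation is a sum over one fixed finite set of lattice
    vectors, which makes it continuous.\<close>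
  have Psum: "P z = (\<Sum>\<gamma>\<in>lat \<inter> ball 0 (M + R). \<phi> (z + \<gamma>))" if z: "norm z < M" for z M
  proof -
    have fS: "finite (lat \<inter> ball 0 (M + R))" by (rule finite_lat_bounded) simp
    have sub: "{\<gamma>\<in>lat. \<phi> (z + \<gamma>) \<noteq> 0} \<subseteq> lat \<inter> ball 0 (M + R)"
    proof
      fix \<gamma> assume g: "\<gamma> \<in> {\<gamma>\<in>lat. \<phi> (z + \<gamma>) \<noteq> 0}"
      then have "norm (z + \<gamma>) < R" using C(2)[of "z + \<gamma>"] by (cases "norm (z + \<gamma>) < R") auto
      then have "norm \<gamma> < M + R" using norm_triangle_ineq4[of "z + \<gamma>" z] z by auto
      then show "\<gamma> \<in> lat \<inter> ball 0 (M + R)" using g by auto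
    qed
    have "P z = (\<Sum>\<gamma> | \<gamma> \<in> lat \<and> \<phi> (z + \<gamma>) \<noteq> 0. \<phi> (z + \<gamma>))"
      unfolding P_def by (rule lebesgue_integral_count_space_finite_support) (rule finite_subset[OF sub fS])
    also have "\<dots> = (\<Sum>\<gamma>\<in>lat \<inter> ball 0 (M + R). \<phi> (z + \<gamma>))"
      by (rule sum.mono_neutral_left[OF fS sub]) auto
    finally show ?thesis .
  qed
  have Pc: "continuous_on UNIV P"
  proof -
    have "continuous_on (ball 0 M) P" for M
    proof (rule continuous_on_eq)
      show "continuous_on (ball 0 M) (\<lambda>z. \<Sum>\<gamma>\<in>lat \<inter> ball 0 (M + R). \<phi> (z + \<gamma>))"
        by (intro continuous_on_sum continuous_on_compose2[OF \<phi>(1)] continuous_intros) auto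
    qed (simp add: Psum)
    then have "isCont P z" for z
      by (rule continuous_on_interior[of "ball 0 (norm z + 1)"]) (simp add: interior_open)
    then show ?thesis by (simp add: continuous_on_eq_continuous_at)
  qed
  have Pper: "P (z + \<gamma>0) = P z" if g: "\<gamma>0 \<in> lat" for z \<gamma>0
    using integral_bij_count_space[OF lat_bij[OF g], of "\<lambda>\<gamma>. \<phi> (z + \<gamma>)"] by (simp add: P_def add.assoc)
  have ptw: "norm (G x * of_real (\<phi> x)) \<le> norm (C * norm (indicator (ball 0 R) x * G x))" for x
    using mult_right_mono[OF C(2)[of x] norm_ge_zero[of "G x"]] C(1)
    by (cases "norm x < R") (simp_all add: norm_mult abs_mult mult_ac)
  have i: "integrable lborel (\<lambda>x. G x * of_real (\<phi> x))"
    by (rule Bochner_Integration.integrable_bound[OF integrable_mult_right[OF integrable_norm[OF bi[of R]], of C]])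
      (use ptw in auto)
  have "(LINT x|lborel. G x * of_real (\<phi> x)) = (LINT z|torus. LINT \<gamma>|count_space lat. G (z + \<gamma>) * of_real (\<phi> (z + \<gamma>)))"
    by (rule unfold_integral(3)[OF i, symmetric])
  also have "\<dots> = (LINT z|torus. G z * of_real (P z))"
  proof (rule Bochner_Integration.integral_cong)
    fix z
    have "(LINT \<gamma>|count_space lat. G (z + \<gamma>) * complex_of_real (\<phi> (z + \<gamma>))) = (LINT \<gamma>|count_space lat. G z * of_real (\<phi> (z + \<gamma>)))"
      by (rule Bochner_Integration.integral_cong) (auto simp: per)
    then show "(LINT \<gamma>|count_space lat. G (z + \<gamma>) * complex_of_real (\<phi> (z + \<gamma>))) = G z * of_real (P z)"
      by (simp add: P_def)
  qed simp
  also have "\<dots> = 0" by (rule torus_integral_continuous_zero[OF G Pc Pper])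
  finally show "(LINT x|lborel. G x * of_real (\<phi> x)) = 0" .
qed

text \<open>Unfolding writes the volume of \<open>A\<close> as the integral over \<open>z\<close> in
  the cell of the number of lattice points in \<open>A - z\<close>. This number does not change when
  \<open>z\<close> is moved by a lattice vector, so \<open>\<gamma>0\<close> may be chosen for each
  \<open>z\<close> before the comparison with \<open>A'\<close>.\<close>

lemma measure_le_card_lat:
  assumes A: "A \<in> sets borel" and A': "bounded A'"
    and sub: "\<And>z. z \<in> fdom \<Longrightarrow> \<exists>\<gamma>0\<in>lat. \<forall>x\<in>A. x - (z + \<gamma>0) \<in> A'"
  shows "emeasure lborel A \<le> ennreal (covol * real (card (lat \<inter> A')))"
proof -
  have fA: "finite (lat \<inter> A')" using finite_lat_bounded[OF A'] .
  have "emeasure lborel A = (\<integral>\<^sup>+z. indicator A z \<partial>lborel)" using A by simp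
  also have "\<dots> = (\<integral>\<^sup>+z. (\<integral>\<^sup>+\<gamma>. indicator A (z + \<gamma>) \<partial>count_space lat) \<partial>torus)"
    by (rule unfold_nn) (use A in measurable)
  also have "\<dots> \<le> (\<integral>\<^sup>+z. ennreal (real (card (lat \<inter> A'))) \<partial>torus)"
  proof (rule nn_integral_mono_AE)
    show "AE z in torus. (\<integral>\<^sup>+\<gamma>. indicator A (z + \<gamma>) \<partial>count_space lat) \<le> ennreal (real (card (lat \<inter> A')))"
      using AE_torus
    proof eventually_elim
      case (elim z)
      then obtain \<gamma>0 where g0: "\<gamma>0 \<in> lat" "\<And>x. x \<in> A \<Longrightarrow> x - (z + \<gamma>0) \<in> A'" using sub by blast
      let ?S = "{\<gamma>\<in>lat. z + \<gamma> \<in> A}"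
      have im: "(\<lambda>\<gamma>. \<gamma> - \<gamma>0) ` ?S \<subseteq> lat \<inter> A'"
        using g0 by (auto intro: lat_diff) (metis add_diff_cancel_left diff_diff_eq add.commute)
      have inj: "inj_on (\<lambda>\<gamma>. \<gamma> - \<gamma>0) ?S" by (simp add: inj_on_def)
      have fS: "finite ?S" using finite_imageD[OF finite_subset[OF im fA] inj] .
      have "(\<integral>\<^sup>+\<gamma>. indicator A (z + \<gamma>) \<partial>count_space lat) = (\<integral>\<^sup>+\<gamma>. indicator ?S \<gamma> \<partial>count_space lat)"
        by (rule nn_integral_cong) (auto simp: indicator_def)
      also have "\<dots> = of_nat (card ?S)" using fS by (subst nn_integral_indicator) auto
      also have "card ?S \<le> card (lat \<inter> A')"
        by (rule card_inj_on_le[OF inj im fA])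
      finally show ?case by (simp add: ennreal_of_nat_eq_real_of_nat)
    qed
  qed
  also have "\<dots> = ennreal (covol * real (card (lat \<inter> A')))"
    using covol_pos by (simp add: emeasure_torus ennreal_mult' mult.commute)
  finally show ?thesis .
qed

lemma card_lat_le_measure:
  assumes A: "A \<in> sets borel" and A': "bounded A'"
    and sub: "\<And>z. z \<in> fdom \<Longrightarrow> \<exists>\<gamma>0\<in>lat. \<forall>x\<in>A'. x + (z + \<gamma>0) \<in> A"
  shows "ennreal (covol * real (card (lat \<inter> A'))) \<le> emeasure lborel A"
proof -
  have fA: "finite (lat \<inter> A')" using finite_lat_bounded[OF A'] .
  have "ennreal (covol * real (card (lat \<inter> A'))) = (\<integral>\<^sup>+z. ennreal (real (card (lat \<inter> A'))) \<partial>torus)"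
    using covol_pos by (simp add: emeasure_torus ennreal_mult' mult.commute)
  also have "\<dots> \<le> (\<integral>\<^sup>+z. (\<integral>\<^sup>+\<gamma>. indicator A (z + \<gamma>) \<partial>count_space lat) \<partial>torus)"
  proof (rule nn_integral_mono_AE)
    show "AE z in torus. ennreal (real (card (lat \<inter> A'))) \<le> (\<integral>\<^sup>+\<gamma>. indicator A (z + \<gamma>) \<partial>count_space lat)"
      using AE_torus
    proof eventually_elim
      case (elim z)
      then obtain \<gamma>0 where g0: "\<gamma>0 \<in> lat" "\<And>x. x \<in> A' \<Longrightarrow> x + (z + \<gamma>0) \<in> A" using sub by blast
      let ?S = "(\<lambda>\<gamma>. \<gamma> + \<gamma>0) ` (lat \<inter> A')"
      have im: "?S \<subseteq> lat" using g0 by (auto intro: lat_add)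
      have inA: "\<gamma> \<in> ?S \<Longrightarrow> z + \<gamma> \<in> A" for \<gamma>
        using g0(2) by (auto simp: add_ac)
      have "ennreal (real (card (lat \<inter> A'))) = of_nat (card ?S)"
        by (subst card_image) (auto simp: inj_on_def ennreal_of_nat_eq_real_of_nat)
      also have "\<dots> = (\<integral>\<^sup>+\<gamma>. indicator ?S \<gamma> \<partial>count_space lat)"
        using fA im by (subst nn_integral_indicator) auto
      also have "\<dots> \<le> (\<integral>\<^sup>+\<gamma>. indicator A (z + \<gamma>) \<partial>count_space lat)"
        by (rule nn_integral_mono) (use inA in \<open>auto simp: indicator_def\<close>)
      finally show ?case .
    qed
  qed
  also have "\<dots> = (\<integral>\<^sup>+z. indicator A z \<partial>lborel)"
    by (rule unfold_nn[symmetric]) (use A in measurable)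
  also have "\<dots> = emeasure lborel A" using A by simp
  finally show ?thesis .
qed

end

section \<open>The density of a model set\<close>

lemma emeasure_cube_times:
  assumes "0 \<le> r" "c \<le> d"
  shows "emeasure lborel (cbox x (x + vec r) \<times> {c..d} :: ((real^'m) \<times> real) set) = ennreal (r ^ CARD('m) * (d - c))"
proof -
  have "measure lborel (cbox x (x + vec r :: real^'m)) = r ^ CARD('m)"
    using assms by (subst content_cbox_cart) (auto simp: interval_ne_empty_cart)
  then have "emeasure lborel (cbox x (x + vec r :: real^'m)) = ennreal (r ^ CARD('m))"
    using emeasure_lborel_cbox_finite[of x "x + vec r"] by (subst emeasure_eq_ennreal_measure) auto
  then have "emeasure (lborel \<Otimes>\<^sub>M lborel) (cbox x (x + vec r :: real^'m) \<times> {c..d}) = ennreal (r ^ CARD('m)) * ennreal (d - c)"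
    using assms by (subst lborel.emeasure_pair_measure_Times) auto
  then show ?thesis using assms by (simp add: lborel_prod ennreal_mult')
qed

lemma tendsto_cube_ratio: "((\<lambda>R. ((R + k) / R) ^ n * c) \<longlongrightarrow> c) at_top" for k c :: real
proof -
  have "((\<lambda>R::real. 1 + k / R) \<longlongrightarrow> 1 + 0) at_top"
    by (intro tendsto_add tendsto_const tendsto_divide_0[OF tendsto_const] filterlim_at_top_imp_at_infinity filterlim_ident)
  moreover have "eventually (\<lambda>R::real. 1 + k / R = (R + k) / R) at_top"
    using eventually_gt_at_top[of 0] by eventually_elim (simp add: field_simps)
  ultimately have "((\<lambda>R::real. (R + k) / R) \<longlongrightarrow> 1) at_top"
    using Lim_transform_eventually by fastforce
  then have "((\<lambda>R. ((R + k) / R) ^ n * c) \<longlongrightarrow> 1 ^ n * c) at_top" by (intro tendsto_intros)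
  then show ?thesis by simp
qed

locale cut_and_project = based_lattice B for B :: "('a::euclidean_space \<times> real) set" +
  assumes dense_snd: "closure (snd ` lat) = UNIV"
begin

lemma snd_approx: "\<delta> > 0 \<Longrightarrow> \<exists>\<gamma>\<in>lat. \<bar>snd \<gamma> - y\<bar> < \<delta>"
  using dense_snd closure_approachable[of y "snd ` lat"] by (auto simp: dist_real_def)

text \<open>Density of the projected lattice and compactness; finiteness serves both to bound shifts
  and to bound the number of windows needed to cover a larger one.\<close>

lemma compact_cover:
  assumes "\<delta> > 0" "compact S"
  obtains C where "finite C" "C \<subseteq> lat" "\<And>y. y \<in> S \<Longrightarrow> \<exists>\<gamma>\<in>C. \<bar>snd \<gamma> - y\<bar> < \<delta>"
proof -
  have sub: "S \<subseteq> (\<Union>\<gamma>\<in>lat. {y. \<bar>snd \<gamma> - y\<bar> < \<delta>})" using snd_approx[OF assms(1)] by auto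
  have op: "open {y. \<bar>snd \<gamma> - y\<bar> < \<delta>}" for \<gamma> :: "'a \<times> real"
    by (intro open_Collect_less continuous_intros)
  obtain C where "C \<subseteq> lat" "finite C" "S \<subseteq> (\<Union>\<gamma>\<in>C. {y. \<bar>snd \<gamma> - y\<bar> < \<delta>})"
    by (rule compactE_image[OF assms(2) op sub])
  then show ?thesis by (intro that[of C]) auto
qed

text \<open>Points of the cell may have large second coordinate, which would distort a window of
  fixed length by a fixed proportion. Density moves them by lattice vectors into a slab of width
  \<open>\<delta>\<close>; as finitely many vectors do, the first coordinate stays bounded.\<close>

lemma small_shift:
  assumes "\<delta> > 0"
  obtains M where "M \<ge> 0" "\<And>z. z \<in> fdom \<Longrightarrow> \<exists>\<gamma>\<in>lat. norm (fst (z + \<gamma>)) \<le> M \<and> \<bar>snd (z + \<gamma>)\<bar> \<le> \<delta>"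
proof -
  obtain L where L: "\<And>z. z \<in> fdom \<Longrightarrow> norm z \<le> L" using bounded_fdom unfolding bounded_iff by blast
  obtain C where C: "finite C" "C \<subseteq> lat" "\<And>y. y \<in> {-L..L} \<Longrightarrow> \<exists>\<gamma>\<in>C. \<bar>snd \<gamma> - y\<bar> < \<delta>"
    using compact_cover[OF assms compact_Icc] by blast
  show ?thesis
  proof (rule that[of "\<bar>L\<bar> + (\<Sum>\<gamma>\<in>C. norm \<gamma>)"])
    show "0 \<le> \<bar>L\<bar> + (\<Sum>\<gamma>\<in>C. norm \<gamma>)" by (simp add: sum_nonneg)
    fix z assume z: "z \<in> fdom"
    have "\<bar>snd z\<bar> \<le> L" using L[OF z] norm_snd_le[of "snd z" "fst z"] by simp
    then have "- snd z \<in> {-L..L}" by auto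
    then obtain \<gamma> where g: "\<gamma> \<in> C" "\<bar>snd \<gamma> - (- snd z)\<bar> < \<delta>" using C(3) by blast
    have "norm (fst (z + \<gamma>)) \<le> norm (z + \<gamma>)"
      using norm_fst_le[of "fst (z + \<gamma>)" "snd (z + \<gamma>)"] unfolding prod.collapse .
    also have "\<dots> \<le> norm z + norm \<gamma>" by (rule norm_triangle_ineq)
    also have "norm \<gamma> \<le> (\<Sum>\<gamma>\<in>C. norm \<gamma>)" by (rule member_le_sum) (use g C in auto)
    finally have "norm (fst (z + \<gamma>)) \<le> \<bar>L\<bar> + (\<Sum>\<gamma>\<in>C. norm \<gamma>)" using L[OF z] by linarith
    then show "\<exists>\<gamma>\<in>lat. norm (fst (z + \<gamma>)) \<le> \<bar>L\<bar> + (\<Sum>\<gamma>\<in>C. norm \<gamma>) \<and> \<bar>snd (z + \<gamma>)\<bar> \<le> \<delta>"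
      using g C by (intro bexI[of _ \<gamma>]) auto
  qed
qed

end

lemma component_bound: "norm v \<le> M \<Longrightarrow> \<bar>v $ i\<bar> \<le> M" for v :: "real^'m"
  using component_le_norm_cart[of v i] by linarith

text \<open>Boxes shrunk or enlarged by \<open>M\<close> in space and by \<open>\<delta>\<close> in
  the window bound the number of lattice points by volumes. Letting \<open>R\<close> grow removes
  \<open>M\<close>, after which \<open>\<delta>\<close> is arbitrary.\<close>

lemma set_density_model_set:
  fixes B :: "((real^'m) \<times> real) set"
  assumes "cut_and_project B" and inj: "inj_on fst (based_lattice.lat B)" and ab: "a < b"
  shows "set_density (model_set (based_lattice.lat B) {a..b}) = (b - a) / based_lattice.covol B"
proof -
  interpret cut_and_project B by fact
  let ?Q = "\<lambda>x R. cbox x (x + vec R :: real^'m)"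
  have card: "card (model_set lat {a..b} \<inter> ?Q x R) = card (lat \<inter> (?Q x R \<times> {a..b}))" for x R
  proof -
    have "model_set lat {a..b} \<inter> ?Q x R = fst ` (lat \<inter> (?Q x R \<times> {a..b}))"
      by (force simp: model_set_def)
    then show ?thesis using inj by (simp add: card_image inj_on_subset)
  qed
  have bnd: "bounded (?Q x R \<times> {a..b})" for x R by (intro bounded_Times) auto
  have lower: "((R + (- 2 * M)) / R) ^ CARD('m) * ((b - a - 2 * \<delta>) / covol) \<le> card (model_set lat {a..b} \<inter> ?Q x R) / R ^ CARD('m)"
    if M: "M \<ge> 0" "\<And>z. z \<in> fdom \<Longrightarrow> \<exists>\<gamma>\<in>lat. norm (fst (z + \<gamma>)) \<le> M \<and> \<bar>snd (z + \<gamma>)\<bar> \<le> \<delta>"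
      and R: "R > 0" "R \<ge> 2 * M" and d: "2 * \<delta> < b - a" for M R x \<delta>
  proof -
    have "ennreal ((R - 2 * M) ^ CARD('m) * ((b - \<delta>) - (a + \<delta>))) \<le> ennreal (covol * real (card (lat \<inter> (?Q x R \<times> {a..b}))))"
    proof (subst emeasure_cube_times[symmetric, where x="x + vec M"])
      show "emeasure lborel (?Q (x + vec M) (R - 2 * M) \<times> {a + \<delta>..b - \<delta>}) \<le> ennreal (covol * real (card (lat \<inter> (?Q x R \<times> {a..b}))))"
      proof (rule measure_le_card_lat[OF _ bnd])
        show "?Q (x + vec M) (R - 2 * M) \<times> {a + \<delta>..b - \<delta>} \<in> sets borel"
          by (intro borel_closed closed_Times) auto
        fix z assume "z \<in> fdom"
        then obtain \<gamma> where g: "\<gamma> \<in> lat" "norm (fst (z + \<gamma>)) \<le> M" "\<bar>snd (z + \<gamma>)\<bar> \<le> \<delta>" using M(2) by blast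
        have c: "\<bar>fst (z + \<gamma>) $ i\<bar> \<le> M" for i using component_bound[OF g(2)] .
        have "p - (z + \<gamma>) \<in> ?Q x R \<times> {a..b}" if p: "p \<in> ?Q (x + vec M) (R - 2 * M) \<times> {a + \<delta>..b - \<delta>}" for p
        proof -
          have "x $ i \<le> (fst p - fst (z + \<gamma>)) $ i \<and> (fst p - fst (z + \<gamma>)) $ i \<le> (x + vec R) $ i" for i
          proof -
            have "x $ i + M \<le> fst p $ i" "fst p $ i \<le> x $ i + M + (R - 2 * M)"
              using p by (auto simp: mem_Times_iff mem_box_cart)
            then show ?thesis using c[of i] by (simp only: vector_minus_component vector_add_component vec_component) linarith
          qed
          moreover have "a \<le> snd p - snd (z + \<gamma>)" "snd p - snd (z + \<gamma>) \<le> b" using p g(3) by auto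
          ultimately show ?thesis by (simp add: mem_Times_iff mem_box_cart)
        qed
        then show "\<exists>\<gamma>0\<in>lat. \<forall>p\<in>?Q (x + vec M) (R - 2 * M) \<times> {a + \<delta>..b - \<delta>}. p - (z + \<gamma>0) \<in> ?Q x R \<times> {a..b}"
          using g(1) by blast
      qed
    qed (use R d in auto)
    then have "(R - 2 * M) ^ CARD('m) * (b - a - 2 * \<delta>) \<le> covol * real (card (lat \<inter> (?Q x R \<times> {a..b})))"
      using covol_pos by (simp add: ennreal_le_iff algebra_simps)
    then have "(R - 2 * M) ^ CARD('m) * (b - a - 2 * \<delta>) / (covol * R ^ CARD('m))
        \<le> covol * real (card (lat \<inter> (?Q x R \<times> {a..b}))) / (covol * R ^ CARD('m))"
      by (rule divide_right_mono) (use covol_pos R in auto)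
    then show ?thesis using covol_pos unfolding card by (simp add: power_divide mult.commute)
  qed
  have upper: "card (model_set lat {a..b} \<inter> ?Q x R) / R ^ CARD('m) \<le> ((R + 2 * M) / R) ^ CARD('m) * ((b - a + 2 * \<delta>) / covol)"
    if M: "M \<ge> 0" "\<And>z. z \<in> fdom \<Longrightarrow> \<exists>\<gamma>\<in>lat. norm (fst (z + \<gamma>)) \<le> M \<and> \<bar>snd (z + \<gamma>)\<bar> \<le> \<delta>"
      and R: "R > 0" and d: "\<delta> > 0" for M R x \<delta>
  proof -
    have "ennreal (covol * real (card (lat \<inter> (?Q x R \<times> {a..b})))) \<le> ennreal ((R + 2 * M) ^ CARD('m) * ((b + \<delta>) - (a - \<delta>)))"
    proof (subst emeasure_cube_times[symmetric, where x="x - vec M"])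
      show "ennreal (covol * real (card (lat \<inter> (?Q x R \<times> {a..b})))) \<le> emeasure lborel (?Q (x - vec M) (R + 2 * M) \<times> {a - \<delta>..b + \<delta>})"
      proof (rule card_lat_le_measure[OF _ bnd])
        show "?Q (x - vec M) (R + 2 * M) \<times> {a - \<delta>..b + \<delta>} \<in> sets borel"
          by (intro borel_closed closed_Times) auto
        fix z assume "z \<in> fdom"
        then obtain \<gamma> where g: "\<gamma> \<in> lat" "norm (fst (z + \<gamma>)) \<le> M" "\<bar>snd (z + \<gamma>)\<bar> \<le> \<delta>" using M(2) by blast
        have c: "\<bar>fst (z + \<gamma>) $ i\<bar> \<le> M" for i using component_bound[OF g(2)] .
        have "p + (z + \<gamma>) \<in> ?Q (x - vec M) (R + 2 * M) \<times> {a - \<delta>..b + \<delta>}" if p: "p \<in> ?Q x R \<times> {a..b}" for p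
        proof -
          have "(x - vec M) $ i \<le> (fst p + fst (z + \<gamma>)) $ i \<and> (fst p + fst (z + \<gamma>)) $ i \<le> (x - vec M + vec (R + 2 * M)) $ i" for i
          proof -
            have "x $ i \<le> fst p $ i" "fst p $ i \<le> x $ i + R"
              using p by (auto simp: mem_Times_iff mem_box_cart)
            then show ?thesis using c[of i]
              by (simp only: vector_minus_component[of x "vec M"] vector_add_component vec_component) linarith
          qed
          moreover have "a - \<delta> \<le> snd p + snd (z + \<gamma>)" "snd p + snd (z + \<gamma>) \<le> b + \<delta>" using p g(3) by auto
          ultimately show ?thesis by (simp add: mem_Times_iff mem_box_cart)
        qed
        then show "\<exists>\<gamma>0\<in>lat. \<forall>p\<in>?Q x R \<times> {a..b}. p + (z + \<gamma>0) \<in> ?Q (x - vec M) (R + 2 * M) \<times> {a - \<delta>..b + \<delta>}"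
          using g(1) by blast
      qed
    qed (use R M ab d in auto)
    then have "covol * real (card (lat \<inter> (?Q x R \<times> {a..b}))) \<le> (R + 2 * M) ^ CARD('m) * (b - a + 2 * \<delta>)"
    proof (subst (asm) ennreal_le_iff)
      show "0 \<le> (R + 2 * M) ^ CARD('m) * (b + \<delta> - (a - \<delta>))"
        using ab d R M(1) by (intro mult_nonneg_nonneg zero_le_power) auto
    qed (simp add: algebra_simps)
    then have "covol * real (card (lat \<inter> (?Q x R \<times> {a..b}))) / (covol * R ^ CARD('m))
        \<le> (R + 2 * M) ^ CARD('m) * (b - a + 2 * \<delta>) / (covol * R ^ CARD('m))"
      by (rule divide_right_mono) (use covol_pos R in auto)
    then show ?thesis using covol_pos unfolding card by (simp add: power_divide mult.commute)
  qed
  have lim: "((\<lambda>R. real (card (model_set lat {a..b} \<inter> ?Q x R)) / R ^ CARD('m)) \<longlongrightarrow> (b - a) / covol) at_top" for x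
  proof (rule order_tendstoI)
    fix l assume l: "l < (b - a) / covol"
    \<comment> \<open>A quarter of the gap: the window loses \<open>2 * \<delta>\<close>, half of
      it. The \<open>max 0\<close> keeps \<open>2 * \<delta>\<close> below \<open>b - a\<close> when
      \<open>l\<close> is negative.\<close>
    define \<delta> where "\<delta> = (b - a - max 0 (l * covol)) / 4"
    have "l * covol < b - a" using l covol_pos by (simp add: field_simps)
    moreover have "0 < b - a" using ab by simp
    moreover have "0 < (s - max 0 t) / 4" "2 * ((s - max 0 t) / 4) < s" "t < s - 2 * ((s - max 0 t) / 4)"
      if "t < s" "0 < s" for s t :: real
      using that by (simp_all add: max_def field_simps)
    ultimately have d: "\<delta> > 0" "2 * \<delta> < b - a" "l * covol < b - a - 2 * \<delta>" unfolding \<delta>_def by blast+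
    then have l': "l < (b - a - 2 * \<delta>) / covol" using covol_pos by (simp add: field_simps)
    obtain M where M: "M \<ge> 0" "\<And>z. z \<in> fdom \<Longrightarrow> \<exists>\<gamma>\<in>lat. norm (fst (z + \<gamma>)) \<le> M \<and> \<bar>snd (z + \<gamma>)\<bar> \<le> \<delta>"
      using small_shift[OF d(1)] by blast
    have "eventually (\<lambda>R. l < ((R + (- 2 * M)) / R) ^ CARD('m) * ((b - a - 2 * \<delta>) / covol)) at_top"
      by (rule order_tendstoD(1)[OF tendsto_cube_ratio l'])
    then show "eventually (\<lambda>R. l < real (card (model_set lat {a..b} \<inter> ?Q x R)) / R ^ CARD('m)) at_top"
      using eventually_gt_at_top[of 0] eventually_ge_at_top[of "2 * M"]
      by eventually_elim (use lower[OF M _ _ d(2)] in \<open>meson less_le_trans\<close>)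
  next
    fix u assume u: "(b - a) / covol < u"
    define \<delta> where "\<delta> = (u * covol - (b - a)) / 4"
    have "b - a < u * covol" using u covol_pos by (simp add: field_simps)
    moreover have "0 < (t - s) / 4" "s + 2 * ((t - s) / 4) < t" if "s < t" for s t :: real
      using that by (simp_all add: field_simps)
    ultimately have d: "\<delta> > 0" "b - a + 2 * \<delta> < u * covol" unfolding \<delta>_def by blast+
    then have u': "(b - a + 2 * \<delta>) / covol < u" using covol_pos by (simp add: field_simps)
    obtain M where M: "M \<ge> 0" "\<And>z. z \<in> fdom \<Longrightarrow> \<exists>\<gamma>\<in>lat. norm (fst (z + \<gamma>)) \<le> M \<and> \<bar>snd (z + \<gamma>)\<bar> \<le> \<delta>"
      using small_shift[OF d(1)] by blast
    have "eventually (\<lambda>R. ((R + 2 * M) / R) ^ CARD('m) * ((b - a + 2 * \<delta>) / covol) < u) at_top"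
      by (rule order_tendstoD(2)[OF tendsto_cube_ratio u'])
    then show "eventually (\<lambda>R. real (card (model_set lat {a..b} \<inter> ?Q x R)) / R ^ CARD('m) < u) at_top"
      using eventually_gt_at_top[of 0]
      by eventually_elim (use upper[OF M _ d(1)] in \<open>meson le_less_trans\<close>)
  qed
  show ?thesis
    unfolding set_density_def
  proof (rule the_equality)
    show "\<forall>x. ((\<lambda>R. real (card (model_set lat {a..b} \<inter> ?Q x R)) / R ^ CARD('m)) \<longlongrightarrow> (b - a) / covol) at_top"
      using lim by blast
    fix d assume "\<forall>x. ((\<lambda>R. real (card (model_set lat {a..b} \<inter> ?Q x R)) / R ^ CARD('m)) \<longlongrightarrow> d) at_top"
    then show "d = (b - a) / covol" using lim[of 0] tendsto_unique trivial_limit_at_top_linorder by blast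
  qed
qed

section \<open>The function \<open>\<Phi>\<close>\<close>

definition box_density :: "real \<Rightarrow> real \<Rightarrow> complex" where
  "box_density r t = of_real (indicator {-r..r} t / (2 * r))"

lemma box_density_measurable [measurable]: "box_density r \<in> borel_measurable borel"
  unfolding box_density_def by measurable

lemma cmod_box_density: "r > 0 \<Longrightarrow> cmod (box_density r t) = indicator {-r..r} t / (2 * r)"
  unfolding box_density_def norm_of_real by (simp add: abs_of_nonneg)

lemma nn_integral_box_density:
  assumes "r > 0"
  shows "(\<integral>\<^sup>+t. ennreal (cmod (box_density r t)) \<partial>lborel) = 1"
proof -
  have "(\<integral>\<^sup>+t. ennreal (cmod (box_density r t)) \<partial>lborel) = (\<integral>\<^sup>+t. ennreal (1 / (2 * r)) * indicator {-r..r} t \<partial>lborel)"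
    using assms by (intro nn_integral_cong) (auto simp: cmod_box_density indicator_def)
  also have "\<dots> = 1"
    using assms by (subst nn_integral_cmult_indicator) (auto simp flip: ennreal_mult')
  finally show ?thesis .
qed

lemma nice_box_density:
  assumes "r > 0"
  shows "nice (box_density r)"
  unfolding nice_def
proof (intro conjI)
  show "integrable lborel (box_density r)"
    by (rule integrableI_bounded) (use nn_integral_box_density[OF assms] in auto)
  show "bounded (range (box_density r))"
    unfolding bounded_iff using assms by (intro exI[of _ "1 / (2 * r)"]) (auto simp: cmod_box_density indicator_def)
  have "AE x in lborel. x \<noteq> r" "AE x in lborel. x \<noteq> - r" by (rule AE_lborel_singleton)+
  then show "AE x in lborel. isCont (box_density r) x"
  proof eventually_elim
    case (elim x)
    consider "x < - r" | "- r < x" "x < r" | "r < x" using elim by linarith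
    then show ?case
    proof cases
      case 1
      then have "eventually (\<lambda>y. y < -r) (nhds x)" by (intro eventually_nhds_in_open[of "{..< -r}", simplified]) auto
      then have "eventually (\<lambda>y. box_density r y = 0) (nhds x)" by eventually_elim (auto simp: box_density_def)
      then show ?thesis by (subst isCont_cong) auto
    next
      case 2
      then have "eventually (\<lambda>y. y \<in> {-r<..<r}) (nhds x)" by (intro eventually_nhds_in_open) auto
      then have "eventually (\<lambda>y. box_density r y = 1 / (2 * of_real r)) (nhds x)" by eventually_elim (auto simp: box_density_def)
      then show ?thesis by (subst isCont_cong) auto
    next
      case 3
      then have "eventually (\<lambda>y. r < y) (nhds x)" by (intro eventually_nhds_in_open[of "{r<..}", simplified]) auto
      then have "eventually (\<lambda>y. box_density r y = 0) (nhds x)" by eventually_elim (auto simp: box_density_def)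
      then show ?thesis by (subst isCont_cong) auto
    qed
  qed
qed

lemma convolve_box_density:
  assumes [measurable]: "u \<in> borel_measurable borel"
  shows "convolve u (box_density r) = corr u (box_density r)"
proof
  fix t
  have "convolve u (box_density r) t = (LINT s|lborel. u s * box_density r (t - s))"
    unfolding convolve_def by (rule integral_completion) measurable
  also have "\<dots> = (LINT s|lborel. u (t + 1 * s) * box_density r (t - (t + 1 * s)))"
    by (subst lborel_integral_real_affine[of 1 _ t]) simp_all
  also have "\<dots> = (LINT s|lborel. u (s + t) * cnj (box_density r s))"
    by (intro Bochner_Integration.integral_cong) (auto simp: box_density_def indicator_def add.commute)
  finally show "convolve u (box_density r) t = corr u (box_density r) t" by (simp add: corr_def)
qed

text \<open>Lipschitz continuity of translation in \<open>L^1\<close>. It survives convolution with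
  a probability density and bounds how far such a convolution moves the function, which is what
  convergence of the infinite product rests on.\<close>

definition L1_modulus :: "(real \<Rightarrow> complex) \<Rightarrow> real \<Rightarrow> bool" where
  "L1_modulus u L \<longleftrightarrow> (\<forall>s. (\<integral>\<^sup>+t. ennreal (cmod (u (t + s) - u t)) \<partial>lborel) \<le> ennreal (L * \<bar>s\<bar>))"

text \<open>The box and its translate differ at most on two intervals of length
  \<open>\<bar>s\<bar>\<close> at the endpoints, where the height is
  \<open>1 / (2 * r)\<close>.\<close>

lemma L1_modulus_box_density:
  assumes r: "r > 0"
  shows "L1_modulus (box_density r) (1 / r)"
  unfolding L1_modulus_def
proof
  fix s :: real
  have "(\<integral>\<^sup>+t. ennreal (cmod (box_density r (t + s) - box_density r t)) \<partial>lborel)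
      \<le> (\<integral>\<^sup>+t. ennreal (1 / (2 * r)) * indicator ({min (-r) (-r-s)..max (-r) (-r-s)} \<union> {min r (r-s)..max r (r-s)}) t \<partial>lborel)"
  proof (rule nn_integral_mono)
    fix t
    have "cmod (box_density r (t + s) - box_density r t) = \<bar>indicator {-r..r} (t + s) - indicator {-r..r} t\<bar> / (2 * r)"
      using r by (simp add: box_density_def flip: of_real_diff diff_divide_distrib del: of_real_divide)
    also have "\<dots> \<le> (1 / (2 * r)) * indicator ({min (-r) (-r-s)..max (-r) (-r-s)} \<union> {min r (r-s)..max r (r-s)}) t"
      using r by (auto simp: indicator_def min_def max_def)
    finally show "ennreal (cmod (box_density r (t + s) - box_density r t)) \<le> ennreal (1 / (2 * r)) * indicator ({min (-r) (-r-s)..max (-r) (-r-s)} \<union> {min r (r-s)..max r (r-s)}) t"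
      using r by (auto simp: indicator_def split: if_splits intro: ennreal_leI)
  qed
  also have "\<dots> = ennreal (1 / (2 * r)) * emeasure lborel ({min (-r) (-r-s)..max (-r) (-r-s)} \<union> {min r (r-s)..max r (r-s)})"
    by (rule nn_integral_cmult_indicator) simp
  also have "\<dots> \<le> ennreal (1 / (2 * r)) * (emeasure lborel {min (-r) (-r-s)..max (-r) (-r-s)} + emeasure lborel {min r (r-s)..max r (r-s)})"
    by (intro mult_left_mono emeasure_subadditive) auto
  also have "\<dots> = ennreal (1 / (2 * r)) * ennreal (2 * \<bar>s\<bar>)"
  proof -
    have "max (-r) (-r-s) - min (-r) (-r-s) = \<bar>s\<bar>" "max r (r-s) - min r (r-s) = \<bar>s\<bar>" by (auto simp: max_def min_def)
    then show ?thesis by (simp flip: ennreal_plus)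
  qed
  also have "\<dots> = ennreal ((1 / r) * \<bar>s\<bar>)" using r by (simp flip: ennreal_mult')
  finally show "(\<integral>\<^sup>+t. ennreal (cmod (box_density r (t + s) - box_density r t)) \<partial>lborel) \<le> ennreal ((1 / r) * \<bar>s\<bar>)" .
qed

text \<open>Minkowski's integral inequality: \<open>F\<close> is an average of the
  \<open>D s\<close> with a weight of mass one, so a common \<open>L^1\<close> bound passes to it.
  Both estimates of \<open>convolve_box_L1\<close> are instances.\<close>

lemma box_average_L1:
  assumes r: "r > 0" and [measurable]: "(\<lambda>(s, t). D s t) \<in> borel_measurable (borel \<Otimes>\<^sub>M borel)"
    and D: "\<And>s. \<bar>s\<bar> \<le> r \<Longrightarrow> (\<integral>\<^sup>+t. ennreal (cmod (D s t)) \<partial>lborel) \<le> c"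
    and F: "\<And>t. F t = (LINT s|lborel. D s t * cnj (box_density r s))"
  shows "(\<integral>\<^sup>+t. ennreal (cmod (F t)) \<partial>lborel) \<le> c"
proof -
  have [measurable]: "(\<lambda>t. D s t) \<in> borel_measurable borel" for s
    using measurable_compose[OF measurable_Pair1'[of s borel borel] assms(2)] by simp
  have "(\<integral>\<^sup>+t. ennreal (cmod (F t)) \<partial>lborel) \<le> (\<integral>\<^sup>+t. (\<integral>\<^sup>+s. ennreal (cmod (D s t)) * ennreal (cmod (box_density r s)) \<partial>lborel) \<partial>lborel)"
  proof (rule nn_integral_mono)
    fix t
    \<comment> \<open>Where the integrand is not integrable, \<open>F t\<close> is 0 by convention
      and the bound is trivial.\<close>
    have "ennreal (cmod (F t)) \<le> (\<integral>\<^sup>+s. ennreal (cmod (D s t * cnj (box_density r s))) \<partial>lborel)"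
      unfolding F
      by (cases "integrable lborel (\<lambda>s. D s t * cnj (box_density r s))")
        (simp_all add: integral_norm_bound_ennreal not_integrable_integral_eq)
    then show "ennreal (cmod (F t)) \<le> (\<integral>\<^sup>+s. ennreal (cmod (D s t)) * ennreal (cmod (box_density r s)) \<partial>lborel)"
      by (simp add: norm_mult ennreal_mult')
  qed
  also have "\<dots> = (\<integral>\<^sup>+s. (\<integral>\<^sup>+t. ennreal (cmod (D s t)) * ennreal (cmod (box_density r s)) \<partial>lborel) \<partial>lborel)"
    by (rule lborel_pair.Fubini') measurable
  also have "\<dots> = (\<integral>\<^sup>+s. (\<integral>\<^sup>+t. ennreal (cmod (D s t)) \<partial>lborel) * ennreal (cmod (box_density r s)) \<partial>lborel)"
    by (intro nn_integral_cong nn_integral_multc) measurable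
  also have "\<dots> \<le> (\<integral>\<^sup>+s. c * ennreal (cmod (box_density r s)) \<partial>lborel)"
  proof (rule nn_integral_mono)
    fix s
    show "(\<integral>\<^sup>+t. ennreal (cmod (D s t)) \<partial>lborel) * ennreal (cmod (box_density r s)) \<le> c * ennreal (cmod (box_density r s))"
    proof (cases "\<bar>s\<bar> \<le> r")
      case False
      then have "box_density r s = 0" by (auto simp: box_density_def indicator_def)
      then show ?thesis by simp
    qed (auto intro!: mult_right_mono D)
  qed
  also have "\<dots> = c" using nn_integral_box_density[OF r] by (subst nn_integral_cmult) auto
  finally show ?thesis .
qed

text \<open>Translation commutes with convolution, which preserves the modulus; the difference from
  \<open>u\<close> averages \<open>u (t + s) - u t\<close> over
  \<open>\<bar>s\<bar> \<le> r\<close>, which gives the distance.\<close>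

lemma convolve_box_L1:
  assumes r: "r > 0" and u: "integrable lborel u" and L: "L1_modulus u L" "L \<ge> 0"
  shows "integrable lborel (convolve u (box_density r))"
    and "L1_modulus (convolve u (box_density r)) L"
    and "(\<integral>\<^sup>+t. ennreal (cmod (convolve u (box_density r) t - u t)) \<partial>lborel) \<le> ennreal (L * r)"
proof -
  have [measurable]: "u \<in> borel_measurable borel" using u by auto
  have eq: "convolve u (box_density r) = corr u (box_density r)" by (rule convolve_box_density) measurable
  have bi: "integrable lborel (box_density r)" using nice_box_density[OF r] by (rule niceD)
  show "integrable lborel (convolve u (box_density r))"
    unfolding eq by (rule integrable_corr[OF u bi])
  have B: "cmod (box_density r s) \<le> 1 / (2 * r)" for s using r by (auto simp: cmod_box_density indicator_def)
  have ci: "integrable lborel (\<lambda>s. u (s + t) * cnj (box_density r s))" for t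
  proof (rule Bochner_Integration.integrable_bound)
    show "integrable lborel (\<lambda>s. (1 / (2 * r)) * cmod (u (t + s)))"
      by (intro integrable_mult_right integrable_norm integrable_lborel_shift u)
    show "AE s in lborel. norm (u (s + t) * cnj (box_density r s)) \<le> norm ((1 / (2 * r)) * cmod (u (t + s)))"
      using mult_left_mono[OF B norm_ge_zero] r by (intro AE_I2) (simp add: norm_mult add.commute abs_mult)
  qed measurable
  have bs: "integrable lborel (\<lambda>s. cnj (box_density r s))" "(LINT s|lborel. cnj (box_density r s)) = 1"
  proof -
    show "integrable lborel (\<lambda>s. cnj (box_density r s))" using bi by simp
    have "(LINT s|lborel. cnj (box_density r s)) = of_real (LINT s|lborel. cmod (box_density r s))"
      unfolding integral_complex_of_real[symmetric] cmod_box_density[OF r]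
      by (intro Bochner_Integration.integral_cong) (auto simp: box_density_def)
    also have "(LINT s|lborel. cmod (box_density r s)) = 1"
      using nn_integral_box_density[OF r] by (subst integral_eq_nn_integral) auto
    finally show "(LINT s|lborel. cnj (box_density r s)) = 1" by simp
  qed
  show "L1_modulus (convolve u (box_density r)) L"
    unfolding L1_modulus_def
  proof
    fix h
    show "(\<integral>\<^sup>+t. ennreal (cmod (convolve u (box_density r) (t + h) - convolve u (box_density r) t)) \<partial>lborel) \<le> ennreal (L * \<bar>h\<bar>)"
    proof (rule box_average_L1[OF r, where D="\<lambda>s t. u (s + t + h) - u (s + t)"])
      fix s
      have "(\<integral>\<^sup>+t. ennreal (cmod (u (s + t + h) - u (s + t))) \<partial>lborel) = (\<integral>\<^sup>+t. ennreal (cmod (u (t + h) - u t)) \<partial>lborel)"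
        by (rule nn_integral_lborel_shift[of "\<lambda>t. ennreal (cmod (u (t + h) - u t))" s]) measurable
      then show "(\<integral>\<^sup>+t. ennreal (cmod (u (s + t + h) - u (s + t))) \<partial>lborel) \<le> ennreal (L * \<bar>h\<bar>)"
        using L(1) by (simp add: L1_modulus_def)
    next
      fix t
      have "convolve u (box_density r) (t + h) - convolve u (box_density r) t
          = (LINT s|lborel. u (s + (t + h)) * cnj (box_density r s) - u (s + t) * cnj (box_density r s))"
        unfolding eq corr_def by (rule Bochner_Integration.integral_diff[OF ci ci, symmetric])
      then show "convolve u (box_density r) (t + h) - convolve u (box_density r) t = (LINT s|lborel. (u (s + t + h) - u (s + t)) * cnj (box_density r s))"
        by (simp add: left_diff_distrib add.assoc)
    qed measurable
  qed
  show "(\<integral>\<^sup>+t. ennreal (cmod (convolve u (box_density r) t - u t)) \<partial>lborel) \<le> ennreal (L * r)"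
  proof (rule box_average_L1[OF r, where D="\<lambda>s t. u (t + s) - u t"])
    fix s :: real assume "\<bar>s\<bar> \<le> r"
    then have "L * \<bar>s\<bar> \<le> L * r" using L(2) by (intro mult_left_mono)
    then show "(\<integral>\<^sup>+t. ennreal (cmod (u (t + s) - u t)) \<partial>lborel) \<le> ennreal (L * r)"
      using L(1) unfolding L1_modulus_def by (meson ennreal_leI order_trans)
  next
    fix t
    have "convolve u (box_density r) t - u t = (LINT s|lborel. u (s + t) * cnj (box_density r s)) - (LINT s|lborel. u t * cnj (box_density r s))"
      unfolding eq corr_def integral_mult_right_zero bs(2) by simp
    also have "\<dots> = (LINT s|lborel. u (s + t) * cnj (box_density r s) - u t * cnj (box_density r s))"
      by (rule Bochner_Integration.integral_diff[OF ci integrable_mult_right[OF bs(1)], symmetric])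
    finally show "convolve u (box_density r) t - u t = (LINT s|lborel. (u (t + s) - u t) * cnj (box_density r s))"
      by (simp add: left_diff_distrib add.commute)
  qed measurable
qed

text \<open>The Riesz-Fischer argument: the sum \<open>W\<close> of the successive differences is
  integrable, so the telescoping series converges almost everywhere and
  \<open>cmod (u 0 t) + enn2real (W t)\<close> dominates the whole sequence.\<close>

lemma L1_limit:
  fixes u :: "nat \<Rightarrow> real \<Rightarrow> complex"
  assumes u: "\<And>n. integrable lborel (u n)"
    and \<rho>: "\<And>n. (\<integral>\<^sup>+t. ennreal (cmod (u (Suc n) t - u n t)) \<partial>lborel) \<le> ennreal (\<rho> n)" "\<And>n. \<rho> n \<ge> 0" "summable \<rho>"
  obtains \<psi> where "integrable lborel \<psi>" "(\<lambda>n. \<integral>\<^sup>+t. ennreal (cmod (u n t - \<psi> t)) \<partial>lborel) \<longlonglongrightarrow> 0"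
proof -
  define w where "w n t = u (Suc n) t - u n t" for n t
  have [measurable]: "u n \<in> borel_measurable borel" for n using u[of n] by auto
  have [measurable]: "w n \<in> borel_measurable borel" for n unfolding w_def by measurable
  define W where "W t = (\<Sum>i. ennreal (cmod (w i t)))" for t
  have [measurable]: "W \<in> borel_measurable borel" unfolding W_def by measurable
  have "(\<integral>\<^sup>+t. W t \<partial>lborel) = (\<Sum>i. \<integral>\<^sup>+t. ennreal (cmod (w i t)) \<partial>lborel)"
    unfolding W_def by (rule nn_integral_suminf) measurable
  also have "\<dots> \<le> (\<Sum>i. ennreal (\<rho> i))" using \<rho>(1) by (intro suminf_le) (auto simp: w_def)
  also have "\<dots> = ennreal (suminf \<rho>)" using \<rho> by (simp add: suminf_ennreal2)
  finally have Wfin: "(\<integral>\<^sup>+t. W t \<partial>lborel) < \<infinity>" by (simp add: le_less_trans)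
  then have AE_W: "AE t in lborel. W t < \<infinity>"
    using nn_integral_PInf_AE[of W lborel] by (simp add: less_top)
  have Wi: "integrable lborel (\<lambda>t. enn2real (W t))"
  proof (rule integrableI_bounded)
    have "(\<integral>\<^sup>+t. ennreal (norm (enn2real (W t))) \<partial>lborel) \<le> (\<integral>\<^sup>+t. W t \<partial>lborel)"
      by (intro nn_integral_mono) (simp add: ennreal_enn2real_if)
    then show "(\<integral>\<^sup>+t. ennreal (norm (enn2real (W t))) \<partial>lborel) < \<infinity>" using Wfin by simp
  qed measurable
  define \<psi> where "\<psi> t = lim (\<lambda>n. u n t)" for t
  have AEc: "AE t in lborel. (\<lambda>n. u n t) \<longlonglongrightarrow> \<psi> t \<and> (\<forall>n. cmod (u n t) \<le> cmod (u 0 t) + enn2real (W t))"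
    using AE_W
  proof eventually_elim
    case (elim t)
    have s: "summable (\<lambda>i. cmod (w i t))"
      using elim unfolding W_def by (intro summable_suminf_not_top) auto
    have WR: "W t = ennreal (\<Sum>i. cmod (w i t))"
      unfolding W_def using s by (intro suminf_ennreal2) auto
    have un: "u n t = u 0 t + (\<Sum>i<n. w i t)" for n
      by (induction n) (auto simp: w_def)
    have "(\<lambda>n. \<Sum>i<n. w i t) \<longlonglongrightarrow> (\<Sum>i. w i t)"
      using summable_norm_cancel[OF s] by (rule summable_LIMSEQ)
    then have "(\<lambda>n. u 0 t + (\<Sum>i<n. w i t)) \<longlonglongrightarrow> u 0 t + (\<Sum>i. w i t)" by (intro tendsto_intros)
    then have l: "(\<lambda>n. u n t) \<longlonglongrightarrow> u 0 t + (\<Sum>i. w i t)" by (subst un)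
    then have "(\<lambda>n. u n t) \<longlonglongrightarrow> \<psi> t" unfolding \<psi>_def using limI by metis
    moreover have "cmod (u n t) \<le> cmod (u 0 t) + enn2real (W t)" for n
    proof -
      have "cmod (u n t) \<le> cmod (u 0 t) + cmod (\<Sum>i<n. w i t)" by (subst un) (rule norm_triangle_ineq)
      also have "cmod (\<Sum>i<n. w i t) \<le> (\<Sum>i<n. cmod (w i t))" by (rule norm_sum)
      also have "\<dots> \<le> (\<Sum>i. cmod (w i t))" by (rule sum_le_suminf[OF s]) auto
      also have "\<dots> = enn2real (W t)" unfolding WR by (simp add: suminf_nonneg[OF s])
      finally show ?thesis by simp
    qed
    ultimately show ?case by blast
  qed
  have [measurable]: "\<psi> \<in> borel_measurable borel" unfolding \<psi>_def by measurable
  have Bi: "integrable lborel (\<lambda>t. cmod (u 0 t) + enn2real (W t))" using u Wi by simp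
  have \<psi>b: "AE t in lborel. cmod (\<psi> t) \<le> cmod (u 0 t) + enn2real (W t)"
    using AEc by eventually_elim (metis tendsto_norm LIMSEQ_le_const2)
  have \<psi>i: "integrable lborel \<psi>"
    by (rule Bochner_Integration.integrable_bound[OF Bi]) (use \<psi>b in \<open>auto elim: eventually_mono\<close>)
  have Bi2: "integrable lborel (\<lambda>t. 2 * (cmod (u 0 t) + enn2real (W t)))" by (rule integrable_mult_right[OF Bi])
  have "(\<lambda>n. LINT t|lborel. cmod (u n t - \<psi> t)) \<longlonglongrightarrow> (LINT t::real|lborel. 0)"
  proof (rule integral_dominated_convergence[OF _ _ Bi2])
    show "AE t in lborel. (\<lambda>n. cmod (u n t - \<psi> t)) \<longlonglongrightarrow> 0"
      using AEc by eventually_elim (simp add: tendsto_norm_zero_iff LIM_zero)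
    show "AE t in lborel. norm (cmod (u n t - \<psi> t)) \<le> 2 * (cmod (u 0 t) + enn2real (W t))" for n
      using AEc \<psi>b
    proof eventually_elim
      case (elim t)
      then have "cmod (u n t) \<le> cmod (u 0 t) + enn2real (W t)" by blast
      then show ?case using norm_triangle_ineq4[of "u n t" "\<psi> t"] elim(2) by simp
    qed
  qed measurable
  then have "(\<lambda>n. ennreal (LINT t|lborel. cmod (u n t - \<psi> t))) \<longlonglongrightarrow> ennreal 0" by (intro tendsto_ennrealI) simp
  moreover have "(\<integral>\<^sup>+t. ennreal (cmod (u n t - \<psi> t)) \<partial>lborel) = ennreal (LINT t|lborel. cmod (u n t - \<psi> t))" for n
    by (rule nn_integral_eq_integral) (use u \<psi>i in auto)
  ultimately show ?thesis using that \<psi>i by simp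
qed

text \<open>The modulus \<open>1 / r 0\<close> of the first factor is inherited by every partial
  product, so convolving with the box of radius \<open>r (Suc N)\<close> moves it by at most
  \<open>r (Suc N) / r 0\<close>.\<close>

lemma convolution_prod_box:
  assumes r: "\<And>n. r n > 0" "summable r"
  defines "u \<equiv> convolution_prod (\<lambda>s. box_density (r s))"
  shows "integrable lborel (u N)" "L1_modulus (u N) (1 / r 0)"
    and "(\<integral>\<^sup>+t. ennreal (cmod (u (Suc N) t - u N t)) \<partial>lborel) \<le> ennreal (r (Suc N) / r 0)"
proof -
  have *: "integrable lborel (u N) \<and> L1_modulus (u N) (1 / r 0)" for N
  proof (induction N)
    case 0
    then show ?case using niceD(1)[OF nice_box_density[OF r(1)]] L1_modulus_box_density[OF r(1)] by (simp add: u_def)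
  next
    case (Suc N)
    then show ?case using convolve_box_L1(1,2)[OF r(1)[of "Suc N"], of "u N" "1 / r 0"] r(1)[of 0] by (simp add: u_def)
  qed
  then show "integrable lborel (u N)" "L1_modulus (u N) (1 / r 0)" by auto
  show "(\<integral>\<^sup>+t. ennreal (cmod (u (Suc N) t - u N t)) \<partial>lborel) \<le> ennreal (r (Suc N) / r 0)"
    using convolve_box_L1(3)[OF r(1)[of "Suc N"], of "u N" "1 / r 0"] * r(1)[of 0] by (simp add: u_def)
qed

text \<open>\<open>infinite_convolution\<close> is an arbitrary choice of limit, so the argument
  relies on its defining convergence alone. The bound adds up all steps away from the first
  factor.\<close>

lemma infinite_convolution_box:
  assumes r: "\<And>n. r n > 0" "summable r"
  defines "\<psi> \<equiv> infinite_convolution (\<lambda>s. box_density (r s))"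
  shows "integrable lebesgue \<psi>"
    and "(\<integral>\<^sup>+t. ennreal (cmod (\<psi> t - box_density (r 0) t)) \<partial>lebesgue) \<le> ennreal ((\<Sum>n. r (Suc n)) / r 0)"
proof -
  let ?u = "convolution_prod (\<lambda>s. box_density (r s))"
  have rs: "summable (\<lambda>n. r (Suc n))" using r(2) by (subst summable_Suc_iff)
  have rs0: "summable (\<lambda>n. r (Suc n) / r 0)" using rs by (rule summable_divide)
  have pos: "r (Suc n) / r 0 \<ge> 0" for n using r(1)[of "Suc n"] r(1)[of 0] by simp
  note cp = convolution_prod_box[OF r]
  have um [measurable]: "?u N \<in> borel_measurable borel" for N using cp(1)[of N] by auto
  obtain \<psi>0 where \<psi>0: "integrable lborel \<psi>0" "(\<lambda>n. \<integral>\<^sup>+t. ennreal (cmod (?u n t - \<psi>0 t)) \<partial>lborel) \<longlonglongrightarrow> 0"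
    using L1_limit[OF cp(1,3) pos rs0] by blast
  let ?P = "\<lambda>\<psi>. integrable lebesgue \<psi> \<and> (\<lambda>n. \<integral>\<^sup>+t. ennreal (cmod (?u n t - \<psi> t)) \<partial>lebesgue) \<longlonglongrightarrow> 0"
  have "?P \<psi>0"
    using \<psi>0 by (simp add: integrable_completion nn_integral_completion)
  then have \<psi>: "?P \<psi>"
    unfolding \<psi>_def infinite_convolution_def by (rule someI[where P="?P"])
  then show "integrable lebesgue \<psi>" by blast
  then have pm [measurable]: "\<psi> \<in> borel_measurable lebesgue" by auto
  have ul [measurable]: "?u n \<in> borel_measurable lebesgue" for n by (rule measurable_completion) simp
  have bl [measurable]: "box_density a \<in> borel_measurable lebesgue" for a by (rule measurable_completion) simp
  have d: "(\<integral>\<^sup>+t. ennreal (cmod (?u N t - box_density (r 0) t)) \<partial>lebesgue) \<le> ennreal ((\<Sum>n. r (Suc n)) / r 0)" for N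
  proof -
    have "(\<integral>\<^sup>+t. ennreal (cmod (?u N t - box_density (r 0) t)) \<partial>lebesgue) \<le> ennreal (\<Sum>n<N. r (Suc n) / r 0)"
    proof (induction N)
      case (Suc N)
      have "(\<integral>\<^sup>+t. ennreal (cmod (?u (Suc N) t - box_density (r 0) t)) \<partial>lebesgue)
          \<le> (\<integral>\<^sup>+t. ennreal (cmod (?u (Suc N) t - ?u N t)) + ennreal (cmod (?u N t - box_density (r 0) t)) \<partial>lebesgue)"
      proof (rule nn_integral_mono)
        fix t
        show "ennreal (cmod (?u (Suc N) t - box_density (r 0) t)) \<le> ennreal (cmod (?u (Suc N) t - ?u N t)) + ennreal (cmod (?u N t - box_density (r 0) t))"
          using norm_triangle_ineq[of "?u (Suc N) t - ?u N t" "?u N t - box_density (r 0) t"] by (simp flip: ennreal_plus add: ennreal_leI)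
      qed
      also have "\<dots> = (\<integral>\<^sup>+t. ennreal (cmod (?u (Suc N) t - ?u N t)) \<partial>lebesgue) + (\<integral>\<^sup>+t. ennreal (cmod (?u N t - box_density (r 0) t)) \<partial>lebesgue)"
        by (rule nn_integral_add) measurable
      also have "\<dots> \<le> ennreal (r (Suc N) / r 0) + ennreal (\<Sum>n<N. r (Suc n) / r 0)"
        using cp(3)[of N] Suc by (intro add_mono) (simp_all add: nn_integral_completion)
      also have "\<dots> = ennreal (\<Sum>n<Suc N. r (Suc n) / r 0)"
        using pos by (subst ennreal_plus[symmetric]) (auto intro!: sum_nonneg simp: add.commute)
      finally show ?case .
    qed simp
    also have "(\<Sum>n<N. r (Suc n) / r 0) \<le> (\<Sum>n. r (Suc n) / r 0)" by (rule sum_le_suminf[OF rs0]) (use pos in auto)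
    also have "\<dots> = (\<Sum>n. r (Suc n)) / r 0" using rs by (rule suminf_divide)
    finally show ?thesis by (simp add: ennreal_leI)
  qed
  show "(\<integral>\<^sup>+t. ennreal (cmod (\<psi> t - box_density (r 0) t)) \<partial>lebesgue) \<le> ennreal ((\<Sum>n. r (Suc n)) / r 0)"
  proof (rule LIMSEQ_le_const)
    show "(\<lambda>N. (\<integral>\<^sup>+t. ennreal (cmod (?u N t - \<psi> t)) \<partial>lebesgue) + ennreal ((\<Sum>n. r (Suc n)) / r 0)) \<longlonglongrightarrow> ennreal ((\<Sum>n. r (Suc n)) / r 0)"
      using tendsto_add[OF conjunct2[OF \<psi>] tendsto_const[of "ennreal ((\<Sum>n. r (Suc n)) / r 0)"]] by simp
    show "\<exists>N. \<forall>n\<ge>N. (\<integral>\<^sup>+t. ennreal (cmod (\<psi> t - box_density (r 0) t)) \<partial>lebesgue) \<le> (\<integral>\<^sup>+t. ennreal (cmod (?u n t - \<psi> t)) \<partial>lebesgue) + ennreal ((\<Sum>n. r (Suc n)) / r 0)"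
    proof (intro exI allI impI)
      fix N
      have "(\<integral>\<^sup>+t. ennreal (cmod (\<psi> t - box_density (r 0) t)) \<partial>lebesgue)
          \<le> (\<integral>\<^sup>+t. ennreal (cmod (?u N t - \<psi> t)) + ennreal (cmod (?u N t - box_density (r 0) t)) \<partial>lebesgue)"
      proof (rule nn_integral_mono)
        fix t
        show "ennreal (cmod (\<psi> t - box_density (r 0) t)) \<le> ennreal (cmod (?u N t - \<psi> t)) + ennreal (cmod (?u N t - box_density (r 0) t))"
          using norm_triangle_ineq[of "\<psi> t - ?u N t" "?u N t - box_density (r 0) t"] by (simp flip: ennreal_plus add: ennreal_leI norm_minus_commute)
      qed
      also have "\<dots> = (\<integral>\<^sup>+t. ennreal (cmod (?u N t - \<psi> t)) \<partial>lebesgue) + (\<integral>\<^sup>+t. ennreal (cmod (?u N t - box_density (r 0) t)) \<partial>lebesgue)"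
        by (rule nn_integral_add) measurable
      also have "\<dots> \<le> (\<integral>\<^sup>+t. ennreal (cmod (?u N t - \<psi> t)) \<partial>lebesgue) + ennreal ((\<Sum>n. r (Suc n)) / r 0)"
        using d[of N] by (intro add_left_mono)
      finally show "(\<integral>\<^sup>+t. ennreal (cmod (\<psi> t - box_density (r 0) t)) \<partial>lebesgue) \<le> (\<integral>\<^sup>+t. ennreal (cmod (?u N t - \<psi> t)) \<partial>lebesgue) + ennreal ((\<Sum>n. r (Suc n)) / r 0)" .
    qed
  qed
qed

section \<open>The uniform limit of the transforms and its self-convolution\<close>

lemma fourier_L1_dist:
  assumes f: "integrable lebesgue f" and g: "integrable lebesgue g"
    and le: "(\<integral>\<^sup>+t. ennreal (cmod (f t - g t)) \<partial>lebesgue) \<le> ennreal e" and e: "e \<ge> 0"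
  shows "dist (fourier f w) (fourier g w) \<le> e"
proof -
  have [measurable]: "(\<lambda>t. - (t \<bullet> w)) \<in> borel_measurable lebesgue" by (rule measurable_completion) simp
  have fi: "integrable lebesgue (\<lambda>t. f t * ue (- (t \<bullet> w)))" and gi: "integrable lebesgue (\<lambda>t. g t * ue (- (t \<bullet> w)))"
    by (intro integrable_mult_ue f g; measurable)+
  have "ennreal (cmod (fourier f w - fourier g w)) = ennreal (norm (LINT t|lebesgue. f t * ue (- (t \<bullet> w)) - g t * ue (- (t \<bullet> w))))"
    unfolding fourier_ue by (subst Bochner_Integration.integral_diff[OF fi gi]) simp
  also have "\<dots> \<le> (\<integral>\<^sup>+t. ennreal (norm (f t * ue (- (t \<bullet> w)) - g t * ue (- (t \<bullet> w)))) \<partial>lebesgue)"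
    by (rule integral_norm_bound_ennreal) (intro Bochner_Integration.integrable_diff fi gi)
  also have "\<dots> = (\<integral>\<^sup>+t. ennreal (cmod (f t - g t)) \<partial>lebesgue)"
    by (simp add: norm_mult flip: left_diff_distrib)
  also note le
  finally show ?thesis using e by (simp add: dist_norm ennreal_le_iff)
qed

lemma box_density_dist:
  assumes c: "c > 0" and q: "0 < q" "q < 1"
  shows "(\<integral>\<^sup>+t. ennreal (cmod (box_density ((1 - q) * c) t - box_density c t)) \<partial>lborel) \<le> ennreal (2 * q)"
proof -
  define r where "r = (1 - q) * c"
  have r: "0 < r" "r < c" using assms by (auto simp: r_def algebra_simps)
  have "(\<integral>\<^sup>+t. ennreal (cmod (box_density r t - box_density c t)) \<partial>lborel)
      \<le> (\<integral>\<^sup>+t. ennreal (1 / (2 * r) - 1 / (2 * c)) * indicator {-r..r} t + ennreal (1 / (2 * c)) * indicator ({-c..c} - {-r..r}) t \<partial>lborel)"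
  proof (rule nn_integral_mono)
    fix t
    have "box_density r t - box_density c t = of_real ((1 / (2 * r) - 1 / (2 * c)) * indicator {-r..r} t - (1 / (2 * c)) * indicator ({-c..c} - {-r..r}) t)"
      using r by (auto simp: box_density_def indicator_def)
    then have eq: "cmod (box_density r t - box_density c t) = \<bar>(1 / (2 * r) - 1 / (2 * c)) * indicator {-r..r} t - (1 / (2 * c)) * indicator ({-c..c} - {-r..r}) t\<bar>"
      by (simp only: norm_of_real)
    have "1 / (2 * r) - 1 / (2 * c) \<ge> 0" using r by (simp add: frac_le)
    then show "ennreal (cmod (box_density r t - box_density c t)) \<le> ennreal (1 / (2 * r) - 1 / (2 * c)) * indicator {-r..r} t + ennreal (1 / (2 * c)) * indicator ({-c..c} - {-r..r}) t"
      unfolding eq using r by (auto simp: indicator_def)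
  qed
  also have "\<dots> = ennreal (1 / (2 * r) - 1 / (2 * c)) * emeasure lborel {-r..r} + ennreal (1 / (2 * c)) * emeasure lborel ({-c..c} - {-r..r})"
    by (subst nn_integral_add) (auto simp: nn_integral_cmult_indicator)
  also have "emeasure lborel ({-c..c} - {-r..r}) = ennreal (2 * c - 2 * r)"
    using r by (subst emeasure_Diff) (auto simp: ennreal_minus)
  also have "ennreal (1 / (2 * r) - 1 / (2 * c)) * emeasure lborel {-r..r} + ennreal (1 / (2 * c)) * ennreal (2 * c - 2 * r)
      = ennreal ((1 / (2 * r) - 1 / (2 * c)) * (2 * r) + 1 / (2 * c) * (2 * c - 2 * r))"
  proof -
    have nn: "0 \<le> 1 / (2 * r) - 1 / (2 * c)" "0 \<le> 2 * r" "0 \<le> 1 / (2 * c)" "0 \<le> 2 * c - 2 * r"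
      using r by (auto simp: frac_le)
    have e: "emeasure lborel {-r..r} = ennreal (2 * r)" using r by (subst emeasure_lborel_Icc) auto
    show ?thesis
      unfolding e ennreal_mult[OF nn(1,2), symmetric] ennreal_mult[OF nn(3,4), symmetric]
      by (intro ennreal_plus[symmetric] mult_nonneg_nonneg nn)
  qed
  \<comment> \<open>Both boxes have mass one: the excess of the narrow one on \<open>{-r..r}\<close>
    and the part of the wide one outside it each amount to \<open>1 - r / c\<close>.\<close>
  also have "(1 / (2 * r) - 1 / (2 * c)) * (2 * r) + 1 / (2 * c) * (2 * c - 2 * r) = 2 * (1 - r / c)"
    using r by (simp add: field_simps)
  also have "1 - r / c = q" using c by (simp add: r_def)
  finally show ?thesis unfolding r_def .
qed

lemma shrunk_window_box:
  assumes "0 < \<epsilon>" "\<epsilon> < 1" "c > 0" "n > 0"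
  shows "normalized_indicator ((\<lambda>x. \<epsilon> ^ (n * s) * x) ` shrunk_window \<epsilon> {-c..c} n) = box_density (\<epsilon> ^ (n * s) * ((1 - \<epsilon> ^ n) * c))"
proof -
  have p: "1 - \<epsilon> ^ n > 0" using assms by (simp add: power_less_one_iff)
  have "shrunk_window \<epsilon> {-c..c} n = {- ((1 - \<epsilon> ^ n) * c)..(1 - \<epsilon> ^ n) * c}"
    unfolding shrunk_window_def using p assms by (subst image_mult_atLeastAtMost) auto
  then have S: "(\<lambda>x. \<epsilon> ^ (n * s) * x) ` shrunk_window \<epsilon> {-c..c} n = {- (\<epsilon> ^ (n * s) * ((1 - \<epsilon> ^ n) * c))..\<epsilon> ^ (n * s) * ((1 - \<epsilon> ^ n) * c)}"
    using p assms by (simp add: image_mult_atLeastAtMost)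
  have "\<epsilon> ^ (n * s) * ((1 - \<epsilon> ^ n) * c) > 0" using p assms by simp
  then show ?thesis unfolding S by (intro ext) (simp add: normalized_indicator_def box_density_def)
qed

text \<open>Write \<open>q = \<epsilon> ^ n\<close>. The first factor has radius
  \<open>(1 - q) * c\<close> and the later radii are smaller by powers of \<open>q\<close>, so the
  product lies within \<open>q / (1 - q)\<close> of the first factor, which lies within
  \<open>2 * q\<close> of the normalized window. These \<open>L^1\<close> bounds control the
  transforms uniformly and vanish as \<open>n\<close> grows.\<close>

lemma Psi_fun_interval:
  assumes eps: "0 < \<epsilon>" "\<epsilon> < 1" and c: "c > 0"
  shows "Psi_fun \<epsilon> {-c..c} = fourier (box_density c)"
proof -
  have bc: "integrable lebesgue (box_density a)" if "a > 0" for a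
    using niceD(1)[OF nice_box_density[OF that]] by (simp add: integrable_completion)
  have bm: "box_density a \<in> borel_measurable lebesgue" for a by (rule measurable_completion) simp
  have d: "dist (fourier (psi_fun \<epsilon> {-c..c} n) w) (fourier (box_density c) w) \<le> \<epsilon> ^ n / (1 - \<epsilon> ^ n) + 2 * \<epsilon> ^ n" if n: "n > 0" for n w
  proof -
    define q where "q = \<epsilon> ^ n"
    have q: "0 < q" "q < 1" using eps n by (auto simp: q_def power_less_one_iff)
    define r where "r s = q ^ s * ((1 - q) * c)" for s
    have r: "r s > 0" for s using q c by (simp add: r_def)
    have sr: "summable r" unfolding r_def using q by (intro summable_mult2 summable_geometric) auto
    have psi: "psi_fun \<epsilon> {-c..c} n = infinite_convolution (\<lambda>s. box_density (r s))"
      unfolding psi_fun_def using shrunk_window_box[OF eps c n] by (simp add: r_def q_def power_mult)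
    have rsum: "(\<Sum>n. r (Suc n)) / r 0 = q / (1 - q)"
    proof -
      have "(\<lambda>s. q ^ s) sums (1 / (1 - q))" using q by (intro geometric_sums) auto
      then have "(\<lambda>s. q ^ s * (q * ((1 - q) * c))) sums (1 / (1 - q) * (q * ((1 - q) * c)))" by (rule sums_mult2)
      then have "(\<Sum>n. r (Suc n)) = 1 / (1 - q) * (q * ((1 - q) * c))"
        by (intro sums_unique[symmetric]) (simp add: r_def mult_ac)
      then show ?thesis using q c by (simp add: r_def)
    qed
    note ic = infinite_convolution_box[OF r sr, folded psi]
    have r0: "r 0 = (1 - q) * c" by (simp add: r_def)
    note [measurable] = borel_measurable_integrable[OF ic(1)] bm
    have "(\<integral>\<^sup>+t. ennreal (cmod (psi_fun \<epsilon> {-c..c} n t - box_density c t)) \<partial>lebesgue)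
        \<le> (\<integral>\<^sup>+t. ennreal (cmod (psi_fun \<epsilon> {-c..c} n t - box_density (r 0) t)) + ennreal (cmod (box_density (r 0) t - box_density c t)) \<partial>lebesgue)"
    proof (rule nn_integral_mono)
      fix t
      show "ennreal (cmod (psi_fun \<epsilon> {-c..c} n t - box_density c t)) \<le> ennreal (cmod (psi_fun \<epsilon> {-c..c} n t - box_density (r 0) t)) + ennreal (cmod (box_density (r 0) t - box_density c t))"
        using norm_triangle_ineq[of "psi_fun \<epsilon> {-c..c} n t - box_density (r 0) t" "box_density (r 0) t - box_density c t"]
        by (simp flip: ennreal_plus add: ennreal_leI)
    qed
    also have "\<dots> = (\<integral>\<^sup>+t. ennreal (cmod (psi_fun \<epsilon> {-c..c} n t - box_density (r 0) t)) \<partial>lebesgue) + (\<integral>\<^sup>+t. ennreal (cmod (box_density (r 0) t - box_density c t)) \<partial>lebesgue)"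
      by (rule nn_integral_add) measurable
    also have "\<dots> \<le> ennreal (q / (1 - q)) + ennreal (2 * q)"
      using ic(2)[unfolded rsum] box_density_dist[OF c q] unfolding r0 nn_integral_completion by (intro add_mono)
    also have "\<dots> = ennreal (q / (1 - q) + 2 * q)" using q by (intro ennreal_plus[symmetric]) auto
    finally show ?thesis unfolding q_def[symmetric]
      by (intro fourier_L1_dist ic(1) bc c) (use q in auto)
  qed
  have "(\<lambda>n. \<epsilon> ^ n) \<longlonglongrightarrow> 0" using eps by (intro LIMSEQ_power_zero) auto
  then have "(\<lambda>n. \<epsilon> ^ n / (1 - \<epsilon> ^ n) + 2 * \<epsilon> ^ n) \<longlonglongrightarrow> 0 / (1 - 0) + 2 * 0"
    by (intro tendsto_add tendsto_divide tendsto_diff tendsto_mult tendsto_const) simp_all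
  then have lim: "(\<lambda>n. \<epsilon> ^ n / (1 - \<epsilon> ^ n) + 2 * \<epsilon> ^ n) \<longlonglongrightarrow> 0" by simp
  have ul: "uniform_limit UNIV (\<lambda>n. fourier (psi_fun \<epsilon> {-c..c} n)) (fourier (box_density c)) sequentially"
  proof (rule uniform_limitI)
    fix e :: real assume "e > 0"
    then have "eventually (\<lambda>n. \<epsilon> ^ n / (1 - \<epsilon> ^ n) + 2 * \<epsilon> ^ n < e) sequentially"
      by (rule order_tendstoD(2)[OF lim])
    then show "eventually (\<lambda>n. \<forall>x\<in>UNIV. dist (fourier (psi_fun \<epsilon> {-c..c} n) x) (fourier (box_density c) x) < e) sequentially"
      using eventually_gt_at_top[of 0] by eventually_elim (use d in \<open>meson le_less_trans\<close>)
  qed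
  show ?thesis unfolding Psi_fun_def
  proof (rule the_equality[where P="\<lambda>\<Psi>. uniform_limit UNIV (\<lambda>n. fourier (psi_fun \<epsilon> {-c..c} n)) \<Psi> sequentially", OF ul])
    fix \<Psi> assume "uniform_limit UNIV (\<lambda>n. fourier (psi_fun \<epsilon> {-c..c} n)) \<Psi> sequentially"
    from tendsto_uniform_limitI[OF this UNIV_I] tendsto_uniform_limitI[OF ul UNIV_I]
    show "\<Psi> = fourier (box_density c)" by (intro ext) (rule LIMSEQ_unique)
  qed
qed

lemma nice_mult_ue:
  assumes "nice V"
  shows "nice (\<lambda>x. V x * ue (x \<bullet> \<xi>))"
  unfolding nice_def
proof (intro conjI)
  show "integrable lborel (\<lambda>x. V x * ue (x \<bullet> \<xi>))"
    by (intro integrable_mult_ue niceD(1)[OF assms]) measurable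
  show "bounded (range (\<lambda>x. V x * ue (x \<bullet> \<xi>)))"
    using niceD(4)[OF assms] by (auto simp: bounded_iff norm_mult)
  show "AE x in lborel. isCont (\<lambda>x. V x * ue (x \<bullet> \<xi>)) x"
    using niceD(3)[OF assms] by eventually_elim (intro continuous_mult continuous_ue continuous_inner continuous_const continuous_ident)
qed

lemma fourier_mult_ue:
  assumes "integrable lborel V"
  shows "fourier (\<lambda>x. V x * ue (x \<bullet> \<xi>)) t = fourier V (t - \<xi>)"
proof -
  have [measurable]: "V \<in> borel_measurable borel" using assms by auto
  have eq: "V x * ue (x \<bullet> \<xi>) * ue (- (x \<bullet> t)) = V x * ue (- (x \<bullet> (t - \<xi>)))" for x
    by (simp add: mult.assoc inner_diff_right flip: ue_add)
  have "fourier (\<lambda>x. V x * ue (x \<bullet> \<xi>)) t = (LINT x|lborel. V x * ue (x \<bullet> \<xi>) * ue (- (x \<bullet> t)))"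
    by (rule fourier_lborel) measurable
  also have "\<dots> = fourier V (t - \<xi>)"
    unfolding eq by (rule fourier_lborel[symmetric]) measurable
  finally show ?thesis .
qed

text \<open>Reflecting the transform of a real function conjugates it, so the convolution at
  \<open>t\<close> is an inner product of transforms. By Parseval it is the transform of the squared
  box density, which is the box density divided by \<open>2 * c\<close>; the factor
  \<open>measure lebesgue \<Omega>\<close> cancels this.\<close>

lemma Phi_fun_interval:
  assumes eps: "0 < \<epsilon>" "\<epsilon> < 1" and c: "c > 0"
  shows "Phi_fun \<epsilon> {-c..c} t = fourier (box_density c) t"
proof -
  let ?V = "box_density c"
  note nV = nice_box_density[OF c]
  have Vi: "integrable lborel ?V" using nV by (rule niceD)
  have [measurable]: "fourier ?V \<in> borel_measurable borel" by (rule fourier_measurable[OF Vi])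
  have cf: "cnj (fourier ?V s) = fourier ?V (- s)" for s
    by (subst fourier_cnj[OF Vi], subst fourier_lborel) (auto simp: box_density_def)
  have "convolve (fourier ?V) (fourier ?V) t = (LINT s|lborel. fourier ?V s * fourier ?V (t - s))"
    unfolding convolve_def by (rule integral_completion) measurable
  also have "\<dots> = (LINT s|lborel. fourier ?V s * cnj (fourier (\<lambda>x. ?V x * ue (x \<bullet> t)) s))"
    unfolding fourier_mult_ue[OF Vi] cf by simp
  also have "\<dots> = (LINT x|lborel. ?V x * cnj (?V x * ue (x \<bullet> t)))"
    by (rule parseval(2)[OF nV nice_mult_ue[OF nV]])
  also have "\<dots> = (LINT x|lborel. (1 / (2 * of_real c)) * (?V x * ue (- (x \<bullet> t))))"
    by (rule Bochner_Integration.integral_cong) (auto simp: box_density_def indicator_def ue_minus)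
  also have "\<dots> = (1 / (2 * of_real c)) * fourier ?V t"
    by (subst integral_mult_right_zero) (simp add: fourier_lborel)
  finally show ?thesis using c by (simp add: Phi_fun_def Psi_fun_interval[OF eps c])
qed

section \<open>Weighted frame sums\<close>

lemma tendsto_indicator_Icc:
  fixes a b :: real
  assumes "X \<longlonglongrightarrow> y" "y \<noteq> a" "y \<noteq> b"
  shows "eventually (\<lambda>n. indicator {a..b} (X n) = (indicator {a..b} y :: ennreal)) sequentially"
proof -
  consider "y < a" | "a < y" "y < b" | "b < y" | "a < y" "b < y" using assms by linarith
  then show ?thesis
  proof cases
    case 1
    then have "eventually (\<lambda>n. X n < a) sequentially" using assms(1) by (intro order_tendstoD)
    then show ?thesis by eventually_elim (use 1 in auto)
  next
    case 2
    then have "eventually (\<lambda>n. X n < b) sequentially" "eventually (\<lambda>n. a < X n) sequentially"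
      using order_tendstoD[OF assms(1)] by auto
    then show ?thesis by eventually_elim (use 2 in auto)
  qed (use order_tendstoD(1)[OF assms(1), of b] in \<open>auto elim!: eventually_mono\<close>)
qed

lemma translate_nice: "nice f \<Longrightarrow> nice (\<lambda>t. f (t + a))"
proof -
  assume f: "nice f"
  show ?thesis unfolding nice_def
  proof (intro conjI)
    show "integrable lborel (\<lambda>t. f (t + a))" using integrable_lborel_shift[OF niceD(1)[OF f], of a] by (simp add: add.commute)
    show "bounded (range (\<lambda>t. f (t + a)))" using niceD(4)[OF f] by (auto simp: bounded_iff)
    have "AE x in lborel. isCont f (a + x)" using AE_lborel_shift[OF niceD(3)[OF f]] .
    then show "AE x in lborel. isCont (\<lambda>t. f (t + a)) x"
      by eventually_elim (rule isCont_o2[where g=f and f="\<lambda>t. t + a"], auto simp: add.commute intro!: continuous_intros)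
  qed
qed

definition test_fun :: "('a::euclidean_space \<Rightarrow> complex) \<Rightarrow> bool" where
  "test_fun f \<longleftrightarrow> nice f \<and> continuous_on UNIV f"

lemma test_funI: "integrable lborel f \<Longrightarrow> bounded (range f) \<Longrightarrow> continuous_on UNIV f \<Longrightarrow> test_fun f"
  by (auto simp: test_fun_def nice_def continuous_on_eq_continuous_at)

lemma test_fun_translate: "test_fun f \<Longrightarrow> test_fun (\<lambda>t. f (t + a))"
  unfolding test_fun_def by (auto intro!: translate_nice continuous_on_compose2[of UNIV f] continuous_intros)

lemma test_fun_add: "test_fun f \<Longrightarrow> test_fun h \<Longrightarrow> test_fun (\<lambda>t. f t + a * h t)"
proof -
  assume f: "test_fun f" and h: "test_fun h"
  obtain M N where "\<And>x. cmod (f x) \<le> M" "\<And>x. cmod (h x) \<le> N"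
    using f h niceD(4) unfolding test_fun_def by metis
  then have "cmod (f t + a * h t) \<le> M + cmod a * N" for t
    by (intro order_trans[OF norm_triangle_ineq] add_mono) (auto simp: norm_mult mult_left_mono)
  then have "bounded (range (\<lambda>t. f t + a * h t))" unfolding bounded_iff by blast
  then show ?thesis
    using f h by (intro test_funI) (auto simp: test_fun_def nice_def intro!: continuous_intros)
qed

lemma test_fun_diff: "test_fun f \<Longrightarrow> test_fun h \<Longrightarrow> test_fun (\<lambda>t. f t - h t)"
  using test_fun_add[of f h "- 1"] by simp

definition sq_norm :: "('a::euclidean_space \<Rightarrow> complex) \<Rightarrow> real" where
  "sq_norm f = (LINT x|lborel. (cmod (f x))\<^sup>2)"

lemma sq_norm_nonneg [simp]: "sq_norm f \<ge> 0"
  by (simp add: sq_norm_def)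

lemma complex_mult_cnj_cmod_Re: "Re (z * cnj z) = (cmod z)\<^sup>2"
  by (simp only: cmod_power2) (simp add: power2_eq_square)

lemma test_fun_square_integrable: "test_fun f \<Longrightarrow> integrable lborel (\<lambda>x. (cmod (f x))\<^sup>2)"
proof -
  assume "test_fun f"
  then have "integrable lborel (\<lambda>x. Re (f x * cnj (f x)))"
    by (intro integrable_Re nice_square_integrable) (auto simp: test_fun_def)
  then show ?thesis by (simp only: complex_mult_cnj_cmod_Re)
qed

lemma sq_norm_translate:
  assumes [measurable]: "f \<in> borel_measurable borel"
  shows "sq_norm (\<lambda>t. f (t + a)) = sq_norm f"
  unfolding sq_norm_def using integral_lborel_shift[of "\<lambda>x. (cmod (f x))\<^sup>2" a] by (simp add: add.commute)

text \<open>Expanding the square gives \<open>2 * sq_norm f - 2 * Re (corr f f x)\<close>, so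
  continuity of translation in \<open>L^2\<close> is continuity of the autocorrelation at 0.\<close>

lemma tendsto_sq_norm_translate:
  assumes f: "test_fun f" and X: "X \<longlonglongrightarrow> 0"
  shows "(\<lambda>n. sq_norm (\<lambda>t. f (t + X n) - f t)) \<longlonglongrightarrow> 0"
proof -
  have nf: "nice f" using f by (simp add: test_fun_def)
  note [measurable] = niceD(2)[OF nf]
  have eq: "sq_norm (\<lambda>t. f (t + x) - f t) = 2 * sq_norm f - 2 * Re (corr f f x)" for x
  proof -
    have i1: "integrable lborel (\<lambda>t. (cmod (f (t + x)))\<^sup>2)" "integrable lborel (\<lambda>t. (cmod (f t))\<^sup>2)"
      using test_fun_square_integrable[OF test_fun_translate[OF f]] test_fun_square_integrable[OF f] by auto
    have i2: "integrable lborel (\<lambda>t. f (t + x) * cnj (f t))"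
      by (rule nice_square_integrable[OF translate_nice[OF nf] nf])
    have "(cmod (f (t + x) - f t))\<^sup>2 = (cmod (f (t + x)))\<^sup>2 + (cmod (f t))\<^sup>2 - 2 * Re (f (t + x) * cnj (f t))" for t
      by (simp only: cmod_power2) (simp add: power2_eq_square algebra_simps)
    then have "sq_norm (\<lambda>t. f (t + x) - f t) = (LINT t|lborel. (cmod (f (t + x)))\<^sup>2 + (cmod (f t))\<^sup>2 - 2 * Re (f (t + x) * cnj (f t)))"
      by (simp add: sq_norm_def)
    also have "\<dots> = sq_norm (\<lambda>t. f (t + x)) + sq_norm f - 2 * Re (corr f f x)"
    proof -
      define r where "r t = Re (f (t + x) * cnj (f t))" for t
      have "integrable lborel r" unfolding r_def by (rule integrable_Re[OF i2])
      moreover have "Re (corr f f x) = (LINT t|lborel. r t)"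
        unfolding corr_def r_def by (rule integral_Re[OF i2, symmetric])
      ultimately show ?thesis using i1 unfolding sq_norm_def r_def[symmetric] by simp
    qed
    finally show ?thesis by (simp add: sq_norm_translate)
  qed
  have "isCont (corr f f) 0" by (rule corr_nice(3)[OF nf nf])
  then have "(\<lambda>n. 2 * sq_norm f - 2 * Re (corr f f (X n))) \<longlonglongrightarrow> 2 * sq_norm f - 2 * Re (corr f f 0)"
    by (intro tendsto_intros isCont_tendsto_compose[OF _ X])
  moreover have "Re (corr f f 0) = sq_norm f"
    unfolding corr_nice(4)[OF nf nf] sq_norm_def
    by (subst integral_Re[symmetric, OF nice_square_integrable[OF nf nf]]) (simp only: complex_mult_cnj_cmod_Re)
  ultimately show ?thesis unfolding eq by simp
qed

text \<open>Young's inequality with a weight: the main term costs only the factor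
  \<open>1 + d\<close>, while the large factor falls on the perturbation. It replaces the triangle
  inequality in \<open>L^2\<close> and over the frame indices, so no square roots of possibly
  infinite sums occur.\<close>

lemma cmod_add_square_le:
  assumes "d > 0"
  shows "(cmod (a + b))\<^sup>2 \<le> (1 + d) * (cmod a)\<^sup>2 + (1 + 1 / d) * (cmod b)\<^sup>2"
proof -
  have "(cmod (a + b))\<^sup>2 \<le> (cmod a + cmod b)\<^sup>2" by (intro power_mono norm_triangle_ineq) simp
  also have "\<dots> = (cmod a)\<^sup>2 + (cmod b)\<^sup>2 + 2 * (cmod a * cmod b)" by (simp add: power2_sum)
  also have "2 * (cmod a * cmod b) \<le> d * (cmod a)\<^sup>2 + (1 / d) * (cmod b)\<^sup>2"
  proof -
    have "0 \<le> (d * cmod a - cmod b)\<^sup>2 / d" using assms by simp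
    also have "\<dots> = d * (cmod a)\<^sup>2 + (1 / d) * (cmod b)\<^sup>2 - 2 * (cmod a * cmod b)"
      using assms by (simp add: power2_diff field_simps power2_eq_square)
    finally show ?thesis by simp
  qed
  finally show ?thesis by (simp add: algebra_simps)
qed

lemma le_of_perturbed:
  fixes a b :: ennreal
  assumes "\<And>d::real. d > 0 \<Longrightarrow> a \<le> ennreal (1 + d) * b"
  shows "a \<le> b"
proof (rule LIMSEQ_le_const)
  have "(\<lambda>n. ennreal (1 + inverse (real (Suc n)))) \<longlonglongrightarrow> ennreal (1 + 0)"
    by (intro tendsto_intros LIMSEQ_inverse_real_of_nat)
  then have l: "(\<lambda>n. ennreal (1 + inverse (real (Suc n)))) \<longlonglongrightarrow> 1" by simp
  show "(\<lambda>n. ennreal (1 + inverse (real (Suc n))) * b) \<longlonglongrightarrow> b"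
    using tendsto_mult_ennreal[OF l tendsto_const[of b]] by simp
  show "\<exists>N. \<forall>n\<ge>N. a \<le> ennreal (1 + inverse (real (Suc n))) * b"
    using assms by auto
qed

locale frame_setup = cut_and_project B for B :: "('a::euclidean_space \<times> real) set" +
  fixes c :: real and K :: "'k set" and g :: "'k \<Rightarrow> 'a \<Rightarrow> complex"
  assumes c_pos: "c > 0" and generic: "\<And>\<gamma>. \<gamma> \<in> lat \<Longrightarrow> snd \<gamma> \<noteq> c"
    and countable_K: "countable K"
    and g_int: "\<And>k. k \<in> K \<Longrightarrow> integrable lborel (g k)"
    and g_sq: "\<And>k. k \<in> K \<Longrightarrow> integrable lborel (\<lambda>x. (cmod (g k x))\<^sup>2)"
begin

definition wterm :: "real set \<Rightarrow> ('a \<Rightarrow> complex) \<Rightarrow> 'a \<Rightarrow> real \<Rightarrow> 'k \<times> ('a \<times> real) \<Rightarrow> ennreal" where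
  "wterm S f x y p = ennreal ((cmod (corr f (g (fst p)) (x + fst (snd p))))\<^sup>2) * indicator S (y + snd (snd p))"

text \<open>With \<open>S = {-c..c}\<close> this is the \<open>G f\<close> of the overview; other
  windows occur as majorants. One integral over the product index set lets each limit theorem be
  applied once.\<close>

definition wsum :: "real set \<Rightarrow> ('a \<Rightarrow> complex) \<Rightarrow> 'a \<Rightarrow> real \<Rightarrow> ennreal" where
  "wsum S f x y = (\<integral>\<^sup>+p. wterm S f x y p \<partial>count_space (K \<times> lat))"

definition good :: "real \<Rightarrow> bool" where
  "good y \<longleftrightarrow> (\<forall>\<gamma>\<in>lat. y + snd \<gamma> \<noteq> c \<and> y + snd \<gamma> \<noteq> - c)"

text \<open>Genericity excludes \<open>c\<close>; the lattice is closed under negation, which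
  excludes \<open>- c\<close> as well.\<close>

lemma good_0: "good 0"
  unfolding good_def using generic generic[OF lat_uminus] by fastforce

lemma AE_good: "AE y in lborel. good y"
proof -
  have "AE y in lborel. \<forall>\<gamma>\<in>lat. y \<noteq> c - snd \<gamma> \<and> y \<noteq> - c - snd \<gamma>"
    using countable_lat by (subst AE_ball_countable) (auto intro: AE_lborel_singleton)
  then show ?thesis unfolding good_def by eventually_elim (auto simp: algebra_simps)
qed

lemma wsum_lattice_shift:
  assumes "\<gamma>0 \<in> lat"
  shows "wsum S f (x + fst \<gamma>0) (y + snd \<gamma>0) = wsum S f x y"
proof -
  have bij: "bij_betw (\<lambda>p. (fst p, \<gamma>0 + snd p)) (K \<times> lat) (K \<times> lat)"
    by (rule bij_betw_byWitness[of _ "\<lambda>p. (fst p, snd p - \<gamma>0)"])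
      (use lat_add[OF assms] lat_diff[OF _ assms] in \<open>auto simp: mem_Times_iff simp del: mem_Sigma_iff\<close>)
  show ?thesis
    unfolding wsum_def
    by (subst (2) nn_integral_bij_count_space[OF bij, symmetric])
      (auto intro!: nn_integral_cong simp: wterm_def add.assoc)
qed

lemma corr_translate: "corr (\<lambda>t. f (t + a)) h x = corr f h (x + a)"
  by (simp add: corr_def add.assoc)

lemma wsum_translate: "wsum S (\<lambda>t. f (t + a)) x y = wsum S f (x + a) y"
  unfolding wsum_def wterm_def corr_translate by (simp add: add_ac)

text \<open>Additivity is required of the correlations rather than derived from
  \<open>f = u + h\<close>, because it has different integrability reasons for test functions and
  for square-integrable ones.\<close>

lemma wsum_perturb:
  assumes "\<And>k z. k \<in> K \<Longrightarrow> corr f (g k) z = corr u (g k) z + corr h (g k) z" and d: "d > 0"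
  shows "wsum S f x y \<le> ennreal (1 + d) * wsum S u x y + ennreal (1 + 1 / d) * wsum S h x y"
proof -
  have "wsum S f x y \<le> (\<integral>\<^sup>+p. ennreal (1 + d) * wterm S u x y p + ennreal (1 + 1 / d) * wterm S h x y p \<partial>count_space (K \<times> lat))"
    unfolding wsum_def
  proof (rule nn_integral_mono)
    fix p assume "p \<in> space (count_space (K \<times> lat))"
    then have k: "fst p \<in> K" by (simp add: mem_Times_iff)
    have "ennreal ((cmod (corr f (g (fst p)) z))\<^sup>2) \<le> ennreal (1 + d) * ennreal ((cmod (corr u (g (fst p)) z))\<^sup>2) + ennreal (1 + 1 / d) * ennreal ((cmod (corr h (g (fst p)) z))\<^sup>2)" for z
      using cmod_add_square_le[OF d, of "corr u (g (fst p)) z" "corr h (g (fst p)) z"] d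
      by (simp add: assms(1)[OF k] ennreal_leI flip: ennreal_mult ennreal_plus)
    then show "wterm S f x y p \<le> ennreal (1 + d) * wterm S u x y p + ennreal (1 + 1 / d) * wterm S h x y p"
      by (auto simp: wterm_def indicator_def)
  qed
  also have "\<dots> = ennreal (1 + d) * wsum S u x y + ennreal (1 + 1 / d) * wsum S h x y"
    unfolding wsum_def by (subst nn_integral_add) (auto simp: nn_integral_cmult)
  finally show ?thesis .
qed

text \<open>Finitely many lattice translates of \<open>{-c..c}\<close> cover \<open>S\<close>. The
  number \<open>n\<close> depends on \<open>S\<close> alone, so the bound is uniform in
  \<open>f\<close>.\<close>

lemma wsum_compact:
  assumes "compact S"
  obtains n :: nat where "\<And>f C x. (\<And>x. wsum {-c..c} f x 0 \<le> C) \<Longrightarrow> wsum S f x 0 \<le> of_nat n * C"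
proof -
  obtain D where D: "finite D" "D \<subseteq> lat" "\<And>y. y \<in> S \<Longrightarrow> \<exists>\<gamma>\<in>D. \<bar>snd \<gamma> - y\<bar> < c"
    using compact_cover[OF c_pos assms] by blast
  have "wsum S f x 0 \<le> of_nat (card D) * C" if C: "\<And>x. wsum {-c..c} f x 0 \<le> C" for f C x
  proof -
    have "wsum S f x 0 \<le> (\<integral>\<^sup>+p. (\<Sum>\<gamma>0\<in>D. wterm {-c..c} f x (- snd \<gamma>0) p) \<partial>count_space (K \<times> lat))"
      unfolding wsum_def
    proof (rule nn_integral_mono)
      fix p :: "'k \<times> 'a \<times> real"
      define \<gamma> where "\<gamma> = snd p"
      have "indicator S (snd \<gamma>) \<le> (\<Sum>\<gamma>0\<in>D. indicator {-c..c} (- snd \<gamma>0 + snd \<gamma>) :: ennreal)"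
      proof (cases "snd \<gamma> \<in> S")
        case True
        then obtain \<gamma>0 where g0: "\<gamma>0 \<in> D" "\<bar>snd \<gamma>0 - snd \<gamma>\<bar> < c" using D(3) by blast
        then have "1 \<le> (indicator {-c..c} (- snd \<gamma>0 + snd \<gamma>) :: ennreal)" by (auto simp: indicator_def)
        also have "\<dots> \<le> (\<Sum>\<gamma>0\<in>D. indicator {-c..c} (- snd \<gamma>0 + snd \<gamma>))"
          by (rule member_le_sum) (use g0 D in auto)
        finally show ?thesis using True by simp
      qed simp
      then show "wterm S f x 0 p \<le> (\<Sum>\<gamma>0\<in>D. wterm {-c..c} f x (- snd \<gamma>0) p)"
        unfolding wterm_def sum_distrib_left[symmetric] \<gamma>_def by (simp add: mult_left_mono)
    qed
    also have "\<dots> = (\<Sum>\<gamma>0\<in>D. wsum {-c..c} f x (- snd \<gamma>0))"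
      unfolding wsum_def by (rule nn_integral_sum) simp
    \<comment> \<open>Periodicity trades a lattice shift of the window for a shift of the base
      point, which is why the hypothesis is uniform in \<open>x\<close>.\<close>
    also have "\<dots> = (\<Sum>\<gamma>0\<in>D. wsum {-c..c} f (x + fst \<gamma>0) 0)"
    proof (rule sum.cong)
      fix \<gamma>0 assume "\<gamma>0 \<in> D"
      then show "wsum {-c..c} f x (- snd \<gamma>0) = wsum {-c..c} f (x + fst \<gamma>0) 0"
        using wsum_lattice_shift[of \<gamma>0 "{-c..c}" f x "- snd \<gamma>0"] D by auto
    qed simp
    also have "\<dots> \<le> (\<Sum>\<gamma>0\<in>D. C)" by (intro sum_mono C)
    finally show ?thesis by simp
  qed
  then show ?thesis using that by blast
qed

lemma tendsto_wsum:
  assumes C: "\<And>x. wsum {-c..c} f x 0 \<le> ennreal C" and Y: "Y \<longlonglongrightarrow> y" and y: "good y"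
  shows "(\<lambda>n. wsum {-c..c} f x (Y n)) \<longlonglongrightarrow> wsum {-c..c} f x y"
proof -
  obtain M where M: "\<And>n. \<bar>Y n\<bar> \<le> M"
    using Y by (metis Bseq_def convergentI convergent_imp_Bseq real_norm_def)
  \<comment> \<open>All windows shifted by some \<open>Y n\<close> lie in this one, whose finite sum
    is the majorant.\<close>
  let ?S = "{-(c + M)..c + M}"
  obtain n :: nat where n: "\<And>f C x. (\<And>x. wsum {-c..c} f x 0 \<le> C) \<Longrightarrow> wsum ?S f x 0 \<le> of_nat n * C"
    using wsum_compact[OF compact_Icc] by blast
  have fin: "wsum ?S f x 0 < \<infinity>"
    using n[OF C, of x] by (rule le_less_trans) (simp add: ennreal_mult_less_top of_nat_less_top)
  show ?thesis
    unfolding wsum_def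
  proof (rule nn_integral_dominated_convergence)
    show "(\<integral>\<^sup>+p. wterm ?S f x 0 p \<partial>count_space (K \<times> lat)) < \<infinity>"
      using fin by (simp only: wsum_def)
    show "AE p in count_space (K \<times> lat). wterm {-c..c} f x (Y n) p \<le> wterm ?S f x 0 p" for n
      using M[of n] by (intro AE_I2) (auto intro!: mult_left_mono simp: wterm_def indicator_def abs_le_iff)
    show "AE p in count_space (K \<times> lat). (\<lambda>n. wterm {-c..c} f x (Y n) p) \<longlonglongrightarrow> wterm {-c..c} f x y p"
    proof (rule AE_I2)
      fix p assume "p \<in> space (count_space (K \<times> lat))"
      then have p: "snd p \<in> lat" by (simp add: mem_Times_iff)
      have "(\<lambda>n. Y n + snd (snd p)) \<longlonglongrightarrow> y + snd (snd p)" by (intro tendsto_intros Y)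
      then have "eventually (\<lambda>n. indicator {-c..c} (Y n + snd (snd p)) = (indicator {-c..c} (y + snd (snd p)) :: ennreal)) sequentially"
        using y p by (intro tendsto_indicator_Icc) (auto simp: good_def)
      then show "(\<lambda>n. wterm {-c..c} f x (Y n) p) \<longlonglongrightarrow> wterm {-c..c} f x y p"
        unfolding wterm_def by (intro tendsto_eventually) (auto elim: eventually_mono)
    qed
  qed simp_all
qed

text \<open>Fatou's lemma over the frame indices. Function, base point and bound all vary, so that
  one statement serves both the limit of points approaching the origin and the limit of test
  functions approaching an \<open>L^2\<close> function.\<close>

lemma wsum_le_of_limit:
  assumes lim: "\<And>k z. k \<in> K \<Longrightarrow> (\<lambda>n. corr (f n) (g k) (X n + z)) \<longlonglongrightarrow> corr h (g k) z"
    and Y: "Y \<longlonglongrightarrow> 0" and le: "\<And>n. wsum {-c..c} (f n) (X n) (Y n) \<le> b n" and b: "b \<longlonglongrightarrow> C"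
  shows "wsum {-c..c} h 0 0 \<le> C"
proof -
  have "wsum {-c..c} h 0 0 = (\<integral>\<^sup>+p. liminf (\<lambda>n. wterm {-c..c} (f n) (X n) (Y n) p) \<partial>count_space (K \<times> lat))"
    unfolding wsum_def
  proof (rule nn_integral_cong)
    fix p assume "p \<in> space (count_space (K \<times> lat))"
    then have p: "fst p \<in> K" "snd p \<in> lat" by (simp_all add: mem_Times_iff)
    define k \<gamma> where "k = fst p" and "\<gamma> = snd p"
    have "(\<lambda>n. Y n + snd \<gamma>) \<longlonglongrightarrow> 0 + snd \<gamma>" by (intro tendsto_intros Y)
    then have ev: "eventually (\<lambda>n. indicator {-c..c} (Y n + snd \<gamma>) = (indicator {-c..c} (0 + snd \<gamma>) :: ennreal)) sequentially"
      using good_0 p by (intro tendsto_indicator_Icc) (auto simp: good_def \<gamma>_def)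
    have "(\<lambda>n. ennreal ((cmod (corr (f n) (g k) (X n + fst \<gamma>)))\<^sup>2)) \<longlonglongrightarrow> ennreal ((cmod (corr h (g k) (fst \<gamma>)))\<^sup>2)"
      using p by (intro tendsto_ennrealI tendsto_power tendsto_norm lim) (simp add: k_def)
    then have "(\<lambda>n. ennreal ((cmod (corr (f n) (g k) (X n + fst \<gamma>)))\<^sup>2) * indicator {-c..c} (0 + snd \<gamma>)) \<longlonglongrightarrow> ennreal ((cmod (corr h (g k) (fst \<gamma>)))\<^sup>2) * indicator {-c..c} (0 + snd \<gamma>)"
      by (cases "0 + snd \<gamma> \<in> {-c..c}") simp_all
    moreover have "eventually (\<lambda>n. ennreal ((cmod (corr (f n) (g k) (X n + fst \<gamma>)))\<^sup>2) * indicator {-c..c} (0 + snd \<gamma>) = wterm {-c..c} (f n) (X n) (Y n) p) sequentially"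
      using ev by eventually_elim (simp add: wterm_def k_def \<gamma>_def)
    ultimately have "(\<lambda>n. wterm {-c..c} (f n) (X n) (Y n) p) \<longlonglongrightarrow> wterm {-c..c} h 0 0 p"
      by (auto simp: wterm_def k_def \<gamma>_def intro: Lim_transform_eventually)
    from lim_imp_Liminf[OF _ this]
    show "wterm {-c..c} h 0 0 p = liminf (\<lambda>n. wterm {-c..c} (f n) (X n) (Y n) p)" by simp
  qed
  also have "\<dots> \<le> liminf (\<lambda>n. \<integral>\<^sup>+p. wterm {-c..c} (f n) (X n) (Y n) p \<partial>count_space (K \<times> lat))"
    by (rule nn_integral_liminf) simp
  also have "\<dots> \<le> liminf b"
    using le by (intro Liminf_mono always_eventually) (simp add: wsum_def)
  also have "\<dots> = C" using lim_imp_Liminf[OF _ b] by simp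
  finally show ?thesis .
qed

end

section \<open>Fourier coefficients of the frame sums\<close>

context based_lattice
begin

lemma AE_torus_of_lborel: "AE z in lborel. P z \<Longrightarrow> AE z in torus. P z"
  unfolding torus_def by (subst AE_density) auto

lemma AE_lborel_of_torus:
  assumes ae: "AE z in torus. P z" and per: "\<And>z \<gamma>. \<gamma> \<in> lat \<Longrightarrow> P (z + \<gamma>) \<Longrightarrow> P z"
  shows "AE z in lborel. P z"
proof -
  have "AE z in lborel. z \<in> fdom \<longrightarrow> P z"
    using ae unfolding torus_def by (subst (asm) AE_density) (auto simp: indicator_def)
  then have "AE z in lborel. \<gamma> + z \<in> fdom \<longrightarrow> P (\<gamma> + z)" for \<gamma> by (rule AE_lborel_shift)
  then have "AE z in lborel. \<forall>\<gamma>\<in>lat. \<gamma> + z \<in> fdom \<longrightarrow> P (\<gamma> + z)"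
    by (subst AE_ball_countable[OF countable_lat]) blast
  then show ?thesis
  proof eventually_elim
    case (elim z)
    have "- lfloor z \<in> lat" "z + - lfloor z \<in> fdom"
      using lat_uminus[OF lfloor_lat] fdom_lfloor[OF lfloor_lat, of z z] by auto
    then show ?case using elim per by (metis add.commute)
  qed
qed

end

section \<open>Null sets and integrals on product spaces\<close>

lemma AE_lborel_fst:
  assumes "AE x in (lborel :: 'a::euclidean_space measure). P x"
  shows "AE z in (lborel :: ('a \<times> 'b::euclidean_space) measure). P (fst z)"
proof -
  obtain N where N: "N \<in> null_sets lborel" "{x. \<not> P x} \<subseteq> N"
    using assms by (auto elim!: AE_E simp: null_sets_def)
  have "N \<times> (UNIV :: 'b set) \<in> null_sets (lborel \<Otimes>\<^sub>M lborel)"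
    using N(1) by (auto simp: null_sets_def lborel.emeasure_pair_measure_Times)
  then have "AE z in (lborel \<Otimes>\<^sub>M lborel). z \<notin> N \<times> (UNIV :: 'b set)" by (rule AE_not_in)
  then show ?thesis unfolding lborel_prod by eventually_elim (use N(2) in auto)
qed

lemma AE_lborel_snd:
  assumes "AE x in (lborel :: 'b::euclidean_space measure). P x"
  shows "AE z in (lborel :: ('a::euclidean_space \<times> 'b) measure). P (snd z)"
proof -
  obtain N where N: "N \<in> null_sets lborel" "{x. \<not> P x} \<subseteq> N"
    using assms by (auto elim!: AE_E simp: null_sets_def)
  have "(UNIV :: 'a set) \<times> N \<in> null_sets (lborel \<Otimes>\<^sub>M lborel)"
    using N(1) by (auto simp: null_sets_def lborel.emeasure_pair_measure_Times)
  then have "AE z in (lborel \<Otimes>\<^sub>M lborel). z \<notin> (UNIV :: 'a set) \<times> N" by (rule AE_not_in)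
  then show ?thesis unfolding lborel_prod by eventually_elim (use N(2) in auto)
qed

lemma
  fixes a :: "'a::euclidean_space \<Rightarrow> complex" and b :: "'b::euclidean_space \<Rightarrow> complex"
  assumes a: "integrable lborel a" and b: "integrable lborel b"
  shows integrable_lborel_times: "integrable lborel (\<lambda>z. a (fst z) * b (snd z))"
    and integral_lborel_times: "(LINT z|lborel. a (fst z) * b (snd z)) = (LINT x|lborel. a x) * (LINT y|lborel. b y)"
proof -
  have [measurable]: "a \<in> borel_measurable borel" "b \<in> borel_measurable borel" using a b by auto
  have i: "integrable (lborel \<Otimes>\<^sub>M lborel) (\<lambda>(x, y). a x * b y)"
  proof (rule lborel_pair.Fubini_integrable)
    show "integrable lborel (\<lambda>x. LINT y|lborel. norm (case (x, y) of (x, y) \<Rightarrow> a x * b y))"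
      using a by (simp add: norm_mult)
  qed (use b in auto)
  then show "integrable lborel (\<lambda>z. a (fst z) * b (snd z))" by (simp add: lborel_prod case_prod_unfold)
  have "(LINT z|lborel. a (fst z) * b (snd z)) = (LINT z|(lborel \<Otimes>\<^sub>M lborel). (case z of (x, y) \<Rightarrow> a x * b y))"
    by (simp add: lborel_prod case_prod_unfold)
  also have "\<dots> = (LINT x|lborel. LINT y|lborel. a x * b y)"
    using lborel_pair.integral_fst[OF i] by simp
  finally show "(LINT z|lborel. a (fst z) * b (snd z)) = (LINT x|lborel. a x) * (LINT y|lborel. b y)" by simp
qed

lemma nn_plancherel:
  assumes "nice V"
  shows "(\<integral>\<^sup>+t. ennreal ((cmod (fourier V t))\<^sup>2) \<partial>lborel) = (\<integral>\<^sup>+t. ennreal ((cmod (V t))\<^sup>2) \<partial>lborel)"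
proof -
  have "integrable lborel (\<lambda>x. Re (V x * cnj (V x)))" by (intro integrable_Re nice_square_integrable assms)
  then have "integrable lborel (\<lambda>t. (cmod (V t))\<^sup>2)" by (simp only: complex_mult_cnj_cmod_Re)
  then show ?thesis
    using plancherel[OF assms] by (simp add: nn_integral_eq_integral)
qed

context frame_setup
begin

lemma g_measurable [measurable (raw)]: "k \<in> K \<Longrightarrow> g k \<in> borel_measurable borel"
  using g_int by auto

lemma isCont_corr_test: "test_fun f \<Longrightarrow> k \<in> K \<Longrightarrow> isCont (corr f (g k)) x"
proof -
  assume f: "test_fun f" and k: "k \<in> K"
  obtain M where "\<And>x. cmod (f x) \<le> M" using f niceD(4) unfolding test_fun_def by metis
  then show ?thesis
    using f k by (intro isCont_corr[of f "g k" M]) (auto simp: test_fun_def continuous_on_eq_continuous_at intro: niceD g_int)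
qed

lemma nice_corr: "test_fun f \<Longrightarrow> k \<in> K \<Longrightarrow> nice (corr f (g k))"
proof -
  assume f: "test_fun f" and k: "k \<in> K"
  have nf: "nice f" using f by (simp add: test_fun_def)
  obtain M where "\<And>x. cmod (f x) \<le> M" using niceD(4)[OF nf] by metis
  then have "\<And>z. cmod (corr f (g k) z) \<le> M * (LINT y|lborel. cmod (g k y))"
    by (rule corr_bound[OF niceD(2)[OF nf] g_int[OF k]])
  then show ?thesis
    unfolding nice_def bounded_iff using integrable_corr[OF niceD(1)[OF nf] g_int[OF k]] isCont_corr_test[OF f k] by auto
qed

lemma corr_test_measurable: "test_fun f \<Longrightarrow> k \<in> K \<Longrightarrow> corr f (g k) \<in> borel_measurable borel"
  by (rule niceD(2)[OF nice_corr])

text \<open>The part of the frame sum that depends on space alone; \<open>wsum\<close> is the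
  lattice periodisation of \<open>hsum\<close> times the window.\<close>

definition hsum :: "('a \<Rightarrow> complex) \<Rightarrow> 'a \<Rightarrow> ennreal" where
  "hsum f x = (\<integral>\<^sup>+k. ennreal ((cmod (corr f (g k) x))\<^sup>2) \<partial>count_space K)"

lemma hsum_measurable: "test_fun f \<Longrightarrow> hsum f \<in> borel_measurable borel"
  unfolding hsum_def[abs_def]
  by (rule borel_measurable_nn_integral_count_space[OF countable_K]) (use corr_test_measurable in measurable)

lemma wsum_iterated: "wsum S f x y = (\<integral>\<^sup>+\<gamma>. hsum f (x + fst \<gamma>) * indicator S (y + snd \<gamma>) \<partial>count_space lat)"
proof -
  interpret K: sigma_finite_measure "count_space K" by (rule sigma_finite_measure_count_space_countable[OF countable_K])
  interpret L: sigma_finite_measure "count_space lat" by (rule sigma_finite_measure_count_space_countable[OF countable_lat])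
  interpret P: pair_sigma_finite "count_space K" "count_space lat" ..
  have cs: "count_space K \<Otimes>\<^sub>M count_space lat = count_space (K \<times> lat)"
    by (rule pair_measure_countable[OF countable_K countable_lat])
  have "wsum S f x y = (\<integral>\<^sup>+p. wterm S f x y p \<partial>(count_space K \<Otimes>\<^sub>M count_space lat))"
    by (simp only: cs wsum_def)
  also have "\<dots> = (\<integral>\<^sup>+\<gamma>. (\<integral>\<^sup>+k. wterm S f x y (k, \<gamma>) \<partial>count_space K) \<partial>count_space lat)"
    by (rule P.nn_integral_snd[symmetric]) (simp add: cs)
  also have "\<dots> = (\<integral>\<^sup>+\<gamma>. hsum f (x + fst \<gamma>) * indicator S (y + snd \<gamma>) \<partial>count_space lat)"
    by (simp add: wterm_def hsum_def nn_integral_multc)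
  finally show ?thesis .
qed

text \<open>Plancherel for each \<open>k\<close> between two applications of Tonelli. As an identity
  in \<open>ennreal\<close> it also carries finiteness from one side to the other.\<close>

lemma nn_integral_hsum:
  assumes f: "test_fun f"
  shows "(\<integral>\<^sup>+x. hsum f x \<partial>lborel) = (\<integral>\<^sup>+t. (\<integral>\<^sup>+k. ennreal ((cmod (fourier (corr f (g k)) t))\<^sup>2) \<partial>count_space K) \<partial>lborel)"
proof -
  have "(\<integral>\<^sup>+x. hsum f x \<partial>lborel) = (\<integral>\<^sup>+k. (\<integral>\<^sup>+x. ennreal ((cmod (corr f (g k) x))\<^sup>2) \<partial>lborel) \<partial>count_space K)"
    unfolding hsum_def
    by (rule nn_integral_count_space_nn_integral[OF countable_K]) (use corr_test_measurable[OF f] in measurable)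
  also have "\<dots> = (\<integral>\<^sup>+k. (\<integral>\<^sup>+t. ennreal ((cmod (fourier (corr f (g k)) t))\<^sup>2) \<partial>lborel) \<partial>count_space K)"
    by (rule nn_integral_cong) (simp add: nn_plancherel nice_corr[OF f])
  also have "\<dots> = (\<integral>\<^sup>+t. (\<integral>\<^sup>+k. ennreal ((cmod (fourier (corr f (g k)) t))\<^sup>2) \<partial>count_space K) \<partial>lborel)"
    by (rule nn_integral_count_space_nn_integral[OF countable_K, symmetric])
      (use fourier_measurable[OF niceD(1)[OF nice_corr[OF f]]] in measurable)
  finally show ?thesis .
qed

definition gram :: "'a \<Rightarrow> 'a \<Rightarrow> complex" where
  "gram \<xi> t = (LINT k|count_space K. cnj (fourier (g k) t) * fourier (g k) (t - \<xi>))"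

text \<open>The sum over \<open>k\<close> of the transform of \<open>corr f (g k)\<close> at
  \<open>t\<close> times its conjugate at \<open>t - \<xi>\<close>; integrating it over
  \<open>t\<close> gives the transform of \<open>hsum f\<close> at \<open>\<xi>\<close>.\<close>

definition spec :: "('a \<Rightarrow> complex) \<Rightarrow> 'a \<Rightarrow> 'a \<Rightarrow> complex" where
  "spec f \<xi> t = fourier f t * cnj (fourier f (t - \<xi>)) * gram \<xi> t"

text \<open>Finiteness of the integral of \<open>hsum f\<close> makes both double integrals
  absolutely convergent: on the frequency side \<open>|a b| \<le> |a|^2 + |b|^2\<close> and
  translation invariance give the bound of twice that integral. Exchanging sum and integral on
  either side then leaves Parseval for each \<open>k\<close>.\<close>

lemma
  assumes f: "test_fun f" and fin: "(\<integral>\<^sup>+x. hsum f x \<partial>lborel) < \<infinity>"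
  shows integrable_hsum: "integrable lborel (\<lambda>x. enn2real (hsum f x))"
    and AE_gram_summable: "AE t in lborel. integrable (count_space K) (\<lambda>k. fourier f t * cnj (fourier f (t - \<xi>)) * (cnj (fourier (g k) t) * fourier (g k) (t - \<xi>)))"
    and integrable_spec: "integrable lborel (spec f \<xi>)"
    and fourier_hsum: "(LINT x|lborel. of_real (enn2real (hsum f x)) * ue (- (x \<bullet> \<xi>))) = (LINT t|lborel. spec f \<xi> t)"
proof -
  interpret K: sigma_finite_measure "count_space K" by (rule sigma_finite_measure_count_space_countable[OF countable_K])
  interpret P: pair_sigma_finite "lborel :: 'a measure" "count_space K" ..
  have nf: "nice f" using f by (simp add: test_fun_def)
  note cm = corr_test_measurable[OF f]
  note fm = fourier_measurable[OF niceD(1)[OF nice_corr[OF f]]]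
  have [measurable]: "hsum f \<in> borel_measurable borel" by (rule hsum_measurable[OF f])
  show hi: "integrable lborel (\<lambda>x. enn2real (hsum f x))"
  proof (rule integrableI_bounded)
    have "(\<integral>\<^sup>+x. ennreal (norm (enn2real (hsum f x))) \<partial>lborel) \<le> (\<integral>\<^sup>+x. hsum f x \<partial>lborel)"
      by (intro nn_integral_mono) (simp add: ennreal_enn2real_if)
    then show "(\<integral>\<^sup>+x. ennreal (norm (enn2real (hsum f x))) \<partial>lborel) < \<infinity>" using fin by simp
  qed measurable
  let ?F = "\<lambda>k. fourier (corr f (g k))"
  have iV: "integrable (lborel \<Otimes>\<^sub>M count_space K) (\<lambda>(x, k). of_real ((cmod (corr f (g k) x))\<^sup>2) * ue (- (x \<bullet> \<xi>)))"
  proof (rule integrableI_bounded)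
    show m: "(\<lambda>(x, k). complex_of_real ((cmod (corr f (g k) x))\<^sup>2) * ue (- (x \<bullet> \<xi>))) \<in> borel_measurable (lborel \<Otimes>\<^sub>M count_space K)"
      by (rule measurable_pair_measure_countable2[OF countable_K]) (use cm in measurable)
    have "(\<integral>\<^sup>+p. ennreal (norm (case p of (x, k) \<Rightarrow> complex_of_real ((cmod (corr f (g k) x))\<^sup>2) * ue (- (x \<bullet> \<xi>)))) \<partial>(lborel \<Otimes>\<^sub>M count_space K))
        = (\<integral>\<^sup>+x. (\<integral>\<^sup>+k. ennreal (norm (complex_of_real ((cmod (corr f (g k) x))\<^sup>2) * ue (- (x \<bullet> \<xi>)))) \<partial>count_space K) \<partial>lborel)"
      by (subst K.nn_integral_fst[symmetric]) (use m in auto)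
    also have "\<dots> = (\<integral>\<^sup>+x. hsum f x \<partial>lborel)" by (simp add: hsum_def norm_mult norm_power)
    finally show "(\<integral>\<^sup>+p. ennreal (norm (case p of (x, k) \<Rightarrow> complex_of_real ((cmod (corr f (g k) x))\<^sup>2) * ue (- (x \<bullet> \<xi>)))) \<partial>(lborel \<Otimes>\<^sub>M count_space K)) < \<infinity>"
      using fin by simp
  qed
  have iF: "integrable (lborel \<Otimes>\<^sub>M count_space K) (\<lambda>(t, k). ?F k t * cnj (?F k (t - \<xi>)))"
  proof (rule integrableI_bounded)
    have fm' [measurable]: "(\<lambda>t. ?F k (t - \<xi>)) \<in> borel_measurable borel" if "k \<in> K" for k
      by (rule measurable_compose[OF _ fm[OF that]]) measurable
    show m: "(\<lambda>(t, k). ?F k t * cnj (?F k (t - \<xi>))) \<in> borel_measurable (lborel \<Otimes>\<^sub>M count_space K)"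
      by (rule measurable_pair_measure_countable2[OF countable_K]) (use fm fm' in measurable)
    have S [measurable]: "(\<lambda>t. \<integral>\<^sup>+k. ennreal ((cmod (?F k t))\<^sup>2) \<partial>count_space K) \<in> borel_measurable borel"
      by (rule borel_measurable_nn_integral_count_space[OF countable_K]) (use fm in measurable)
    have "(\<integral>\<^sup>+p. ennreal (norm (case p of (t, k) \<Rightarrow> ?F k t * cnj (?F k (t - \<xi>)))) \<partial>(lborel \<Otimes>\<^sub>M count_space K))
        = (\<integral>\<^sup>+t. (\<integral>\<^sup>+k. ennreal (norm (?F k t * cnj (?F k (t - \<xi>)))) \<partial>count_space K) \<partial>lborel)"
      by (subst K.nn_integral_fst[symmetric]) (use m in auto)
    also have "\<dots> \<le> (\<integral>\<^sup>+t. (\<integral>\<^sup>+k. ennreal ((cmod (?F k t))\<^sup>2) + ennreal ((cmod (?F k (t - \<xi>)))\<^sup>2) \<partial>count_space K) \<partial>lborel)"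
    proof (intro nn_integral_mono)
      fix t k
      have "0 \<le> cmod (?F k t) * cmod (?F k (t - \<xi>))" by simp
      then have "norm (?F k t * cnj (?F k (t - \<xi>))) \<le> (cmod (?F k t))\<^sup>2 + (cmod (?F k (t - \<xi>)))\<^sup>2"
        using sum_squares_bound[of "cmod (?F k t)" "cmod (?F k (t - \<xi>))"]
        unfolding norm_mult complex_mod_cnj by linarith
      then show "ennreal (norm (?F k t * cnj (?F k (t - \<xi>)))) \<le> ennreal ((cmod (?F k t))\<^sup>2) + ennreal ((cmod (?F k (t - \<xi>)))\<^sup>2)"
        by (simp add: ennreal_leI flip: ennreal_plus)
    qed
    also have "\<dots> = (\<integral>\<^sup>+t. (\<integral>\<^sup>+k. ennreal ((cmod (?F k t))\<^sup>2) \<partial>count_space K) + (\<integral>\<^sup>+k. ennreal ((cmod (?F k (t - \<xi>)))\<^sup>2) \<partial>count_space K) \<partial>lborel)"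
      by (simp add: nn_integral_add)
    also have "\<dots> = (\<integral>\<^sup>+t. (\<integral>\<^sup>+k. ennreal ((cmod (?F k t))\<^sup>2) \<partial>count_space K) \<partial>lborel)
        + (\<integral>\<^sup>+t. (\<integral>\<^sup>+k. ennreal ((cmod (?F k (t - \<xi>)))\<^sup>2) \<partial>count_space K) \<partial>lborel)"
      by (rule nn_integral_add) (use measurable_compose[OF _ S, of "\<lambda>t. t - \<xi>"] in simp_all)
    also have "(\<integral>\<^sup>+t. (\<integral>\<^sup>+k. ennreal ((cmod (?F k (t - \<xi>)))\<^sup>2) \<partial>count_space K) \<partial>lborel) = (\<integral>\<^sup>+t. (\<integral>\<^sup>+k. ennreal ((cmod (?F k t))\<^sup>2) \<partial>count_space K) \<partial>lborel)"
      using nn_integral_lborel_shift[OF S, of "- \<xi>"] by (simp add: add.commute)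
    finally show "(\<integral>\<^sup>+p. ennreal (norm (case p of (t, k) \<Rightarrow> ?F k t * cnj (?F k (t - \<xi>)))) \<partial>(lborel \<Otimes>\<^sub>M count_space K)) < \<infinity>"
      by (rule le_less_trans) (use fin in \<open>simp add: nn_integral_hsum[OF f]\<close>)
  qed
  have Feq: "?F k t * cnj (?F k (t - \<xi>)) = fourier f t * cnj (fourier f (t - \<xi>)) * (cnj (fourier (g k) t) * fourier (g k) (t - \<xi>))" if "k \<in> K" for k t
    by (simp add: fourier_corr niceD(1)[OF nf] g_int[OF that] mult_ac)
  have Feqi: "(LINT k|count_space K. ?F k t * cnj (?F k (t - \<xi>))) = spec f \<xi> t" for t
  proof -
    have "(LINT k|count_space K. ?F k t * cnj (?F k (t - \<xi>))) = (LINT k|count_space K. fourier f t * cnj (fourier f (t - \<xi>)) * (cnj (fourier (g k) t) * fourier (g k) (t - \<xi>)))"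
      by (rule Bochner_Integration.integral_cong) (auto simp: Feq)
    then show ?thesis unfolding spec_def gram_def integral_mult_right_zero .
  qed
  show "AE t in lborel. integrable (count_space K) (\<lambda>k. fourier f t * cnj (fourier f (t - \<xi>)) * (cnj (fourier (g k) t) * fourier (g k) (t - \<xi>)))"
    using P.AE_integrable_fst[OF iF]
  proof eventually_elim
    case (elim t)
    then show ?case by (subst (asm) Bochner_Integration.integrable_cong[OF refl Feq]) auto
  qed
  show "integrable lborel (spec f \<xi>)"
    using P.integrable_fst[OF iF] unfolding Feqi .
  have "of_real (enn2real (hsum f x)) * ue (- (x \<bullet> \<xi>)) = (LINT k|count_space K. of_real ((cmod (corr f (g k) x))\<^sup>2) * ue (- (x \<bullet> \<xi>)))" for x
  proof -
    have "(LINT k|count_space K. (cmod (corr f (g k) x))\<^sup>2) = enn2real (hsum f x)"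
      unfolding hsum_def by (rule integral_eq_nn_integral) auto
    then show ?thesis unfolding integral_mult_left_zero integral_complex_of_real by simp
  qed
  then have "(LINT x|lborel. of_real (enn2real (hsum f x)) * ue (- (x \<bullet> \<xi>)))
      = (LINT x|lborel. LINT k|count_space K. of_real ((cmod (corr f (g k) x))\<^sup>2) * ue (- (x \<bullet> \<xi>)))"
    by (simp only:)
  also have "\<dots> = (LINT k|count_space K. LINT x|lborel. of_real ((cmod (corr f (g k) x))\<^sup>2) * ue (- (x \<bullet> \<xi>)))"
    by (rule P.Fubini_integral[OF iV, symmetric])
  also have "\<dots> = (LINT k|count_space K. LINT t|lborel. ?F k t * cnj (?F k (t - \<xi>)))"
  proof (rule Bochner_Integration.integral_cong)
    fix k assume "k \<in> space (count_space K)"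
    then have nV: "nice (corr f (g k))" using nice_corr[OF f] by simp
    \<comment> \<open>Attaching the character to the conjugated factor makes this an inner product
      of the correlation with its own modulation, whose transform is shifted by
      \<open>\<xi>\<close>.\<close>
    have "(LINT x|lborel. of_real ((cmod (corr f (g k) x))\<^sup>2) * ue (- (x \<bullet> \<xi>))) = (LINT x|lborel. corr f (g k) x * cnj (corr f (g k) x * ue (x \<bullet> \<xi>)))"
      by (intro Bochner_Integration.integral_cong refl)
        (simp only: complex_norm_square complex_cnj_mult ue_minus mult.assoc)
    also have "\<dots> = (LINT t|lborel. ?F k t * cnj (fourier (\<lambda>x. corr f (g k) x * ue (x \<bullet> \<xi>)) t))"
      by (rule parseval(2)[OF nV nice_mult_ue[OF nV], symmetric])
    finally show "(LINT x|lborel. of_real ((cmod (corr f (g k) x))\<^sup>2) * ue (- (x \<bullet> \<xi>))) = (LINT t|lborel. ?F k t * cnj (?F k (t - \<xi>)))"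
      by (simp add: fourier_mult_ue[OF niceD(1)[OF nV]])
  qed simp
  also have "\<dots> = (LINT t|lborel. LINT k|count_space K. ?F k t * cnj (?F k (t - \<xi>)))"
    by (rule P.Fubini_integral[OF iF])
  finally show "(LINT x|lborel. of_real (enn2real (hsum f x)) * ue (- (x \<bullet> \<xi>))) = (LINT t|lborel. spec f \<xi> t)"
    unfolding Feqi .
qed

definition orbit_weight :: "('a \<Rightarrow> complex) \<Rightarrow> 'a \<times> real \<Rightarrow> complex" where
  "orbit_weight f z = of_real (enn2real (hsum f (fst z))) * indicator {-c..c} (snd z)"

text \<open>A complex-valued counterpart of \<open>wsum\<close>, so that Fourier coefficients make
  sense. Its conventional values at divergent points are the same along each orbit, hence it is
  periodic everywhere and not just almost everywhere.\<close>

definition orbit_sum :: "('a \<Rightarrow> complex) \<Rightarrow> 'a \<times> real \<Rightarrow> complex" where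
  "orbit_sum f z = (LINT \<gamma>|count_space lat. orbit_weight f (z + \<gamma>))"


lemma orbit_sum_periodic: "\<gamma>0 \<in> lat \<Longrightarrow> orbit_sum f (z + \<gamma>0) = orbit_sum f z"
  using integral_bij_count_space[OF lat_bij, of \<gamma>0 "\<lambda>\<gamma>. orbit_weight f (z + \<gamma>)"]
  by (simp add: orbit_sum_def add.assoc)

lemma window_fourier: "integrable lborel (\<lambda>y. indicator {-c..c} y * ue (- (y * s)))"
  "(LINT y|lborel. indicator {-c..c} y * ue (- (y * s))) = 2 * of_real c * fourier (box_density c) s"
proof -
  have e: "indicator {-c..c} y = 2 * of_real c * box_density c y" for y
    using c_pos by (simp add: box_density_def indicator_def)
  have i: "integrable lborel (\<lambda>y. box_density c y * ue (- (y * s)))"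
    by (intro integrable_mult_ue niceD(1)[OF nice_box_density[OF c_pos]]) measurable
  show "integrable lborel (\<lambda>y. indicator {-c..c} y * ue (- (y * s)))"
    unfolding e mult.assoc by (intro integrable_mult_right i)
  show "(LINT y|lborel. indicator {-c..c} y * ue (- (y * s))) = 2 * of_real c * fourier (box_density c) s"
    unfolding e mult.assoc integral_mult_right_zero by (subst fourier_lborel) auto
qed

text \<open>Against a dual character the lattice sum unfolds to an integral of
  \<open>orbit_weight\<close>, which splits into the transform of \<open>hsum f\<close> in space and
  the transform of the window.\<close>

lemma
  assumes f: "test_fun f" and fin: "(\<integral>\<^sup>+x. hsum f x \<partial>lborel) < \<infinity>"
  shows orbit_sum_integrable: "integrable torus (orbit_sum f)"
    and AE_wsum_orbit_sum: "AE z in lborel. \<exists>r\<ge>0. wsum {-c..c} f (fst z) (snd z) = ennreal r \<and> orbit_sum f z = of_real r"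
    and orbit_sum_coeff: "\<eta> \<in> dual_lattice lat \<Longrightarrow> (LINT z|torus. orbit_sum f z * ue (- (z \<bullet> \<eta>)))
      = 2 * of_real c * fourier (box_density c) (snd \<eta>) * (LINT t|lborel. spec f (fst \<eta>) t)"
proof -
  note hi = integrable_hsum[OF f fin]
  have hm [measurable]: "hsum f \<in> borel_measurable borel" by (rule hsum_measurable[OF f])
  have eq: "orbit_weight f z * ue (- (z \<bullet> \<eta>)) = (of_real (enn2real (hsum f (fst z))) * ue (- (fst z \<bullet> fst \<eta>))) * (indicator {-c..c} (snd z) * ue (- (snd z * snd \<eta>)))" for z \<eta>
  proof -
    have "ue (- (z \<bullet> \<eta>)) = ue (- (fst z \<bullet> fst \<eta>)) * ue (- (snd z * snd \<eta>))"
      by (simp add: inner_prod_def flip: ue_add)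
    then show ?thesis by (simp add: orbit_weight_def)
  qed
  have hi': "integrable lborel (\<lambda>x. complex_of_real (enn2real (hsum f x)) * ue (- (x \<bullet> \<xi>)))" for \<xi>
    by (intro integrable_mult_ue integrable_of_real hi) measurable
  have wi: "integrable lborel (\<lambda>z. orbit_weight f z * ue (- (z \<bullet> \<eta>)))" for \<eta>
    unfolding eq by (rule integrable_lborel_times[OF hi' window_fourier(1)])
  have wi0: "integrable lborel (orbit_weight f)" using wi[of 0] by simp
  show "integrable torus (orbit_sum f)"
    using unfold_integral(2)[OF wi0] by (simp add: orbit_sum_def[abs_def])
  show "(LINT z|torus. orbit_sum f z * ue (- (z \<bullet> \<eta>)))
      = 2 * of_real c * fourier (box_density c) (snd \<eta>) * (LINT t|lborel. spec f (fst \<eta>) t)" if \<eta>: "\<eta> \<in> dual_lattice lat"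
  proof -
    have "(LINT \<gamma>|count_space lat. orbit_weight f (z + \<gamma>) * ue (- ((z + \<gamma>) \<bullet> \<eta>))) = orbit_sum f z * ue (- (z \<bullet> \<eta>))" for z
    proof -
      have "(LINT \<gamma>|count_space lat. orbit_weight f (z + \<gamma>) * ue (- ((z + \<gamma>) \<bullet> \<eta>))) = (LINT \<gamma>|count_space lat. orbit_weight f (z + \<gamma>) * ue (- (z \<bullet> \<eta>)))"
        by (rule Bochner_Integration.integral_cong) (use ue_dual[OF _ \<eta>] in auto)
      then show ?thesis by (simp add: orbit_sum_def)
    qed
    then have "(LINT z|torus. orbit_sum f z * ue (- (z \<bullet> \<eta>))) = (LINT z|lborel. orbit_weight f z * ue (- (z \<bullet> \<eta>)))"
      using unfold_integral(3)[OF wi[of \<eta>]] by simp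
    also have "\<dots> = (LINT t|lborel. spec f (fst \<eta>) t) * (2 * of_real c * fourier (box_density c) (snd \<eta>))"
      unfolding eq integral_lborel_times[OF hi' window_fourier(1)] fourier_hsum[OF f fin] window_fourier(2) ..
    finally show ?thesis by (simp add: mult_ac)
  qed
  \<comment> \<open>\<open>orbit_weight\<close> turns an infinite \<open>hsum\<close> into 0, so
    agreement with \<open>wsum\<close> requires finiteness at all lattice translates of
    \<open>z\<close> at once; the lattice being countable, this holds almost everywhere.\<close>
  have "AE x in lborel. hsum f x < \<infinity>"
    using nn_integral_PInf_AE[of "hsum f" lborel] hm fin by (simp add: less_top)
  then have "AE z in lborel. hsum f (fst (z :: 'a \<times> real)) < \<infinity>" by (rule AE_lborel_fst)
  then have "AE z in lborel. hsum f (fst (\<gamma> + z :: 'a \<times> real)) < \<infinity>" for \<gamma> by (rule AE_lborel_shift)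
  then have 1: "AE z in lborel. \<forall>\<gamma>\<in>lat. hsum f (fst (\<gamma> + z)) < \<infinity>"
    by (subst AE_ball_countable[OF countable_lat]) blast
  have 2: "AE z in lborel. integrable (count_space lat) (\<lambda>\<gamma>. orbit_weight f (z + \<gamma>))"
  proof (rule AE_lborel_of_torus[OF unfold_integral(1)[OF wi0]])
    fix z \<gamma>0 assume g: "\<gamma>0 \<in> lat" and i: "integrable (count_space lat) (\<lambda>\<gamma>. orbit_weight f (z + \<gamma>0 + \<gamma>))"
    then have "integrable (count_space lat) (\<lambda>\<gamma>. (\<lambda>\<gamma>. orbit_weight f (z + \<gamma>)) (\<gamma>0 + \<gamma>))" by (simp add: add.assoc)
    then show "integrable (count_space lat) (\<lambda>\<gamma>. orbit_weight f (z + \<gamma>))"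
      by (subst (asm) integrable_bij_count_space[OF lat_bij[OF g]])
  qed
  show "AE z in lborel. \<exists>r\<ge>0. wsum {-c..c} f (fst z) (snd z) = ennreal r \<and> orbit_sum f z = of_real r"
    using 1 2
  proof eventually_elim
    case (elim z)
    define u where "u \<gamma> = enn2real (hsum f (fst (z + \<gamma>))) * indicator {-c..c} (snd (z + \<gamma>))" for \<gamma>
    have ow: "orbit_weight f (z + \<gamma>) = complex_of_real (u \<gamma>)" for \<gamma>
      by (simp add: orbit_weight_def u_def indicator_def)
    have ui: "integrable (count_space lat) u" using integrable_Re[OF elim(2)] by (simp add: ow)
    have "wsum {-c..c} f (fst z) (snd z) = (\<integral>\<^sup>+\<gamma>. ennreal (u \<gamma>) \<partial>count_space lat)"
      unfolding wsum_iterated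
    proof (rule nn_integral_cong)
      fix \<gamma> assume "\<gamma> \<in> space (count_space lat)"
      then have "hsum f (fst z + fst \<gamma>) < \<infinity>" using elim(1) by (auto simp: add.commute)
      then show "hsum f (fst z + fst \<gamma>) * indicator {-c..c} (snd z + snd \<gamma>) = ennreal (u \<gamma>)"
        by (auto simp: u_def indicator_def)
    qed
    also have "\<dots> = ennreal (LINT \<gamma>|count_space lat. u \<gamma>)"
      by (rule nn_integral_eq_integral[OF ui]) (simp add: u_def)
    finally have "wsum {-c..c} f (fst z) (snd z) = ennreal (LINT \<gamma>|count_space lat. u \<gamma>)" .
    moreover have "orbit_sum f z = of_real (LINT \<gamma>|count_space lat. u \<gamma>)"
      unfolding orbit_sum_def ow by (rule integral_complex_of_real)
    moreover have "(LINT \<gamma>|count_space lat. u \<gamma>) \<ge> 0" by (simp add: u_def)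
    ultimately show ?case by blast
  qed
qed

end

section \<open>From tight frames to the Gramian equations\<close>

lemma fourier_translate:
  fixes f :: "'a::euclidean_space \<Rightarrow> complex"
  assumes "integrable lborel f"
  shows "fourier (\<lambda>t. f (t + a)) w = fourier f w * ue (a \<bullet> w)"
proof -
  have [measurable]: "f \<in> borel_measurable borel" using assms by auto
  have e: "f (t + a) * ue (- (t \<bullet> w)) = f (a + t) * ue (- ((a + t) \<bullet> w)) * ue (a \<bullet> w)" for t
    by (simp add: mult.assoc inner_add_left add.commute flip: ue_add)
  have "fourier (\<lambda>t. f (t + a)) w = (LINT t|lborel. f (t + a) * ue (- (t \<bullet> w)))"
    by (rule fourier_lborel) measurable
  also have "\<dots> = (LINT t|lborel. f t * ue (- (t \<bullet> w)) * ue (a \<bullet> w))"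
    unfolding e by (rule integral_lborel_shift) measurable
  finally show ?thesis by (simp add: fourier_lborel)
qed

lemma fourier_add_scaled:
  assumes f: "integrable lborel f" and h: "integrable lborel h"
  shows "fourier (\<lambda>t. f t + a * h t) w = fourier f w + a * fourier h w"
proof -
  have [measurable]: "f \<in> borel_measurable borel" "h \<in> borel_measurable borel" using f h by auto
  have i: "integrable lborel (\<lambda>t. f t * ue (- (t \<bullet> w)))" "integrable lborel (\<lambda>t. a * (h t * ue (- (t \<bullet> w))))"
    using f h by (auto intro!: integrable_mult_ue integrable_mult_right)
  have "fourier (\<lambda>t. f t + a * h t) w = (LINT t|lborel. f t * ue (- (t \<bullet> w)) + a * (h t * ue (- (t \<bullet> w))))"
    by (subst fourier_lborel) (auto simp: distrib_right mult.assoc)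
  also have "\<dots> = (LINT t|lborel. f t * ue (- (t \<bullet> w))) + a * (LINT t|lborel. h t * ue (- (t \<bullet> w)))"
    by (simp only: Bochner_Integration.integral_add[OF i] integral_mult_right_zero)
  finally show ?thesis by (simp add: fourier_lborel)
qed

lemma test_fun_gauss: "test_fun (\<lambda>x. complex_of_real (gauss x))"
proof (rule test_funI[OF integrable_gauss_complex])
  show "bounded (range (\<lambda>x. complex_of_real (gauss x)))"
    unfolding bounded_iff using gauss_le_1 by (intro exI[of _ 1]) (auto simp: abs_of_pos[OF gauss_pos])
qed (intro continuous_intros)

lemma sq_norm_fourier:
  assumes "test_fun f"
  shows "(LINT t|lborel. fourier f t * cnj (fourier f t)) = of_real (sq_norm f)"
    and "integrable lborel (\<lambda>t. fourier f t * cnj (fourier f t))"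
proof -
  have nf: "nice f" using assms by (simp add: test_fun_def)
  show "integrable lborel (\<lambda>t. fourier f t * cnj (fourier f t))" by (rule parseval(1)[OF nf nf])
  have "(LINT t|lborel. fourier f t * cnj (fourier f t)) = (LINT t|lborel. f t * cnj (f t))"
    by (rule parseval(2)[OF nf nf])
  also have "\<dots> = of_real (sq_norm f)"
    unfolding sq_norm_def integral_complex_of_real[symmetric] by (simp only: complex_norm_square)
  finally show "(LINT t|lborel. fourier f t * cnj (fourier f t)) = of_real (sq_norm f)" .
qed

text \<open>The functions \<open>u + b T\<^sub>s u\<close> with \<open>u\<close> the Gaussian suffice to recover the multiplier, because
  varying \<open>b\<close> isolates the Fourier coefficient at \<open>s\<close>.\<close>

lemma multiplier_zero:
  fixes M :: "'a::euclidean_space \<Rightarrow> complex"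
  assumes p: "integrable lborel (\<lambda>t. of_real (gauss t) * of_real (gauss (t - \<xi>)) * M t)"
    and z: "\<And>f. test_fun f \<Longrightarrow> (LINT t|lborel. fourier f t * cnj (fourier f (t - \<xi>)) * M t) = 0"
  shows "AE t in lborel. M t = 0"
proof -
  define P where "P t = of_real (gauss t) * of_real (gauss (t - \<xi>)) * M t" for t
  have Pi: "integrable lborel P" using p by (simp add: P_def[abs_def])
  then have [measurable]: "P \<in> borel_measurable borel" by auto
  \<comment> \<open>The Gaussian by itself disposes of the term of the expansion that does not
    involve \<open>s\<close>.\<close>
  have P0: "(LINT t|lborel. P t) = 0"
    using z[OF test_fun_gauss] by (simp add: fourier_gauss P_def)
  have "fourier P s = 0" for s
  proof -
    define w where "w = ue (- (s \<bullet> \<xi>))"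
    define A where "A = (LINT t|lborel. P t * ue (- (s \<bullet> t)))"
    define C where "C = (LINT t|lborel. P t * ue (s \<bullet> t))"
    have iA: "integrable lborel (\<lambda>t. P t * ue (- (s \<bullet> t)))" and iC: "integrable lborel (\<lambda>t. P t * ue (s \<bullet> t))"
      by (intro integrable_mult_ue Pi; measurable)+
    have main: "b * A + cnj b * w * C = 0" for b
    proof -
      let ?E = "\<lambda>x::'a. complex_of_real (gauss x)"
      let ?f = "\<lambda>t. ?E t + b * ?E (t + - s)"
      have tf: "test_fun ?f" by (intro test_fun_add test_fun_translate test_fun_gauss)
      have ff: "fourier ?f t = ?E t * (1 + b * ue (- (s \<bullet> t)))" for t
      proof -
        have "fourier ?f t = fourier ?E t + b * fourier (\<lambda>t. ?E (t + - s)) t"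
          by (rule fourier_add_scaled) (use test_fun_gauss test_fun_translate[OF test_fun_gauss, of "- s"] in \<open>auto simp: test_fun_def nice_def\<close>)
        also have "fourier (\<lambda>t. ?E (t + - s)) t = ?E t * ue (- (s \<bullet> t))"
          using fourier_translate[OF integrable_gauss_complex, of "- s" t] by (simp only: fourier_gauss inner_minus_left)
        finally show ?thesis by (simp only: fourier_gauss) (simp add: algebra_simps)
      qed
      have e: "fourier ?f t * cnj (fourier ?f (t - \<xi>)) * M t = (1 + b * cnj b * w) * P t + b * (P t * ue (- (s \<bullet> t))) + cnj b * w * (P t * ue (s \<bullet> t))" for t
      proof -
        have u: "ue (- (s \<bullet> (t - \<xi>))) = ue (- (s \<bullet> t)) * cnj w"
          by (simp add: w_def inner_diff_right flip: ue_minus ue_add)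
        have v: "cnj (ue (- (s \<bullet> t))) = ue (s \<bullet> t)" "ue (- (s \<bullet> t)) * ue (s \<bullet> t) = 1"
          by (simp_all flip: ue_minus ue_add)
        have "fourier ?f t * cnj (fourier ?f (t - \<xi>)) * M t = P t * ((1 + b * ue (- (s \<bullet> t))) * (1 + cnj b * (ue (s \<bullet> t) * w)))"
          unfolding ff u P_def by (simp add: v mult_ac)
        also have "(1 + b * ue (- (s \<bullet> t))) * (1 + cnj b * (ue (s \<bullet> t) * w)) = 1 + b * cnj b * w * (ue (- (s \<bullet> t)) * ue (s \<bullet> t)) + b * ue (- (s \<bullet> t)) + cnj b * w * ue (s \<bullet> t)"
          by (simp add: algebra_simps)
        finally show ?thesis unfolding v(2) by (simp add: algebra_simps)
      qed
      have "0 = (LINT t|lborel. (1 + b * cnj b * w) * P t + b * (P t * ue (- (s \<bullet> t))) + cnj b * w * (P t * ue (s \<bullet> t)))"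
        using z[OF tf] unfolding e by simp
      also have "\<dots> = (1 + b * cnj b * w) * (LINT t|lborel. P t) + b * A + cnj b * w * C"
        unfolding A_def C_def integral_mult_right_zero[symmetric]
        using Pi iA iC by simp
      finally show ?thesis by (simp add: P0)
    qed
    \<comment> \<open>The choices \<open>b = \<i>\<close> and \<open>b = 1\<close> give
      \<open>A = w * C\<close> and \<open>A = - (w * C)\<close>, hence \<open>A = 0\<close>.\<close>
    have "\<i> * (A - w * C) = 0" using main[of \<i>] by (simp add: algebra_simps)
    then have "A = w * C" by simp
    moreover have "A + w * C = 0" using main[of 1] by simp
    ultimately have "A + A = 0" by metis
    then have "A = 0" by (simp flip: mult_2)
    then show ?thesis by (simp add: fourier_lborel A_def inner_commute)
  qed
  from fourier_unique[OF Pi this] show ?thesis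
  proof eventually_elim
    case (elim t)
    then show ?case using gauss_pos[of t] gauss_pos[of "t - \<xi>"] by (simp add: P_def)
  qed
qed

text \<open>Balls have positive measure, so a property valid almost everywhere holds at points
  arbitrarily close to 0.\<close>

lemma AE_tendsto_zero:
  fixes P :: "'a::euclidean_space \<Rightarrow> bool"
  assumes "AE z in lborel. P z"
  obtains X where "X \<longlonglongrightarrow> 0" "\<And>n::nat. P (X n)"
proof -
  have "\<exists>z. norm z < inverse (real (Suc n)) \<and> P z" for n
  proof (rule ccontr)
    assume "\<not> ?thesis"
    then have "AE z in lborel. z \<notin> ball (0::'a) (inverse (real (Suc n)))"
      using assms by (auto elim!: eventually_mono)
    then have "ball (0::'a) (inverse (real (Suc n))) \<in> null_sets lborel"
      by (subst (asm) AE_iff_null_sets[symmetric]) auto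
    then have "negligible (ball (0::'a) (inverse (real (Suc n))))"
      by (simp add: negligible_iff_null_sets null_sets_completionI)
    then show False using open_not_negligible[OF open_ball] by (metis ball_eq_empty inverse_positive_iff_positive not_le of_nat_0_less_iff zero_less_Suc)
  qed
  then obtain X where X: "\<And>n. norm (X n) < inverse (real (Suc n))" "\<And>n. P (X n)" by metis
  have "X \<longlonglongrightarrow> 0"
    by (rule Lim_null_comparison[OF _ LIMSEQ_inverse_real_of_nat]) (intro always_eventually allI less_imp_le X(1))
  then show ?thesis using X(2) that by blast
qed

context frame_setup
begin

text \<open>Unfolding leaves the product of \<open>hsum f\<close> and the window indicator, whose
  second factor integrates to \<open>2 * c\<close>. This is how a bounded \<open>wsum\<close> forces
  \<open>hsum\<close> to be integrable.\<close>

lemma nn_integral_hsum_window: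
  assumes f: "test_fun f"
  shows "ennreal (2 * c) * (\<integral>\<^sup>+x. hsum f x \<partial>lborel) = (\<integral>\<^sup>+z. wsum {-c..c} f (fst z) (snd z) \<partial>torus)"
proof -
  have hm [measurable]: "hsum f \<in> borel_measurable borel" by (rule hsum_measurable[OF f])
  have m: "(\<lambda>z. hsum f (fst z) * indicator {-c..c} (snd z)) \<in> borel_measurable (borel :: ('a \<times> real) measure)"
    unfolding borel_prod[symmetric] by measurable
  have "(\<integral>\<^sup>+z. wsum {-c..c} f (fst z) (snd z) \<partial>torus) = (\<integral>\<^sup>+z. hsum f (fst z) * indicator {-c..c} (snd z) \<partial>lborel)"
    unfolding wsum_iterated by (subst unfold_nn[OF m]) simp
  also have "\<dots> = (\<integral>\<^sup>+x. (\<integral>\<^sup>+y. hsum f x * indicator {-c..c} y \<partial>lborel) \<partial>lborel)"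
    unfolding lborel_prod[symmetric] by (subst lborel.nn_integral_fst[symmetric]) auto
  also have "\<dots> = (\<integral>\<^sup>+x. hsum f x * ennreal (2 * c) \<partial>lborel)"
  proof (rule nn_integral_cong)
    fix x
    have "emeasure lborel {-c..c} = ennreal (2 * c)" using c_pos by (subst emeasure_lborel_Icc) auto
    then show "(\<integral>\<^sup>+y. hsum f x * indicator {-c..c} y \<partial>lborel) = hsum f x * ennreal (2 * c)"
      by (subst nn_integral_cmult_indicator) auto
  qed
  also have "\<dots> = ennreal (2 * c) * (\<integral>\<^sup>+x. hsum f x \<partial>lborel)"
    by (subst nn_integral_multc) (auto simp: mult.commute)
  finally show ?thesis by simp
qed

text \<open>Translating \<open>f\<close> gives the value at every \<open>(x, 0)\<close>, and
  periodicity carries it to every \<open>(x, snd \<gamma>)\<close>. These second coordinates are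
  dense, and \<open>good\<close> points are points of continuity.\<close>

lemma wsum_tight_everywhere:
  assumes H: "\<And>f. test_fun f \<Longrightarrow> wsum {-c..c} f 0 0 = ennreal (sq_norm f)"
    and f: "test_fun f" and y: "good y"
  shows "wsum {-c..c} f x y = ennreal (sq_norm f)"
proof -
  have fm: "f \<in> borel_measurable borel" using f niceD by (auto simp: test_fun_def)
  have 0: "wsum {-c..c} f x 0 = ennreal (sq_norm f)" for x
    using H[OF test_fun_translate[OF f, of x]] wsum_translate[of "{-c..c}" f x 0 0] sq_norm_translate[OF fm, of x] by simp
  have "\<exists>\<gamma>\<in>lat. \<bar>snd \<gamma> - y\<bar> < inverse (real (Suc n))" for n by (rule snd_approx) simp
  then obtain Y where Y: "\<And>n. Y n \<in> lat" "\<And>n. \<bar>snd (Y n) - y\<bar> < inverse (real (Suc n))" by metis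
  have "(\<lambda>n. snd (Y n) - y) \<longlonglongrightarrow> 0"
    by (rule Lim_null_comparison[OF _ LIMSEQ_inverse_real_of_nat]) (intro always_eventually allI, simp only: real_norm_def less_imp_le[OF Y(2)])
  then have "(\<lambda>n. snd (Y n)) \<longlonglongrightarrow> y" by (simp add: LIM_zero_iff)
  from tendsto_wsum[OF _ this y, of f "sq_norm f" x]
  have "(\<lambda>n. wsum {-c..c} f x (snd (Y n))) \<longlonglongrightarrow> wsum {-c..c} f x y" by (simp add: 0)
  moreover have "wsum {-c..c} f x (snd (Y n)) = ennreal (sq_norm f)" for n
    using wsum_lattice_shift[OF Y(1)[of n], of "{-c..c}" f "x - fst (Y n)" 0] 0 by simp
  ultimately show ?thesis by (simp add: LIMSEQ_const_iff)
qed

text \<open>The factor \<open>D \<Phi>\<close> of the Gramian equation, with density and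
  \<open>\<Phi>\<close> in closed form.\<close>

abbreviation amp :: "'a \<times> real \<Rightarrow> complex" where
  "amp \<eta> \<equiv> of_real (2 * c / covol) * fourier (box_density c) (snd \<eta>)"

lemma tight_imp_gram:
  assumes H: "\<And>f. test_fun f \<Longrightarrow> wsum {-c..c} f 0 0 = ennreal (sq_norm f)"
    and \<eta>: "\<eta> \<in> dual_lattice lat"
  shows "AE t in lborel. integrable (count_space K) (\<lambda>k. cnj (fourier (g k) t) * fourier (g k) (t - fst \<eta>))
    \<and> amp \<eta> * gram (fst \<eta>) t = (if \<eta> = 0 then 1 else 0)"
proof -
  let ?\<xi> = "fst \<eta>" and ?\<delta> = "if \<eta> = 0 then 1 else 0 :: complex"
  have AEw: "AE z in lborel. wsum {-c..c} f (fst z) (snd z) = ennreal (sq_norm f)" if "test_fun f" for f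
    using AE_lborel_snd[OF AE_good] by eventually_elim (rule wsum_tight_everywhere[OF H that])
  have fin: "(\<integral>\<^sup>+x. hsum f x \<partial>lborel) < \<infinity>" if f: "test_fun f" for f
  proof -
    have "ennreal (2 * c) * (\<integral>\<^sup>+x. hsum f x \<partial>lborel) = (\<integral>\<^sup>+z. ennreal (sq_norm f) \<partial>torus)"
      unfolding nn_integral_hsum_window[OF f]
      by (rule nn_integral_cong_AE) (rule AE_torus_of_lborel[OF AEw[OF f]])
    also have "\<dots> < \<infinity>" by (simp add: emeasure_torus ennreal_mult_less_top)
    finally show ?thesis using c_pos by (auto simp: ennreal_mult_less_top)
  qed
  have key: "amp \<eta> * (LINT t|lborel. spec f ?\<xi> t) = ?\<delta> * of_real (sq_norm f)" if f: "test_fun f" for f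
  proof -
    have "AE z in lborel. orbit_sum f z = of_real (sq_norm f)"
      using AEw[OF f] AE_wsum_orbit_sum[OF f fin[OF f]]
      by eventually_elim auto
    then have "AE z in torus. orbit_sum f z = of_real (sq_norm f)" by (rule AE_torus_of_lborel)
    then have "(LINT z|torus. orbit_sum f z * ue (- (z \<bullet> \<eta>))) = (LINT z|torus. of_real (sq_norm f) * ue (- (z \<bullet> \<eta>)))"
      using borel_measurable_integrable[OF orbit_sum_integrable[OF f fin[OF f]]]
      by (intro integral_cong_AE) auto
    also have "\<dots> = of_real (sq_norm f) * (if \<eta> = 0 then of_real covol else 0)"
      by (simp add: torus_character[OF \<eta>])
    finally show ?thesis
      using covol_pos unfolding orbit_sum_coeff[OF f fin[OF f] \<eta>] by (auto simp: field_simps split: if_splits)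
  qed
  let ?M = "\<lambda>t. amp \<eta> * gram ?\<xi> t - ?\<delta>"
  \<comment> \<open>Where \<open>?\<delta>\<close> is non-zero, \<open>\<eta>\<close> and hence
    \<open>?\<xi>\<close> are 0, so both terms carry the same product of transforms.\<close>
  have eq: "fourier f t * cnj (fourier f (t - ?\<xi>)) * ?M t = amp \<eta> * spec f ?\<xi> t - ?\<delta> * (fourier f t * cnj (fourier f t))" for f t
    by (auto simp: spec_def algebra_simps)
  have iM: "integrable lborel (\<lambda>t. fourier f t * cnj (fourier f (t - ?\<xi>)) * ?M t)" if f: "test_fun f" for f
    unfolding eq by (intro Bochner_Integration.integrable_diff integrable_mult_right integrable_spec[OF f fin[OF f]] sq_norm_fourier(2)[OF f])
  have zM: "(LINT t|lborel. fourier f t * cnj (fourier f (t - ?\<xi>)) * ?M t) = 0" if f: "test_fun f" for f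
    unfolding eq using key[OF f]
    by (subst Bochner_Integration.integral_diff)
      (auto simp: sq_norm_fourier(1)[OF f] intro!: integrable_mult_right integrable_spec[OF f fin[OF f]] sq_norm_fourier(2)[OF f])
  have "AE t in lborel. ?M t = 0"
    by (rule multiplier_zero[of ?\<xi>]) (use iM[OF test_fun_gauss] zM in \<open>simp_all add: fourier_gauss\<close>)
  \<comment> \<open>Summability is known only after multiplication by transforms of a test function;
    the Gaussian never vanishes and can be divided out.\<close>
  moreover have "AE t in lborel. integrable (count_space K) (\<lambda>k. cnj (fourier (g k) t) * fourier (g k) (t - fst \<eta>))"
    using AE_gram_summable[OF test_fun_gauss fin[OF test_fun_gauss], of ?\<xi>]
  proof eventually_elim
    case (elim t)
    let ?C = "complex_of_real (gauss t) * complex_of_real (gauss (t - ?\<xi>))"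
    have C: "?C \<noteq> 0" using gauss_pos[of t] gauss_pos[of "t - ?\<xi>"] by simp
    have "integrable (count_space K) (\<lambda>k. inverse ?C * (?C * (cnj (fourier (g k) t) * fourier (g k) (t - ?\<xi>))))"
      by (rule integrable_mult_right) (use elim in \<open>simp add: fourier_gauss\<close>)
    moreover have "inverse ?C * (?C * z) = z" for z
      by (metis C left_inverse mult.assoc mult_1_left)
    ultimately show ?case by (simp only:)
  qed
  ultimately show ?thesis by eventually_elim simp
qed

end

section \<open>From the Gramian equations to tight frames\<close>

context frame_setup
begin

lemma wsum_tight_AE:
  assumes H: "\<And>\<eta>. \<eta> \<in> dual_lattice lat \<Longrightarrow> AE t in lborel. integrable (count_space K) (\<lambda>k. cnj (fourier (g k) t) * fourier (g k) (t - fst \<eta>))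
      \<and> amp \<eta> * gram (fst \<eta>) t = (if \<eta> = 0 then 1 else 0)"
    and f: "test_fun f"
  shows "AE z in lborel. wsum {-c..c} f (fst z) (snd z) = ennreal (sq_norm f)"
proof -
  have nf: "nice f" using f by (simp add: test_fun_def)
  have box0: "fourier (box_density c) 0 = 1"
  proof -
    have "(LINT y|lborel. indicator {-c..c} y * ue (- (y * 0))) = (LINT y|lborel. complex_of_real (indicator {-c..c} y))"
      by (intro Bochner_Integration.integral_cong) (auto simp: indicator_def)
    also have "\<dots> = of_real (2 * c)" using c_pos by (simp only: integral_complex_of_real) simp
    finally show ?thesis using window_fourier(2)[of 0] c_pos by simp
  qed
  \<comment> \<open>The equation at \<open>\<eta> = 0\<close> fixes the sum over \<open>k\<close> of
    \<open>|fourier (g k) t|^2\<close> as \<open>covol / (2 * c)\<close>, so the integral of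
    \<open>hsum f\<close> is this constant times the energy of \<open>fourier f\<close>.\<close>
  have fin: "(\<integral>\<^sup>+x. hsum f x \<partial>lborel) < \<infinity>"
  proof -
    have "AE t in lborel. (\<integral>\<^sup>+k. ennreal ((cmod (fourier (corr f (g k)) t))\<^sup>2) \<partial>count_space K) = ennreal (covol / (2 * c)) * ennreal ((cmod (fourier f t))\<^sup>2)"
      using H[OF dual_0]
    proof eventually_elim
      case (elim t)
      have i: "integrable (count_space K) (\<lambda>k. Re (cnj (fourier (g k) t) * fourier (g k) t))"
        using elim by (intro integrable_Re) simp
      have r: "Re (cnj (fourier (g k) t) * fourier (g k) t) = (cmod (fourier (g k) t))\<^sup>2" for k
        by (simp only: complex_mult_cnj_cmod_Re mult.commute[of "cnj _"])
      have "of_real (2 * c / covol) * gram 0 t = 1" using elim by (simp add: box0)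
      then have "gram 0 t = of_real (covol / (2 * c))" using c_pos covol_pos by (simp add: field_simps)
      moreover have "Re (gram 0 t) = (LINT k|count_space K. Re (cnj (fourier (g k) t) * fourier (g k) t))"
        unfolding gram_def using elim by (subst integral_Re) simp_all
      ultimately have l: "(LINT k|count_space K. (cmod (fourier (g k) t))\<^sup>2) = covol / (2 * c)" unfolding r by simp
      have "(\<integral>\<^sup>+k. ennreal ((cmod (fourier (corr f (g k)) t))\<^sup>2) \<partial>count_space K) = (\<integral>\<^sup>+k. ennreal ((cmod (fourier f t))\<^sup>2) * ennreal ((cmod (fourier (g k) t))\<^sup>2) \<partial>count_space K)"
        by (rule nn_integral_cong) (simp add: fourier_corr niceD(1)[OF nf] g_int norm_mult power_mult_distrib ennreal_mult)
      also have "\<dots> = ennreal ((cmod (fourier f t))\<^sup>2) * (\<integral>\<^sup>+k. ennreal ((cmod (fourier (g k) t))\<^sup>2) \<partial>count_space K)"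
        by (rule nn_integral_cmult) simp
      also have "(\<integral>\<^sup>+k. ennreal ((cmod (fourier (g k) t))\<^sup>2) \<partial>count_space K) = ennreal (covol / (2 * c))"
        using i unfolding r by (subst nn_integral_eq_integral) (simp_all add: l)
      finally show ?case by (simp add: mult.commute)
    qed
    then have "(\<integral>\<^sup>+x. hsum f x \<partial>lborel) = (\<integral>\<^sup>+t. ennreal (covol / (2 * c)) * ennreal ((cmod (fourier f t))\<^sup>2) \<partial>lborel)"
      unfolding nn_integral_hsum[OF f] by (rule nn_integral_cong_AE)
    also have "\<dots> = ennreal (covol / (2 * c)) * (\<integral>\<^sup>+t. ennreal ((cmod (fourier f t))\<^sup>2) \<partial>lborel)"
      using fourier_measurable[OF niceD(1)[OF nf]] by (intro nn_integral_cmult) measurable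
    also have "\<dots> < \<infinity>"
      using plancherel(1)[OF nf] by (simp add: ennreal_mult_less_top integrable_iff_bounded)
    finally show ?thesis .
  qed
  define G where "G z = orbit_sum f z - of_real (sq_norm f)" for z
  interpret T: finite_measure torus by (rule finite_measure_torus)
  note oi = orbit_sum_integrable[OF f fin]
  \<comment> \<open>The constant \<open>sq_norm f\<close> has coefficient
    \<open>covol * sq_norm f\<close> at 0 and none elsewhere, which is what the Gramian equations
    give for \<open>orbit_sum f\<close>.\<close>
  have "zero_coeffs G"
    unfolding zero_coeffs_def
  proof (intro conjI ballI)
    show "integrable torus G" unfolding G_def using oi by simp
    fix \<eta> assume \<eta>: "\<eta> \<in> dual_lattice lat"
    have i1: "integrable torus (\<lambda>z. orbit_sum f z * ue (- (z \<bullet> \<eta>)))"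
      by (intro integrable_mult_ue oi) measurable
    have i2: "integrable torus (\<lambda>z. of_real (sq_norm f) * ue (- (z \<bullet> \<eta>)))"
      by (intro integrable_mult_ue T.integrable_const) measurable
    have "(LINT z|torus. orbit_sum f z * ue (- (z \<bullet> \<eta>))) = of_real covol * (LINT t|lborel. amp \<eta> * spec f (fst \<eta>) t)"
      unfolding orbit_sum_coeff[OF f fin \<eta>] integral_mult_right_zero using covol_pos by simp
    also have "(LINT t|lborel. amp \<eta> * spec f (fst \<eta>) t) = (LINT t|lborel. (if \<eta> = 0 then 1 else 0) * (fourier f t * cnj (fourier f t)))"
    proof (rule integral_cong_AE)
      show "AE t in lborel. amp \<eta> * spec f (fst \<eta>) t = (if \<eta> = 0 then 1 else 0) * (fourier f t * cnj (fourier f t))"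
        using H[OF \<eta>]
      proof eventually_elim
        case (elim t)
        have "amp \<eta> * spec f (fst \<eta>) t = fourier f t * cnj (fourier f (t - fst \<eta>)) * (amp \<eta> * gram (fst \<eta>) t)"
          by (simp add: spec_def)
        also have "\<dots> = (if \<eta> = 0 then 1 else 0) * (fourier f t * cnj (fourier f t))"
          using elim by (cases "\<eta> = 0") simp_all
        finally show ?case .
      qed
    qed (use integrable_spec[OF f fin] sq_norm_fourier(2)[OF f] in \<open>auto intro!: borel_measurable_times borel_measurable_integrable\<close>)
    also have "\<dots> = (if \<eta> = 0 then of_real (sq_norm f) else 0)"
      by (simp add: sq_norm_fourier(1)[OF f])
    finally have "(LINT z|torus. orbit_sum f z * ue (- (z \<bullet> \<eta>))) = (LINT z|torus. of_real (sq_norm f) * ue (- (z \<bullet> \<eta>)))"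
      by (simp add: torus_character[OF \<eta>])
    then show "(LINT z|torus. G z * ue (- (z \<bullet> \<eta>))) = 0"
      unfolding G_def left_diff_distrib by (subst Bochner_Integration.integral_diff[OF i1 i2]) simp
  qed
  then have "AE z in lborel. G z = 0"
    by (rule torus_unique) (simp add: G_def orbit_sum_periodic)
  then show ?thesis
    using AE_wsum_orbit_sum[OF f fin] by eventually_elim (auto simp: G_def)
qed

text \<open>The identity holds at points approaching the origin, and Fatou's lemma keeps the
  inequality in the limit. Translating \<open>f\<close> then reaches every base point
  \<open>(x, 0)\<close>.\<close>

lemma bessel_test:
  assumes H: "\<And>f. test_fun f \<Longrightarrow> AE z in lborel. wsum {-c..c} f (fst z) (snd z) = ennreal (sq_norm f)"
    and f: "test_fun f"
  shows "wsum {-c..c} f x 0 \<le> ennreal (sq_norm f)"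
proof -
  have 0: "wsum {-c..c} f 0 0 \<le> ennreal (sq_norm f)" if f: "test_fun f" for f
  proof -
    obtain Z where Z: "Z \<longlonglongrightarrow> 0" "\<And>n. wsum {-c..c} f (fst (Z n)) (snd (Z n)) = ennreal (sq_norm f)"
      using AE_tendsto_zero[OF H[OF f]] by blast
    show ?thesis
    proof (rule wsum_le_of_limit[of "\<lambda>_. f" "\<lambda>n. fst (Z n)" f "\<lambda>n. snd (Z n)" "\<lambda>_. ennreal (sq_norm f)"])
      fix k z assume k: "k \<in> K"
      have "(\<lambda>n. fst (Z n) + z) \<longlonglongrightarrow> 0 + z" using tendsto_fst[OF Z(1)] by (intro tendsto_intros) simp
      then show "(\<lambda>n. corr f (g k) (fst (Z n) + z)) \<longlonglongrightarrow> corr f (g k) z"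
        using isCont_tendsto_compose[OF isCont_corr_test[OF f k, of z]] by simp
    qed (use Z tendsto_snd[OF Z(1)] in auto)
  qed
  have fm: "f \<in> borel_measurable borel" using f niceD by (auto simp: test_fun_def)
  show ?thesis
    using 0[OF test_fun_translate[OF f, of x]] by (simp add: wsum_translate sq_norm_translate[OF fm])
qed

lemma corr_diff:
  assumes u: "test_fun u" and h: "test_fun h" and k: "k \<in> K"
  shows "corr (\<lambda>t. u t - h t) (g k) z = corr u (g k) z - corr h (g k) z"
proof -
  have i: "integrable lborel (\<lambda>y. f (y + z) * cnj (g k y))" if f: "test_fun f" for f
  proof -
    obtain M where M: "\<And>x. cmod (f x) \<le> M" using f niceD(4) unfolding test_fun_def by metis
    have [measurable]: "f \<in> borel_measurable borel" "g k \<in> borel_measurable borel"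
      using f niceD g_measurable[OF k] by (auto simp: test_fun_def)
    show ?thesis
    proof (rule Bochner_Integration.integrable_bound[OF integrable_mult_right[OF integrable_norm[OF g_int[OF k]], of M]])
      show "AE y in lborel. norm (f (y + z) * cnj (g k y)) \<le> norm (M * norm (g k y))"
        using M order_trans[OF norm_ge_zero M] by (intro AE_I2) (simp add: norm_mult abs_mult mult_right_mono)
    qed measurable
  qed
  show ?thesis
    unfolding corr_def by (simp add: left_diff_distrib Bochner_Integration.integral_diff[OF i[OF u] i[OF h]])
qed

section \<open>Correlations of square-integrable functions and the Bessel bound on them\<close>

lemma corr_L2_integrable:
  assumes [measurable]: "f \<in> borel_measurable borel" and fi: "integrable lborel (\<lambda>x. (cmod (f x))\<^sup>2)" and k: "k \<in> K"
  shows "integrable lborel (\<lambda>y. f (y + z) * cnj (g k y))"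
proof -
  have [measurable]: "g k \<in> borel_measurable borel" by (rule g_measurable[OF k])
  have "integrable lborel (\<lambda>x. (cmod (f (x + z)))\<^sup>2)"
    using integrable_lborel_shift[OF fi, of z] by (simp add: add.commute)
  then show ?thesis by (intro integrable_mult_cnj_L2 g_sq[OF k]) measurable
qed

text \<open>The inequality \<open>2 a b \<le> a^2 / e + e b^2\<close> stands in for Cauchy-Schwarz:
  a bound that tends to 0 with \<open>e\<close> is all that the approximation argument asks
  for.\<close>

lemma corr_L2_bound:
  assumes [measurable]: "f \<in> borel_measurable borel" and fi: "integrable lborel (\<lambda>x. (cmod (f x))\<^sup>2)" and k: "k \<in> K"
    and e: "e > 0" "sq_norm f \<le> e\<^sup>2"
  shows "cmod (corr f (g k) z) \<le> e * (1 + sq_norm (g k))"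
proof -
  have [measurable]: "g k \<in> borel_measurable borel" by (rule g_measurable[OF k])
  have fi': "integrable lborel (\<lambda>x. (cmod (f (x + z)))\<^sup>2)"
    using integrable_lborel_shift[OF fi, of z] by (simp add: add.commute)
  have "cmod (corr f (g k) z) \<le> (LINT y|lborel. cmod (f (y + z) * cnj (g k y)))"
    unfolding corr_def by (rule integral_norm_bound)
  also have "\<dots> \<le> (LINT y|lborel. (1 / e) * (cmod (f (y + z)))\<^sup>2 + e * (cmod (g k y))\<^sup>2)"
  proof (rule integral_mono)
    show "integrable lborel (\<lambda>y. cmod (f (y + z) * cnj (g k y)))"
      by (intro integrable_norm corr_L2_integrable fi k) measurable
    show "integrable lborel (\<lambda>y. (1 / e) * (cmod (f (y + z)))\<^sup>2 + e * (cmod (g k y))\<^sup>2)"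
      using fi' g_sq[OF k] by simp
    fix y
    have "0 \<le> (cmod (f (y + z)) - e * cmod (g k y))\<^sup>2 / e" using e by simp
    also have "\<dots> = (1 / e) * (cmod (f (y + z)))\<^sup>2 + e * (cmod (g k y))\<^sup>2 - 2 * (cmod (f (y + z)) * cmod (g k y))"
      using e by (simp add: power2_diff field_simps power2_eq_square)
    finally have "2 * (cmod (f (y + z)) * cmod (g k y)) \<le> (1 / e) * (cmod (f (y + z)))\<^sup>2 + e * (cmod (g k y))\<^sup>2" by simp
    moreover have "0 \<le> cmod (f (y + z)) * cmod (g k y)" by simp
    ultimately show "cmod (f (y + z) * cnj (g k y)) \<le> (1 / e) * (cmod (f (y + z)))\<^sup>2 + e * (cmod (g k y))\<^sup>2"
      unfolding norm_mult complex_mod_cnj by linarith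
  qed
  also have "\<dots> = (1 / e) * sq_norm (\<lambda>y. f (y + z)) + e * sq_norm (g k)"
    unfolding sq_norm_def using fi' g_sq[OF k] by simp
  also have "\<dots> \<le> (1 / e) * e\<^sup>2 + e * sq_norm (g k)"
    using e by (intro add_right_mono mult_left_mono) (auto simp: sq_norm_translate)
  also have "\<dots> = e * (1 + sq_norm (g k))" using e by (simp add: power2_eq_square field_simps)
  finally show ?thesis .
qed

lemma sq_norm_perturb:
  fixes f u :: "'a \<Rightarrow> complex"
  assumes d: "d > 0" and u: "integrable lborel (\<lambda>x. (cmod (u x))\<^sup>2)" and h: "integrable lborel (\<lambda>x. (cmod (f x - u x))\<^sup>2)"
    and f: "integrable lborel (\<lambda>x. (cmod (f x))\<^sup>2)"
  shows "sq_norm f \<le> (1 + d) * sq_norm u + (1 + 1 / d) * sq_norm (\<lambda>x. f x - u x)"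
proof -
  have "sq_norm f \<le> (LINT x|lborel. (1 + d) * (cmod (u x))\<^sup>2 + (1 + 1 / d) * (cmod (f x - u x))\<^sup>2)"
    unfolding sq_norm_def
  proof (rule integral_mono[OF f])
    show "integrable lborel (\<lambda>x. (1 + d) * (cmod (u x))\<^sup>2 + (1 + 1 / d) * (cmod (f x - u x))\<^sup>2)"
      by (intro Bochner_Integration.integrable_add integrable_mult_right u h)
    show "(cmod (f x))\<^sup>2 \<le> (1 + d) * (cmod (u x))\<^sup>2 + (1 + 1 / d) * (cmod (f x - u x))\<^sup>2" for x
      using cmod_add_square_le[OF d, of "u x" "f x - u x"] by simp
  qed
  also have "\<dots> = (1 + d) * sq_norm u + (1 + 1 / d) * sq_norm (\<lambda>x. f x - u x)"
    unfolding sq_norm_def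
    by (subst Bochner_Integration.integral_add) (simp_all only: integral_mult_right_zero integrable_mult_right u h)
  finally show ?thesis .
qed

lemma L2_approx_sequence:
  fixes f :: "'a \<Rightarrow> complex"
  assumes fm: "f \<in> borel_measurable borel" and fi: "integrable lborel (\<lambda>x. (cmod (f x))\<^sup>2)"
  obtains u where "\<And>n::nat. test_fun (u n)" "\<And>n. sq_norm (\<lambda>x. u n x - f x) \<le> (inverse (real (Suc n)))\<^sup>2"
    "\<And>n. integrable lborel (\<lambda>x. (cmod (u n x - f x))\<^sup>2)"
proof -
  have "\<exists>u. test_fun u \<and> sq_norm (\<lambda>x. u x - f x) \<le> (inverse (real (Suc n)))\<^sup>2 \<and> integrable lborel (\<lambda>x. (cmod (u x - f x))\<^sup>2)" for n
  proof -
    have "(inverse (real (Suc n)))\<^sup>2 > 0" by simp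
    from L2_dense[OF fm fi this] obtain u where "continuous_on UNIV u" "nice u"
      "(LINT x|lborel. (cmod (u x - f x))\<^sup>2) < (inverse (real (Suc n)))\<^sup>2" "integrable lborel (\<lambda>x. (cmod (u x - f x))\<^sup>2)" by blast
    then show ?thesis by (intro exI[of _ u]) (auto simp: test_fun_def sq_norm_def)
  qed
  then show ?thesis using that by metis
qed

text \<open>Fatou's lemma along approximating test functions; the correlations converge pointwise
  because \<open>g k\<close> is square integrable. The factor \<open>1 + d\<close> absorbs the
  difference between \<open>sq_norm (u n)\<close> and \<open>sq_norm f\<close>.\<close>

lemma bessel_L2:
  assumes H: "\<And>f. test_fun f \<Longrightarrow> wsum {-c..c} f 0 0 \<le> ennreal (sq_norm f)"
    and fm: "f \<in> borel_measurable borel" and fi: "integrable lborel (\<lambda>x. (cmod (f x))\<^sup>2)"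
  shows "wsum {-c..c} f 0 0 \<le> ennreal (sq_norm f)"
proof (rule le_of_perturbed)
  fix d :: real assume d: "d > 0"
  let ?e = "\<lambda>n. inverse (real (Suc n))"
  obtain u where u: "\<And>n. test_fun (u n)" "\<And>n. sq_norm (\<lambda>x. u n x - f x) \<le> (?e n)\<^sup>2"
    "\<And>n. integrable lborel (\<lambda>x. (cmod (u n x - f x))\<^sup>2)"
    using L2_approx_sequence[OF fm fi] by blast
  have um: "u n \<in> borel_measurable borel" for n using u(1)[of n] niceD by (auto simp: test_fun_def)
  let ?b = "\<lambda>n. ennreal ((1 + d) * sq_norm f + (1 + 1 / d) * (?e n)\<^sup>2)"
  have "wsum {-c..c} f 0 0 \<le> ennreal ((1 + d) * sq_norm f + (1 + 1 / d) * 0\<^sup>2)"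
  proof (rule wsum_le_of_limit[of u "\<lambda>_. 0" f "\<lambda>_. 0" ?b])
    show "?b \<longlonglongrightarrow> ennreal ((1 + d) * sq_norm f + (1 + 1 / d) * 0\<^sup>2)"
      by (intro tendsto_ennrealI tendsto_add tendsto_mult tendsto_const tendsto_power LIMSEQ_inverse_real_of_nat)
    show "wsum {-c..c} (u n) 0 0 \<le> ?b n" for n
    proof -
      have "sq_norm (u n) \<le> (1 + d) * sq_norm f + (1 + 1 / d) * sq_norm (\<lambda>x. u n x - f x)"
        by (rule sq_norm_perturb[OF d fi u(3) test_fun_square_integrable[OF u(1)]])
      also have "\<dots> \<le> (1 + d) * sq_norm f + (1 + 1 / d) * (?e n)\<^sup>2"
        using d u(2)[of n] by (intro add_left_mono mult_left_mono) auto
      finally show ?thesis using H[OF u(1)[of n]] by (meson ennreal_leI order_trans)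
    qed
    fix k z assume k: "k \<in> K"
    have b: "cmod (corr (u n) (g k) z - corr f (g k) z) \<le> ?e n * (1 + sq_norm (g k))" for n
    proof -
      have i1: "integrable lborel (\<lambda>y. u n (y + z) * cnj (g k y))" "integrable lborel (\<lambda>y. f (y + z) * cnj (g k y))"
        using corr_L2_integrable[OF um test_fun_square_integrable[OF u(1)] k] corr_L2_integrable[OF fm fi k] by auto
      have "corr (u n) (g k) z - corr f (g k) z = corr (\<lambda>x. u n x - f x) (g k) z"
        unfolding corr_def by (simp add: left_diff_distrib Bochner_Integration.integral_diff[OF i1])
      then show ?thesis
        using corr_L2_bound[OF _ u(3)[of n] k _ u(2)[of n], of z] um[of n] fm by simp
    qed
    have "(\<lambda>n. ?e n * (1 + sq_norm (g k))) \<longlonglongrightarrow> 0 * (1 + sq_norm (g k))"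
      by (intro tendsto_mult tendsto_const LIMSEQ_inverse_real_of_nat)
    then have "(\<lambda>n. corr (u n) (g k) z - corr f (g k) z) \<longlonglongrightarrow> 0"
      by (intro Lim_null_comparison[OF always_eventually[OF allI[OF b]]]) simp
    then show "(\<lambda>n. corr (u n) (g k) (0 + z)) \<longlonglongrightarrow> corr f (g k) z" by (simp add: LIM_zero_iff)
  qed simp
  then show "wsum {-c..c} f 0 0 \<le> ennreal (1 + d) * ennreal (sq_norm f)"
    using d by (simp add: ennreal_mult)
qed

section \<open>The lower frame bound and the equivalence\<close>

lemma wsum_enlarge: "\<bar>y\<bar> \<le> 1 \<Longrightarrow> wsum {-c..c} f x y \<le> wsum {-(c + 1)..c + 1} f x 0"
  unfolding wsum_def wterm_def
  by (intro nn_integral_mono mult_left_mono) (auto simp: indicator_def)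

text \<open>Near the origin there are points where the value is \<open>sq_norm f\<close>. The first
  coordinate of such a point is absorbed into \<open>f\<close>, which changes it by
  \<open>h n\<close>, small in \<open>L^2\<close> by continuity of translation; the Bessel bound
  makes the frame sum of \<open>h n\<close> small. What remains has base point 0 and converges in
  the second coordinate because 0 is \<open>good\<close>.\<close>

lemma tight_lower_test:
  assumes H: "\<And>f. test_fun f \<Longrightarrow> AE z in lborel. wsum {-c..c} f (fst z) (snd z) = ennreal (sq_norm f)"
    and f: "test_fun f"
  shows "ennreal (sq_norm f) \<le> wsum {-c..c} f 0 0"
proof (rule le_of_perturbed)
  fix d :: real assume d: "d > 0"
  \<comment> \<open>The window enlarged by 1 contains all windows shifted by
    \<open>snd (Z n)\<close> once these are below 1, so one constant \<open>m\<close> serves all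
    large \<open>n\<close>.\<close>
  obtain m :: nat where m: "\<And>f C x. (\<And>x. wsum {-c..c} f x 0 \<le> C) \<Longrightarrow> wsum {-(c + 1)..c + 1} f x 0 \<le> of_nat m * C"
    using wsum_compact[OF compact_Icc] by blast
  obtain Z where Z: "Z \<longlonglongrightarrow> 0" "\<And>n. wsum {-c..c} f (fst (Z n)) (snd (Z n)) = ennreal (sq_norm f)"
    using AE_tendsto_zero[OF H[OF f]] by blast
  have X: "(\<lambda>n. fst (Z n)) \<longlonglongrightarrow> 0" and Y: "(\<lambda>n. snd (Z n)) \<longlonglongrightarrow> 0"
    using tendsto_fst[OF Z(1)] tendsto_snd[OF Z(1)] by simp_all
  define h where "h n t = f (t + fst (Z n)) - f t" for n t
  have th: "test_fun (h n)" for n unfolding h_def by (intro test_fun_diff test_fun_translate f)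
  let ?b = "\<lambda>n. ennreal (1 + d) * wsum {-c..c} f 0 (snd (Z n)) + ennreal (1 + 1 / d) * (of_nat m * ennreal (sq_norm (h n)))"
  show "ennreal (sq_norm f) \<le> ennreal (1 + d) * wsum {-c..c} f 0 0"
  proof (rule LIMSEQ_le_const)
    have 1: "(\<lambda>n. wsum {-c..c} f 0 (snd (Z n))) \<longlonglongrightarrow> wsum {-c..c} f 0 0"
      by (rule tendsto_wsum[OF bessel_test[OF H f] Y good_0])
    have "(\<lambda>n. ennreal (sq_norm (h n))) \<longlonglongrightarrow> ennreal 0"
      unfolding h_def by (intro tendsto_ennrealI tendsto_sq_norm_translate[OF f X])
    then have "(\<lambda>n. ennreal (1 + 1 / d) * (of_nat m * ennreal (sq_norm (h n)))) \<longlonglongrightarrow> ennreal (1 + 1 / d) * (of_nat m * ennreal 0)"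
      by (intro ennreal_tendsto_cmult) (auto simp: of_nat_less_top)
    from tendsto_add[OF ennreal_tendsto_cmult[OF _ 1, of "ennreal (1 + d)"] this]
    show "?b \<longlonglongrightarrow> ennreal (1 + d) * wsum {-c..c} f 0 0" by simp
    have "eventually (\<lambda>n. \<bar>snd (Z n)\<bar> < 1) sequentially"
      using tendsto_norm[OF Y] by (intro order_tendstoD(2)[of _ 0]) simp_all
    then obtain N where N: "\<And>n. n \<ge> N \<Longrightarrow> \<bar>snd (Z n)\<bar> < 1" by (auto simp: eventually_sequentially)
    show "\<exists>N. \<forall>n\<ge>N. ennreal (sq_norm f) \<le> ?b n"
    proof (intro exI[of _ N] allI impI)
      fix n assume n: "n \<ge> N"
      let ?t = "\<lambda>t. f (t + fst (Z n))"
      have "ennreal (sq_norm f) = wsum {-c..c} ?t 0 (snd (Z n))"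
        using Z(2)[of n] by (simp add: wsum_translate)
      also have "\<dots> \<le> ennreal (1 + d) * wsum {-c..c} f 0 (snd (Z n)) + ennreal (1 + 1 / d) * wsum {-c..c} (h n) 0 (snd (Z n))"
      proof (rule wsum_perturb[OF _ d])
        fix k z assume k: "k \<in> K"
        show "corr ?t (g k) z = corr f (g k) z + corr (h n) (g k) z"
          unfolding h_def by (simp add: corr_diff[OF test_fun_translate[OF f] f k])
      qed
      also have "wsum {-c..c} (h n) 0 (snd (Z n)) \<le> wsum {-(c + 1)..c + 1} (h n) 0 0"
        using N[OF n] by (intro wsum_enlarge) simp
      also have "\<dots> \<le> of_nat m * ennreal (sq_norm (h n))"
        by (rule m[OF bessel_test[OF H th]])
      finally show "ennreal (sq_norm f) \<le> ?b n" by (simp add: add_left_mono mult_left_mono)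
    qed
  qed
qed

text \<open>For the lower bound \<open>f\<close> is compared with a test function twice, once in the
  norm and once in the frame sum; the error in the sum is controlled by the Bessel bound just
  extended to \<open>L^2\<close>.\<close>

lemma tight_L2:
  assumes H: "\<And>f. test_fun f \<Longrightarrow> wsum {-c..c} f 0 0 = ennreal (sq_norm f)"
    and fm: "f \<in> borel_measurable borel" and fi: "integrable lborel (\<lambda>x. (cmod (f x))\<^sup>2)"
  shows "wsum {-c..c} f 0 0 = ennreal (sq_norm f)"
proof (rule antisym)
  have bes: "wsum {-c..c} f 0 0 \<le> ennreal (sq_norm f)"
    if "f \<in> borel_measurable borel" "integrable lborel (\<lambda>x. (cmod (f x))\<^sup>2)" for f
    by (rule bessel_L2[OF _ that]) (simp add: H)
  show "wsum {-c..c} f 0 0 \<le> ennreal (sq_norm f)" by (rule bes[OF fm fi])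
  let ?e = "\<lambda>n. inverse (real (Suc n))"
  obtain u where u: "\<And>n. test_fun (u n)" "\<And>n. sq_norm (\<lambda>x. u n x - f x) \<le> (?e n)\<^sup>2"
    "\<And>n. integrable lborel (\<lambda>x. (cmod (u n x - f x))\<^sup>2)"
    using L2_approx_sequence[OF fm fi] by blast
  have um: "u n \<in> borel_measurable borel" for n using u(1)[of n] niceD by (auto simp: test_fun_def)
  let ?W = "wsum {-c..c} f 0 0"
  show "ennreal (sq_norm f) \<le> ?W"
  proof (rule le_of_perturbed)
    fix d' :: real assume d': "d' > 0"
    \<comment> \<open>Each of the two comparisons costs a factor \<open>1 + d\<close>, and their
      product has to be \<open>1 + d'\<close>.\<close>
    define d where "d = sqrt (1 + d') - 1"
    have d: "d > 0" "(1 + d) * (1 + d) = 1 + d'" using d' by (auto simp: d_def real_sqrt_gt_1_iff)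
    let ?b = "\<lambda>n. ennreal (1 + d) * (ennreal (1 + d) * ?W + ennreal (1 + 1 / d) * ennreal ((?e n)\<^sup>2)) + ennreal (1 + 1 / d) * ennreal ((?e n)\<^sup>2)"
    have le: "ennreal (sq_norm f) \<le> ?b n" for n
    proof -
      let ?h = "\<lambda>x. u n x - f x"
      have hm: "?h \<in> borel_measurable borel" using um[of n] fm by measurable
      have fu: "(\<lambda>x. (cmod (f x - u n x))\<^sup>2) = (\<lambda>x. (cmod (?h x))\<^sup>2)" by (simp add: norm_minus_commute)
      have "sq_norm f \<le> (1 + d) * sq_norm (u n) + (1 + 1 / d) * sq_norm (\<lambda>x. f x - u n x)"
        by (rule sq_norm_perturb[OF d(1) test_fun_square_integrable[OF u(1)] _ fi]) (simp add: fu u(3))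
      also have "sq_norm (\<lambda>x. f x - u n x) = sq_norm ?h" by (simp only: sq_norm_def fu)
      finally have "ennreal (sq_norm f) \<le> ennreal (1 + d) * ennreal (sq_norm (u n)) + ennreal (1 + 1 / d) * ennreal (sq_norm ?h)"
        using d(1) by (simp add: ennreal_leI flip: ennreal_mult ennreal_plus)
      also have "ennreal (sq_norm (u n)) = wsum {-c..c} (u n) 0 0" by (rule H[OF u(1), symmetric])
      also have "wsum {-c..c} (u n) 0 0 \<le> ennreal (1 + d) * ?W + ennreal (1 + 1 / d) * wsum {-c..c} ?h 0 0"
      proof (rule wsum_perturb[OF _ d(1)])
        fix k z assume k: "k \<in> K"
        have i1: "integrable lborel (\<lambda>y. u n (y + z) * cnj (g k y))" "integrable lborel (\<lambda>y. f (y + z) * cnj (g k y))"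
          using corr_L2_integrable[OF um test_fun_square_integrable[OF u(1)] k] corr_L2_integrable[OF fm fi k] by auto
        show "corr (u n) (g k) z = corr f (g k) z + corr ?h (g k) z"
          unfolding corr_def by (simp add: left_diff_distrib Bochner_Integration.integral_diff[OF i1])
      qed
      also have "wsum {-c..c} ?h 0 0 \<le> ennreal (sq_norm ?h)" by (rule bes[OF hm u(3)])
      also have "ennreal (sq_norm ?h) \<le> ennreal ((?e n)\<^sup>2)" by (rule ennreal_leI[OF u(2)])
      finally show ?thesis by (simp add: add_mono mult_left_mono)
    qed
    have e0: "(\<lambda>n. ennreal ((?e n)\<^sup>2)) \<longlonglongrightarrow> ennreal (0\<^sup>2)"
      by (intro tendsto_ennrealI tendsto_power LIMSEQ_inverse_real_of_nat)
    have "?b \<longlonglongrightarrow> ennreal (1 + d) * (ennreal (1 + d) * ?W + ennreal (1 + 1 / d) * ennreal (0\<^sup>2)) + ennreal (1 + 1 / d) * ennreal (0\<^sup>2)"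
      by (intro tendsto_add ennreal_tendsto_cmult tendsto_const e0) auto
    then have "ennreal (sq_norm f) \<le> ennreal (1 + d) * (ennreal (1 + d) * ?W + ennreal (1 + 1 / d) * ennreal (0\<^sup>2)) + ennreal (1 + 1 / d) * ennreal (0\<^sup>2)"
      by (rule LIMSEQ_le_const) (use le in blast)
    also have "\<dots> = (ennreal (1 + d) * ennreal (1 + d)) * ?W" by (simp add: mult.assoc)
    also have "ennreal (1 + d) * ennreal (1 + d) = ennreal (1 + d')"
      using d(1) by (subst ennreal_mult[symmetric]) (simp_all add: d(2))
    finally show "ennreal (sq_norm f) \<le> ennreal (1 + d') * ?W" .
  qed
qed

theorem tight_frame_iff:
  "(\<forall>f. f \<in> borel_measurable borel \<longrightarrow> integrable lborel (\<lambda>x. (cmod (f x))\<^sup>2) \<longrightarrow> wsum {-c..c} f 0 0 = ennreal (sq_norm f))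
   \<longleftrightarrow> (\<forall>\<eta>\<in>dual_lattice lat. AE t in lborel. integrable (count_space K) (\<lambda>k. cnj (fourier (g k) t) * fourier (g k) (t - fst \<eta>))
      \<and> amp \<eta> * gram (fst \<eta>) t = (if \<eta> = 0 then 1 else 0))" (is "?L \<longleftrightarrow> ?R")
proof
  assume L: ?L
  have "wsum {-c..c} f 0 0 = ennreal (sq_norm f)" if f: "test_fun f" for f
    using L test_fun_square_integrable[OF f] f niceD(2) unfolding test_fun_def by blast
  then show ?R by (intro ballI tight_imp_gram)
next
  assume ?R
  then have AE: "AE z in lborel. wsum {-c..c} f (fst z) (snd z) = ennreal (sq_norm f)" if "test_fun f" for f
    by (intro wsum_tight_AE that) blast
  have "wsum {-c..c} f 0 0 = ennreal (sq_norm f)" if "test_fun f" for f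
    by (intro antisym bessel_test[OF AE that] tight_lower_test[OF AE that])
  then show ?L by (blast intro: tight_L2)
qed

end

section \<open>Passing to Borel representatives\<close>

lemma ex_borel_version:
  fixes f :: "'a::euclidean_space \<Rightarrow> complex"
  assumes f: "f \<in> borel_measurable lebesgue"
  obtains f' where "f' \<in> borel_measurable borel" "AE x in lborel. f x = f' x"
proof -
  have "(\<lambda>x. Re (f x)) \<in> borel_measurable lebesgue" "(\<lambda>x. Im (f x)) \<in> borel_measurable lebesgue"
    using f by auto
  then obtain u v where u: "u \<in> borel_measurable lborel" "AE x in lborel. Re (f x) = u x"
    and v: "v \<in> borel_measurable lborel" "AE x in lborel. Im (f x) = v x"
    using completion_ex_borel_measurable_real by metis
  have "AE x in lborel. f x = Complex (u x) (v x)"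
    using u(2) v(2) by eventually_elim (simp add: complex_eq_iff)
  moreover have "(\<lambda>x. Complex (u x) (v x)) \<in> borel_measurable borel"
    using u(1) v(1) by (simp add: borel_measurable_complex_iff)
  ultimately show ?thesis by (rule that[rotated])
qed

lemma
  fixes f :: "'a::euclidean_space \<Rightarrow> 'b::{banach, second_countable_topology}"
  assumes f: "f \<in> borel_measurable lebesgue" and f': "f' \<in> borel_measurable borel"
    and eq: "AE x in lborel. f x = f' x"
  shows integral_borel_version: "(LINT x|lebesgue. f x) = (LINT x|lborel. f' x)"
    and integrable_borel_version: "integrable lebesgue f \<longleftrightarrow> integrable lborel f'"
proof -
  have m: "f' \<in> borel_measurable lborel" using f' by simp
  have m': "f' \<in> borel_measurable lebesgue" by (rule measurable_completion[OF m])
  show "(LINT x|lebesgue. f x) = (LINT x|lborel. f' x)"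
    unfolding integral_completion[OF m, symmetric] by (rule integral_cong_AE[OF f m' AE_completion[OF eq]])
  show "integrable lebesgue f \<longleftrightarrow> integrable lborel f'"
    unfolding integrable_completion[OF m, symmetric] by (rule integrable_cong_AE[OF f m' AE_completion[OF eq]])
qed

lemma fourier_borel_version:
  fixes f :: "'a::euclidean_space \<Rightarrow> complex"
  assumes [measurable]: "f \<in> borel_measurable lebesgue" "f' \<in> borel_measurable borel"
    and eq: "AE x in lborel. f x = f' x"
  shows "fourier f = fourier f'"
proof
  fix w :: 'a
  have "(\<lambda>t. ue (- (t \<bullet> w))) \<in> borel_measurable lborel" by measurable
  then have [measurable]: "(\<lambda>t. ue (- (t \<bullet> w))) \<in> borel_measurable lebesgue" by (rule measurable_completion)
  have "fourier f w = (LINT t|lborel. f' t * ue (- (t \<bullet> w)))"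
    unfolding fourier_ue by (rule integral_borel_version) (measurable, use eq in \<open>auto elim: eventually_mono\<close>)
  then show "fourier f w = fourier f' w" by (simp add: fourier_lborel)
qed

lemma lebesgue_measurable_translate:
  fixes g :: "'a::euclidean_space \<Rightarrow> complex"
  assumes "g \<in> borel_measurable lebesgue"
  shows "(\<lambda>t. g (t - l)) \<in> borel_measurable lebesgue"
proof -
  have "(\<lambda>x. - l + (\<Sum>j\<in>Basis. (1 * (x \<bullet> j)) *\<^sub>R j)) \<in> lebesgue \<rightarrow>\<^sub>M lebesgue"
    by (rule lebesgue_affine_measurable) simp
  then have "(\<lambda>x. x - l) \<in> lebesgue \<rightarrow>\<^sub>M lebesgue" by (simp add: euclidean_representation)
  from measurable_compose[OF this assms] show ?thesis .
qed

lemma L2_inner_translate_corr: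
  fixes f g :: "'a::euclidean_space \<Rightarrow> complex"
  assumes f: "f \<in> borel_measurable lebesgue" and f' [measurable]: "f' \<in> borel_measurable borel" and ff': "AE x in lborel. f x = f' x"
    and g: "g \<in> borel_measurable lebesgue" and g' [measurable]: "g' \<in> borel_measurable borel" and gg': "AE x in lborel. g x = g' x"
  shows "L2_inner f (translate l g) = corr f' g' l"
proof -
  have "AE x in lborel. g (- l + x) = g' (- l + x)" by (rule AE_lborel_shift[OF gg'])
  then have eq: "AE x in lborel. f x * cnj (g (x - l)) = f' x * cnj (g' (x - l))"
    using ff' by eventually_elim simp
  have gm: "(\<lambda>t. g (t - l)) \<in> borel_measurable lebesgue" by (rule lebesgue_measurable_translate[OF g])
  have "L2_inner f (translate l g) = (LINT x|lborel. f' x * cnj (g' (x - l)))"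
    unfolding L2_inner_def translate_def
    by (rule integral_borel_version[OF borel_measurable_times[OF f cnj_measurable[OF gm]] _ eq]) measurable
  also have "\<dots> = (LINT x|lborel. f' (l + x) * cnj (g' (l + x - l)))"
    by (rule integral_lborel_shift[symmetric]) measurable
  finally show ?thesis by (simp add: corr_def add.commute)
qed

lemma L2_space_borel_version:
  fixes f :: "'a::euclidean_space \<Rightarrow> complex"
  assumes f: "f \<in> borel_measurable lebesgue" and f': "f' \<in> borel_measurable borel" and eq: "AE x in lborel. f x = f' x"
  shows "integrable lebesgue (\<lambda>t. (cmod (f t))\<^sup>2) \<longleftrightarrow> integrable lborel (\<lambda>t. (cmod (f' t))\<^sup>2)"
    and "(L2_norm f)\<^sup>2 = sq_norm f'"
proof -
  have m: "(\<lambda>t. (cmod (f t))\<^sup>2) \<in> borel_measurable lebesgue" using f by simp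
  have m': "(\<lambda>t. (cmod (f' t))\<^sup>2) \<in> borel_measurable borel" using f' by measurable
  have e: "AE x in lborel. (cmod (f x))\<^sup>2 = (cmod (f' x))\<^sup>2" using eq by eventually_elim simp
  show "integrable lebesgue (\<lambda>t. (cmod (f t))\<^sup>2) \<longleftrightarrow> integrable lborel (\<lambda>t. (cmod (f' t))\<^sup>2)"
    by (rule integrable_borel_version[OF m m' e])
  show "(L2_norm f)\<^sup>2 = sq_norm f'"
    using integral_borel_version[OF m m' e] sq_norm_nonneg[of f'] by (simp add: L2_norm_def sq_norm_def)
qed

section \<open>The amalgam space: integrable and square-integrable generators\<close>

lemma countable_integer_points: "countable (integer_points :: (real^'m) set)"
proof -
  have "(integer_points :: (real^'m) set) \<subseteq> range (\<lambda>n :: int^'m. \<chi> i. of_int (n $ i))"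
  proof
    fix k :: "real^'m" assume "k \<in> integer_points"
    then have "k = (\<chi> i. of_int ((\<chi> i. \<lfloor>k $ i\<rfloor>) $ i))" by (auto simp: integer_points_def vec_eq_iff elim!: Ints_cases)
    then show "k \<in> range (\<lambda>n :: int^'m. \<chi> i. of_int (n $ i))" by blast
  qed
  then show ?thesis by (rule countable_subset) (rule countable_image, rule countableI_type)
qed

lemma integer_cubes_cover: "\<exists>k\<in>integer_points. t \<in> cbox k (k + vec 1)" for t :: "real^'m"
proof (rule bexI[of _ "\<chi> i. of_int \<lfloor>t $ i\<rfloor>"])
  have "t $ i \<le> of_int \<lfloor>t $ i\<rfloor> + 1" for i by linarith
  then show "t \<in> cbox (\<chi> i. of_int \<lfloor>t $ i\<rfloor>) ((\<chi> i. of_int \<lfloor>t $ i\<rfloor>) + vec 1)" by (simp add: mem_box_cart)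
qed (simp add: integer_points_def)

lemma emeasure_unit_cube: "emeasure lborel (cbox k (k + vec 1 :: real^'m)) = 1"
  using emeasure_lborel_cbox_finite[of k "k + vec 1"] content_cbox_cart[of k "k + vec 1"]
  by (subst emeasure_eq_ennreal_measure) (auto simp: interval_ne_empty_cart)

text \<open>The closed cubes overlap on their faces, so they give a cover rather than a partition;
  an upper bound is enough.\<close>

lemma nn_integral_le_cubes:
  fixes u :: "real^'m \<Rightarrow> ennreal"
  assumes [measurable]: "u \<in> borel_measurable borel"
  shows "(\<integral>\<^sup>+t. u t \<partial>lborel) \<le> (\<integral>\<^sup>+k. (\<integral>\<^sup>+t. u t * indicator (cbox k (k + vec 1)) t \<partial>lborel) \<partial>count_space integer_points)"
proof -
  interpret I: sigma_finite_measure "count_space integer_points :: (real^'m) measure"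
    by (rule sigma_finite_measure_count_space_countable[OF countable_integer_points])
  interpret P: pair_sigma_finite "count_space integer_points :: (real^'m) measure" "lborel :: (real^'m) measure" ..
  have "(\<integral>\<^sup>+t. u t \<partial>lborel) \<le> (\<integral>\<^sup>+t. (\<integral>\<^sup>+k. u t * indicator (cbox k (k + vec 1)) t \<partial>count_space integer_points) \<partial>lborel)"
  proof (rule nn_integral_mono)
    fix t :: "real^'m"
    obtain k where k: "k \<in> integer_points" "t \<in> cbox k (k + vec 1)" using integer_cubes_cover by blast
    have "u t = (\<integral>\<^sup>+j. u t * indicator {k} j \<partial>count_space integer_points)"
      using k(1) by (simp add: nn_integral_cmult)
    also have "\<dots> \<le> (\<integral>\<^sup>+j. u t * indicator (cbox j (j + vec 1)) t \<partial>count_space integer_points)"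
      using k(2) by (intro nn_integral_mono mult_left_mono) (auto simp: indicator_def)
    finally show "u t \<le> \<dots>" .
  qed
  also have "\<dots> = (\<integral>\<^sup>+k. (\<integral>\<^sup>+t. u t * indicator (cbox k (k + vec 1)) t \<partial>lborel) \<partial>count_space integer_points)"
    by (rule P.Fubini') (rule measurable_pair_measure_countable1[OF countable_integer_points], simp)
  finally show ?thesis .
qed

lemma ennreal_power2_le_imp_le:
  assumes "x\<^sup>2 \<le> (ennreal r)\<^sup>2" "r \<ge> 0"
  shows "x \<le> ennreal r"
proof (cases x)
  case (real s)
  then have "s\<^sup>2 \<le> r\<^sup>2" using assms by (simp add: ennreal_power)
  then have "s \<le> r" using assms(2) by (rule power2_le_imp_le)
  then show ?thesis using real by (simp add: ennreal_leI)
next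
  case top
  then show ?thesis using assms by (simp add: ennreal_power top_unique)
qed

text \<open>A unit cube has volume one, so by Cauchy-Schwarz the local \<open>L^1\<close> norm is at
  most the local \<open>L^2\<close> norm; summing gives integrability. The local \<open>L^2\<close>
  norms are summable, hence bounded by their sum \<open>S\<close> and square summable, which gives
  square integrability.\<close>

lemma amalgam_space_borel_version:
  fixes g :: "real^'m \<Rightarrow> complex"
  assumes g: "g \<in> amalgam_space 2 1" and g' [measurable]: "g' \<in> borel_measurable borel" and eq: "AE x in lborel. g x = g' x"
  shows "integrable lborel g'" "integrable lborel (\<lambda>t. (cmod (g' t))\<^sup>2)"
proof -
  define Q where "Q k = cbox k (k + vec 1 :: real^'m)" for k
  define I where "I k = (LINT t|lborel. indicator (Q k) t *\<^sub>R (cmod (g' t))\<^sup>2)" for k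
  have [measurable]: "Q k \<in> sets borel" "Q k \<in> sets lebesgue" for k by (simp_all add: Q_def)
  have gm: "g \<in> borel_measurable lebesgue" using g by (simp add: amalgam_space_def)
  have m: "(\<lambda>t. indicator (Q k) t *\<^sub>R (cmod (g t)) powr 2) \<in> borel_measurable lebesgue" for k
  proof -
    have "(\<lambda>z. cmod z powr 2) \<in> borel_measurable borel" by measurable
    from measurable_compose[OF gm this] show ?thesis by (intro borel_measurable_scaleR borel_measurable_indicator) simp_all
  qed
  have m': "(\<lambda>t. indicator (Q k) t *\<^sub>R (cmod (g' t))\<^sup>2) \<in> borel_measurable borel" for k
    by measurable
  have e: "AE t in lborel. indicator (Q k) t *\<^sub>R (cmod (g t)) powr 2 = indicator (Q k) t *\<^sub>R (cmod (g' t))\<^sup>2" for k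
    using eq by eventually_elim simp
  have int: "integrable lborel (\<lambda>t. indicator (Q k) t *\<^sub>R (cmod (g' t))\<^sup>2)" if "k \<in> integer_points" for k
    using g that integrable_borel_version[OF m m' e, of k] unfolding amalgam_space_def set_integrable_def Q_def by auto
  have I0: "I k \<ge> 0" for k unfolding I_def by (intro integral_nonneg_AE) auto
  have loc: "local_Lp_norm 2 g k powr 1 = sqrt (I k)" for k
    using integral_borel_version[OF m m' e, of k] I0[of k]
    by (simp add: local_Lp_norm_def Q_def[simplified, symmetric] I_def set_lebesgue_integral_def powr_half_sqrt)
  have sum: "(\<lambda>k. sqrt (I k)) summable_on integer_points"
    using g loc unfolding amalgam_space_def by simp
  then have "(\<lambda>k. norm (sqrt (I k))) summable_on integer_points" using I0 by simp
  then have ic: "integrable (count_space integer_points) (\<lambda>k. sqrt (I k))"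
    by (simp only: abs_summable_equivalent Infinite_Set_Sum.abs_summable_on_def)
  have fin: "(\<integral>\<^sup>+k. ennreal (sqrt (I k)) \<partial>count_space integer_points) < \<infinity>"
    using ic I0 by (simp add: integrable_iff_bounded)
  have sq: "(\<integral>\<^sup>+t. ennreal ((cmod (g' t))\<^sup>2) * indicator (Q k) t \<partial>lborel) = ennreal (I k)" if "k \<in> integer_points" for k
    unfolding I_def by (subst nn_integral_eq_integral[OF int[OF that], symmetric])
      (auto intro!: nn_integral_cong simp: indicator_def)
  have one: "(\<integral>\<^sup>+t. ennreal (cmod (g' t)) * indicator (Q k) t \<partial>lborel) \<le> ennreal (sqrt (I k))" if k: "k \<in> integer_points" for k
  proof -
    have "(\<integral>\<^sup>+t. ennreal (cmod (g' t)) * indicator (Q k) t \<partial>lborel)\<^sup>2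
        = (\<integral>\<^sup>+t. (ennreal (cmod (g' t)) * indicator (Q k) t) * indicator (Q k) t \<partial>lborel)\<^sup>2"
      by (intro arg_cong[where f="\<lambda>x. x\<^sup>2"] nn_integral_cong) (auto simp: indicator_def)
    also have "\<dots> \<le> (\<integral>\<^sup>+t. (ennreal (cmod (g' t)) * indicator (Q k) t)\<^sup>2 \<partial>lborel) * (\<integral>\<^sup>+t. (indicator (Q k) t)\<^sup>2 \<partial>lborel)"
      by (rule Cauchy_Schwarz_nn_integral) measurable
    also have "(\<integral>\<^sup>+t. (ennreal (cmod (g' t)) * indicator (Q k) t)\<^sup>2 \<partial>lborel) = ennreal (I k)"
      unfolding sq[OF k, symmetric] by (intro nn_integral_cong) (auto simp: indicator_def ennreal_power)
    also have "(\<integral>\<^sup>+t. (indicator (Q k) t)\<^sup>2 \<partial>lborel) = (\<integral>\<^sup>+t. indicator (Q k) t \<partial>lborel)"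
      by (intro nn_integral_cong) (auto simp: indicator_def)
    also have "\<dots> = 1" by (simp add: Q_def emeasure_unit_cube[simplified])
    also have "ennreal (I k) * 1 = (ennreal (sqrt (I k)))\<^sup>2" using I0[of k] by (simp add: ennreal_power)
    finally show ?thesis by (rule ennreal_power2_le_imp_le) (simp add: I0)
  qed
  have "(\<integral>\<^sup>+t. ennreal (cmod (g' t)) \<partial>lborel) \<le> (\<integral>\<^sup>+k. ennreal (sqrt (I k)) \<partial>count_space integer_points)"
    by (rule order_trans[OF nn_integral_le_cubes]) (measurable, unfold Q_def[symmetric], auto intro!: nn_integral_mono one)
  then show "integrable lborel g'" using fin by (auto simp: integrable_iff_bounded intro: le_less_trans)
  define S where "S = (\<Sum>\<^sub>\<infinity>k\<in>integer_points. sqrt (I k))"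
  have le: "I k \<le> S * sqrt (I k)" if k: "k \<in> integer_points" for k
  proof -
    have "sqrt (I k) \<le> S"
      using finite_sum_le_infsum[OF sum, of "{k}"] k I0 by (simp add: S_def)
    then have "sqrt (I k) * sqrt (I k) \<le> S * sqrt (I k)" using I0[of k] by (intro mult_right_mono) auto
    then show ?thesis using I0[of k] by simp
  qed
  have "(\<integral>\<^sup>+t. ennreal ((cmod (g' t))\<^sup>2) \<partial>lborel) \<le> (\<integral>\<^sup>+k. ennreal (I k) \<partial>count_space integer_points)"
    by (rule order_trans[OF nn_integral_le_cubes]) (measurable, unfold Q_def[symmetric], auto intro!: nn_integral_mono simp: sq)
  also have "\<dots> \<le> (\<integral>\<^sup>+k. ennreal S * ennreal (sqrt (I k)) \<partial>count_space integer_points)"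
    using le I0 by (intro nn_integral_mono) (auto simp: ennreal_mult''[symmetric] intro!: ennreal_leI)
  also have "\<dots> < \<infinity>" using fin by (simp add: nn_integral_cmult ennreal_mult_less_top)
  finally show "integrable lborel (\<lambda>t. (cmod (g' t))\<^sup>2)" by (simp add: integrable_iff_bounded)
qed

section \<open>Symmetric windows and assembly of the equivalence\<close>

lemma fourier_box_density_even: "fourier (box_density c) (- s) = fourier (box_density c) s"
proof -
  have b: "box_density c (- t) = box_density c t" for t by (auto simp: box_density_def indicator_def)
  have "(LINT t|lborel. box_density c t * ue (- (t \<bullet> - s))) = (LINT t|lborel. box_density c t * ue (- (t \<bullet> s)))"
    by (subst lborel_integral_real_affine[of "-1" _ 0]) (simp_all add: b)
  then show ?thesis by (simp add: fourier_lborel)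
qed

lemma symmetric_interval:
  fixes \<Omega> :: "real set"
  assumes "is_interval \<Omega>" "compact \<Omega>" "interior \<Omega> \<noteq> {}" "uminus ` \<Omega> = \<Omega>"
  obtains c where "c > 0" "\<Omega> = {-c..c}"
proof -
  obtain a b where ab: "\<Omega> = {a..b}"
    using assms(1,2) connected_compact_interval_1 is_interval_connected_1 by metis
  with assms(3) have "a < b" by auto
  moreover from assms(4) ab have "{- b..- a} = {a..b}" by simp
  ultimately have "a = - b" by (simp add: Icc_eq_Icc)
  with ab \<open>a < b\<close> show ?thesis by (intro that[of b]) auto
qed

context frame_setup
begin

text \<open>By injectivity of \<open>fst\<close> each point of the model set comes from a single
  lattice vector, so the sum over the set can be indexed by lattice vectors, with membership in the
  window as a weight.\<close>

lemma frame_sum_eq_wsum: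
  assumes inj: "inj_on fst lat"
  shows "(\<Sum>\<^sub>\<infinity>k\<in>K. \<Sum>\<^sub>\<infinity>l\<in>model_set lat {-c..c}. ennreal ((cmod (corr f (g k) l))\<^sup>2)) = wsum {-c..c} f 0 0"
proof -
  let ?A = "{\<gamma> \<in> lat. snd \<gamma> \<in> {-c..c}}"
  have ms: "model_set lat {-c..c} = fst ` ?A" unfolding model_set_def by blast
  have inj': "inj_on fst ?A" using inj by (rule inj_on_subset) auto
  have cA: "countable ?A" using countable_lat by (rule countable_subset[rotated]) auto
  have inner: "(\<Sum>\<^sub>\<infinity>l\<in>model_set lat {-c..c}. ennreal ((cmod (corr f (g k) l))\<^sup>2)) = (\<integral>\<^sup>+\<gamma>. wterm {-c..c} f 0 0 (k, \<gamma>) \<partial>count_space lat)" for k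
  proof -
    have "(\<Sum>\<^sub>\<infinity>l\<in>model_set lat {-c..c}. ennreal ((cmod (corr f (g k) l))\<^sup>2)) = (\<integral>\<^sup>+\<gamma>. ennreal ((cmod (corr f (g k) (fst \<gamma>)))\<^sup>2) \<partial>count_space ?A)"
      unfolding ms infsum_reindex[OF inj'] infsum_ennreal_eq_nn_integral[OF cA] comp_def ..
    also have "\<dots> = (\<integral>\<^sup>+\<gamma>. wterm {-c..c} f 0 0 (k, \<gamma>) \<partial>count_space ?A)"
      by (intro nn_integral_cong) (auto simp: wterm_def)
    also have "\<dots> = (\<integral>\<^sup>+\<gamma>. wterm {-c..c} f 0 0 (k, \<gamma>) \<partial>count_space lat)"
      by (rule nn_integral_count_space_eq) (auto simp: wterm_def)
    finally show ?thesis .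
  qed
  interpret L: sigma_finite_measure "count_space lat" by (rule sigma_finite_measure_count_space_countable[OF countable_lat])
  have cs: "count_space K \<Otimes>\<^sub>M count_space lat = count_space (K \<times> lat)"
    by (rule pair_measure_countable[OF countable_K countable_lat])
  have "(\<integral>\<^sup>+k. (\<integral>\<^sup>+\<gamma>. wterm {-c..c} f 0 0 (k, \<gamma>) \<partial>count_space lat) \<partial>count_space K) = wsum {-c..c} f 0 0"
    unfolding wsum_def cs[symmetric] by (rule L.nn_integral_fst) (simp add: cs)
  then show ?thesis by (simp add: inner infsum_ennreal_eq_nn_integral[OF countable_K])
qed

end

theorem theorem4p7:
  fixes \<Gamma> :: "((real ^ 'm) \<times> real) set"
    and \<Omega> :: "real set"
    and \<epsilon> :: real
    and K :: "'k set"
    and g :: "'k \<Rightarrow> real ^ 'm \<Rightarrow> complex"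
  assumes "full_lattice \<Gamma>"
    and "inj_on fst \<Gamma>" and "inj_on snd \<Gamma>"
    and "closure (fst ` \<Gamma>) = UNIV" and "closure (snd ` \<Gamma>) = UNIV"
    and "is_interval \<Omega>" and "compact \<Omega>" and "interior \<Omega> \<noteq> {}"
    and "uminus ` \<Omega> = \<Omega>"
    and "generic_window \<Gamma> \<Omega>"
    and "generic_window (dual_lattice \<Gamma>) \<Omega>"
    and "0 < \<epsilon>" and "\<epsilon> < 1"
    and "countable K"
    and "\<And>k. k \<in> K \<Longrightarrow> g k \<in> amalgam_space 2 1"
  shows "(\<forall>f \<in> L2_space.
            (\<Sum>\<^sub>\<infinity>k\<in>K. \<Sum>\<^sub>\<infinity>l\<in>model_set \<Gamma> \<Omega>. ennreal ((cmod (L2_inner f (translate l (g k))))\<^sup>2))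
              = ennreal ((L2_norm f)\<^sup>2))
     \<longleftrightarrow>
         (\<forall>\<eta> \<in> dual_lattice \<Gamma>. AE t in lebesgue.
            (\<lambda>k. cnj (fourier (g k) t) * fourier (g k) (t - fst \<eta>)) summable_on K \<and>
            of_real (set_density (model_set \<Gamma> \<Omega>)) * Phi_fun \<epsilon> \<Omega> (- snd \<eta>) *
              (\<Sum>\<^sub>\<infinity>k\<in>K. cnj (fourier (g k) t) * fourier (g k) (t - fst \<eta>))
              = (if \<eta> = 0 then 1 else 0))"
proof -
  obtain B where B: "based_lattice B" and \<Gamma>: "\<Gamma> = based_lattice.lat B"
    using assms(1) unfolding full_lattice_def based_lattice_def by (auto simp: based_lattice.lat_def based_lattice_def)
  obtain c where c: "c > 0" and \<Omega>: "\<Omega> = {-c..c}" using symmetric_interval[OF assms(6-9)] .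
  have cp: "cut_and_project B"
    using B assms(5) by (simp add: cut_and_project_def cut_and_project_axioms_def \<Gamma>)
  have gm: "g k \<in> borel_measurable lebesgue" if "k \<in> K" for k
    using assms(15)[OF that] by (simp add: amalgam_space_def)
  have "\<forall>k\<in>K. \<exists>g'. g' \<in> borel_measurable borel \<and> (AE x in lborel. g k x = g' x)"
    using ex_borel_version[OF gm] by metis
  then obtain g' where g': "\<And>k. k \<in> K \<Longrightarrow> g' k \<in> borel_measurable borel" "\<And>k. k \<in> K \<Longrightarrow> AE x in lborel. g k x = g' k x"
    by metis
  have "snd \<gamma> \<noteq> c" if "\<gamma> \<in> \<Gamma>" for \<gamma>
  proof -
    have "frontier {-c..c} = {-c, c}" using c by (auto simp: frontier_def)
    then show ?thesis using assms(10) that by (auto simp: generic_window_def \<Omega>)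
  qed
  then interpret frame_setup B c K g'
    using c assms(14) amalgam_space_borel_version[OF assms(15) g']
    by (intro frame_setup.intro cp frame_setup_axioms.intro) (auto simp: \<Gamma>)
  have inj: "inj_on fst lat" using assms(2) by (simp add: \<Gamma>)
  have frame: "(\<Sum>\<^sub>\<infinity>k\<in>K. \<Sum>\<^sub>\<infinity>l\<in>model_set \<Gamma> \<Omega>. ennreal ((cmod (L2_inner f (translate l (g k))))\<^sup>2)) = wsum {-c..c} f' 0 0"
    if "f \<in> borel_measurable lebesgue" "f' \<in> borel_measurable borel" "AE x in lborel. f x = f' x" for f f'
    unfolding frame_sum_eq_wsum[OF inj, symmetric] \<Gamma> \<Omega>
    by (intro infsum_cong) (simp add: L2_inner_translate_corr[OF that gm g'])
  have lhs: "(\<forall>f \<in> L2_space.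
            (\<Sum>\<^sub>\<infinity>k\<in>K. \<Sum>\<^sub>\<infinity>l\<in>model_set \<Gamma> \<Omega>. ennreal ((cmod (L2_inner f (translate l (g k))))\<^sup>2))
              = ennreal ((L2_norm f)\<^sup>2)) \<longleftrightarrow>
     (\<forall>f. f \<in> borel_measurable borel \<longrightarrow> integrable lborel (\<lambda>x. (cmod (f x))\<^sup>2) \<longrightarrow> wsum {-c..c} f 0 0 = ennreal (sq_norm f))"
    (is "?L \<longleftrightarrow> ?R")
  proof
    assume L: ?L
    show ?R
    proof (intro allI impI)
      fix f :: "real^'m \<Rightarrow> complex"
      assume f: "f \<in> borel_measurable borel" "integrable lborel (\<lambda>x. (cmod (f x))\<^sup>2)"
      have fm: "f \<in> borel_measurable lebesgue" using f(1) by (intro measurable_completion) simp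
      have ae: "AE x in lborel. f x = f x" by simp
      have "f \<in> L2_space" using f fm L2_space_borel_version(1)[OF fm f(1) ae] by (simp add: L2_space_def)
      then show "wsum {-c..c} f 0 0 = ennreal (sq_norm f)"
        using L frame[OF fm f(1) ae] L2_space_borel_version(2)[OF fm f(1) ae] by simp
    qed
  next
    assume R: ?R
    show ?L
    proof
      fix f :: "real^'m \<Rightarrow> complex" assume "f \<in> L2_space"
      then have f: "f \<in> borel_measurable lebesgue" "integrable lebesgue (\<lambda>t. (cmod (f t))\<^sup>2)" by (auto simp: L2_space_def)
      obtain f' where f': "f' \<in> borel_measurable borel" "AE x in lborel. f x = f' x" using ex_borel_version[OF f(1)] .
      show "(\<Sum>\<^sub>\<infinity>k\<in>K. \<Sum>\<^sub>\<infinity>l\<in>model_set \<Gamma> \<Omega>. ennreal ((cmod (L2_inner f (translate l (g k))))\<^sup>2)) = ennreal ((L2_norm f)\<^sup>2)"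
        using R f'(1) f(2) unfolding frame[OF f(1) f'] L2_space_borel_version[OF f(1) f'] by blast
    qed
  qed
  have fourier: "fourier (g k) = fourier (g' k)" if "k \<in> K" for k
    by (rule fourier_borel_version[OF gm[OF that] g'[OF that]])
  have amp: "of_real (set_density (model_set \<Gamma> \<Omega>)) * Phi_fun \<epsilon> \<Omega> (- snd \<eta>) = amp \<eta>" for \<eta> :: "(real^'m) \<times> real"
  proof -
    have "set_density (model_set \<Gamma> \<Omega>) = 2 * c / covol"
      using set_density_model_set[OF cp inj, of "- c" c] c by (simp add: \<Gamma> \<Omega>)
    then show ?thesis
      by (simp add: \<Omega> Phi_fun_interval[OF assms(12,13) c] fourier_box_density_even)
  qed
  have rhs: "(\<lambda>k. cnj (fourier (g k) t) * fourier (g k) (t - fst \<eta>)) summable_on K \<and>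
            of_real (set_density (model_set \<Gamma> \<Omega>)) * Phi_fun \<epsilon> \<Omega> (- snd \<eta>) *
              (\<Sum>\<^sub>\<infinity>k\<in>K. cnj (fourier (g k) t) * fourier (g k) (t - fst \<eta>)) = (if \<eta> = 0 then 1 else 0)
     \<longleftrightarrow> integrable (count_space K) (\<lambda>k. cnj (fourier (g' k) t) * fourier (g' k) (t - fst \<eta>))
      \<and> amp \<eta> * gram (fst \<eta>) t = (if \<eta> = 0 then 1 else 0)" for \<eta> :: "(real^'m) \<times> real" and t
  proof -
    let ?u = "\<lambda>k. cnj (fourier (g k) t) * fourier (g k) (t - fst \<eta>)"
    let ?v = "\<lambda>k. cnj (fourier (g' k) t) * fourier (g' k) (t - fst \<eta>)"
    have "?u summable_on K \<longleftrightarrow> ?v summable_on K" by (rule summable_on_cong) (simp add: fourier)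
    moreover have "infsum ?u K = infsum ?v K" by (rule infsum_cong) (simp add: fourier)
    \<comment> \<open>Without summability both \<open>infsum\<close> and the Bochner integral take
      default values; as both sides of the equivalence contain the summability clause, their
      agreement is used only under it.\<close>
    moreover have "infsum ?v K = gram (fst \<eta>) t" if "?v summable_on K"
      unfolding gram_def by (rule infsum_eq_integral_count_space[OF that])
    ultimately show ?thesis
      unfolding amp summable_on_iff_integrable_count_space[symmetric] by auto
  qed
  show ?thesis
    unfolding lhs rhs AE_completion_iff using tight_frame_iff by (simp only: \<Gamma>)
qed

end
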